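(* Let $\mathfrak g$ be an odd Lie bialgebra. Then in the vector space $\mathfrak d(\mathfrak g):=\mathfrak g\oplus\Pi\mathfrak g^*$ there is a natural structure of an odd Lie bialgebra uniquely characterized by the following properties: (1) $\mathfrak g$ and $\Pi\mathfrak g^*$ are Lie subalgebras in $\mathfrak d(\mathfrak g)$; (2) the natural odd inner product in $\mathfrak d(\mathfrak g)=\mathfrak g\oplus\Pi\mathfrak g^*$ is $\mathrm{ad}$-invariant; (3) the odd cobracket $\delta:\mathfrak d(\mathfrak g)\to S^2\,\mathfrak d(\mathfrak g)\subset\mathfrak d(\mathfrak g)\otimes\mathfrak d(\mathfrak g)$ is given by the coboundary of the (odd) invariant element $\rho=e_i\varepsilon^i\in S^2(\mathfrak g\oplus\Pi\mathfrak g^* )$.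
   Context: Everything is $\mathbb Z_2$-graded and finite-dimensional; tilde denotes parity; $\Pi$ is parity reversion. $e_i$ is a basis of $\mathfrak g$ ($\tilde e_i=\tilde\imath$), $e^i$ the right-dual basis of $\mathfrak g^*$, $\varepsilon^i=\Pi e^i\in\Pi\mathfrak g^*$ ($\tilde\varepsilon^i=\tilde\imath+1$). Canonical Schouten bracket on $\Pi T^*M$ (coordinates $x^a$ of parity $\tilde a$, odd-conjugate momenta $x^*_a$ of parity $\tilde a+1$): $\{f,g\}=(-1)^{(\tilde a+1)(\tilde f+1)}\frac{\partial f}{\partial x^*_a}\frac{\partial g}{\partial x^a}-(-1)^{\tilde a(\tilde f+1)}\frac{\partial f}{\partial x^a}\frac{\partial g}{\partial x^*_a}$. An even bivector field $P\in C^\infty(\Pi T^*M)$ (quadratic in $x^*_a$) with $\{P,P\}=0$ defines the Poisson bracket $\{f,g\}_P=\{f,\{P,g\}\}$. Odd Lie bialgebra: a Lie superalgebra $\mathfrak g$ such that $\Pi\mathfrak g^*$ is also a Lie superalgebra and the induced structures on the supermanifold $\Pi\mathfrak g$ (linear coordinates $\xi^i$ of parity $\tilde\imath+1$) are compatible: the quadratic homological vector field (odd field of square zero) $\hat Q=\frac12\xi^j\xi^iQ_{ij}^k\partial/\partial\xi^k$ encoding $[e_i,e_j]=(-1)^{\tilde\jmath}Q_{ij}^ke_k$ is a derivation of the linear Poisson bracket with tensor $P=\frac12\xi^kP_k^{ij}\xi^*_j\xi^*_i$ encoding $[\varepsilon^i,\varepsilon^j]=(-1)^{\tilde\imath+1}\varepsilon^kP^{ij}_k$.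 The corresponding odd cobracket on $\mathfrak g$ is the odd linear map $\delta:\mathfrak g\to S^2\mathfrak g$, $\delta(e_k)=(-1)^{\tilde k}P_k^{ij}e_je_i$, where $uv=\frac12(u\otimes v+(-1)^{\tilde u\tilde v}v\otimes u)$ is the symmetric product. The odd cobracket and the Lie bracket on $\Pi\mathfrak g^*$ determine each other. An odd symmetric inner product is an odd nondegenerate bilinear form with $(u,v)=(-1)^{\tilde u+\tilde v+\tilde u\tilde v}(v,u)$; it is $\mathrm{ad}$-invariant if $([u,v],w)+(-1)^{\tilde u(\tilde v+1)}(v,[u,w])=0$ for all $u,v,w$. The natural odd inner product in $\mathfrak g\oplus\Pi\mathfrak g^*$ has as its only nonvanishing products of basis vectors $(e_i,\varepsilon^j)=\delta_i{}^j$, $(\varepsilon^j,e_i)=-\delta_i{}^j$. The element $\rho=e_i\varepsilon^i=\frac12(e_i\otimes\varepsilon^i+\varepsilon^i\otimes e_i)$ (summation over $i$) does not depend on the basis; its coboundary is the map $d\rho(u)=(-1)^{\tilde u}(S^2\mathrm{ad}\,u)(\rho)$. In (1), "Lie subalgebras" means with their given brackets. *)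

theory Defs
  imports "HOL-Analysis.Analysis" "HOL-Library.Z2"
begin

text \<open>
  A finite-dimensional super vector space is given by a homogeneous basis: it is \<^typ>\<open>real^'i\<close>
  together with a parity function \<^typ>\<open>'i \<Rightarrow> bit\<close>, where \<^term>\<open>axis i 1\<close> is the basis vector
  \<open>e\<^sub>i\<close> and \<open>p i\<close> is its parity.  If \<open>\<gg>\<close> is given by \<open>p\<close>, then \<open>\<Pi>\<gg>\<^sup>*\<close>, with the basis
  \<open>\<epsilon>\<^sup>i = \<Pi>e\<^sup>i\<close>, is \<^typ>\<open>real^'i\<close> with the parity function \<open>\<lambda>i. p i + 1\<close>.
\<close>

definition psign :: "bit \<Rightarrow> real" where
  "psign b = (if b = 0 then 1 else - 1)"

definition homogeneous :: "('i::finite \<Rightarrow> bit) \<Rightarrow> bit \<Rightarrow> real^'i \<Rightarrow> bool" where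
  "homogeneous p a u \<longleftrightarrow> (\<forall>i. u $ i \<noteq> 0 \<longrightarrow> p i = a)"

definition lie_superalgebra ::
    "('i::finite \<Rightarrow> bit) \<Rightarrow> (real^'i \<Rightarrow> real^'i \<Rightarrow> real^'i) \<Rightarrow> bool" where
  "lie_superalgebra p br \<longleftrightarrow>
     bilinear br \<and>
     (\<forall>a b u v. homogeneous p a u \<longrightarrow> homogeneous p b v \<longrightarrow> homogeneous p (a + b) (br u v)) \<and>
     (\<forall>a b u v. homogeneous p a u \<longrightarrow> homogeneous p b v \<longrightarrow>
        br u v = - (psign (a * b) *\<^sub>R br v u)) \<and>
     (\<forall>a b c u v w. homogeneous p a u \<longrightarrow> homogeneous p b v \<longrightarrow> homogeneous p c w \<longrightarrow>
        br u (br v w) = br (br u v) w + psign (a * b) *\<^sub>R br v (br u w))"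


section \<open>Smooth functions on superdomains\<close>

definition partial :: "'a::finite \<Rightarrow> (real^'a \<Rightarrow> real) \<Rightarrow> (real^'a \<Rightarrow> real)" where
  "partial a f = (\<lambda>x. frechet_derivative f (at x) (axis a 1))"

definition smooth :: "(real^'a::finite \<Rightarrow> real) \<Rightarrow> bool" where
  "smooth f \<longleftrightarrow> (\<forall>as x. foldr partial as f differentiable (at x))"

text \<open>
  Let \<open>'a\<close> index coordinates \<open>z\<^sup>a\<close> of parity \<open>\<pi> a\<close>.  A function on the corresponding superdomain
  is a sum \<open>\<Sum>S. f\<^sub>S(x) \<theta>\<^sup>S\<close>, with \<open>S\<close> running over the sets of odd coordinates, \<open>\<theta>\<^sup>S\<close> the product of
  the odd coordinates in \<open>S\<close> in increasing order and \<open>f\<^sub>S\<close> a smooth function of the even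
  coordinates; it is represented by the family of its coefficients.  The order is an arbitrary
  fixed enumeration of the index type.  The coefficients formally take an argument in
  \<^typ>\<open>real^'a\<close>, whose components at odd \<open>a\<close> are dummies.
\<close>

type_synonym 'a superfun = "'a set \<Rightarrow> real^'a \<Rightarrow> real"

definition rank :: "'a::finite \<Rightarrow> nat" where
  "rank = to_nat_on (UNIV :: 'a set)"

text \<open>The smooth functions that depend only on the coordinates with index in \<open>A\<close>.\<close>

definition smooth_superfuns :: "('a::finite \<Rightarrow> bit) \<Rightarrow> 'a set \<Rightarrow> 'a superfun set" where
  "smooth_superfuns \<pi> A = {f.
     (\<forall>S. smooth (f S)) \<and>
     (\<forall>S. \<not> S \<subseteq> {a \<in> A. \<pi> a = 1} \<longrightarrow> f S = (\<lambda>x. 0)) \<and>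
     (\<forall>S x y. (\<forall>a\<in>A. \<pi> a = 0 \<longrightarrow> x $ a = y $ a) \<longrightarrow> f S x = f S y)}"

definition sf_part :: "bit \<Rightarrow> 'a::finite superfun \<Rightarrow> 'a superfun" where
  "sf_part b f = (\<lambda>S x. if of_nat (card S) = b then f S x else 0)"

definition sf_homogeneous :: "bit \<Rightarrow> 'a::finite superfun \<Rightarrow> bool" where
  "sf_homogeneous b f \<longleftrightarrow> sf_part b f = f"

definition sf_mult :: "'a::finite superfun \<Rightarrow> 'a superfun \<Rightarrow> 'a superfun" (infixr \<open>\<odot>\<close> 70) where
  "f \<odot> g = (\<lambda>S x. \<Sum>T\<in>Pow S.
     psign (of_nat (card {(a, b). a \<in> T \<and> b \<in> S - T \<and> rank b < rank a})) * (f T x * g (S - T) x))"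

definition sf_coord :: "('a::finite \<Rightarrow> bit) \<Rightarrow> 'a \<Rightarrow> 'a superfun" where
  "sf_coord \<pi> a = (\<lambda>S x. if \<pi> a = 0 then (if S = {} then x $ a else 0)
                         else (if S = {a} then 1 else 0))"

text \<open>Left partial derivatives \<open>\<partial>/\<partial>z\<^sup>a\<close>.\<close>

definition sf_deriv :: "('a::finite \<Rightarrow> bit) \<Rightarrow> 'a \<Rightarrow> 'a superfun \<Rightarrow> 'a superfun" where
  "sf_deriv \<pi> a f = (\<lambda>S x.
     if \<pi> a = 0 then partial a (f S) x
     else if a \<in> S then 0
     else psign (of_nat (card {b \<in> S. rank b < rank a})) * f (insert a S) x)"


section \<open>The Schouten bracket\<close>

text \<open>
  If \<open>M\<close> has coordinates \<open>x\<^sup>a\<close> of parity \<open>q a\<close>, then \<open>\<Pi>T\<^sup>*M\<close> has the coordinates \<open>x\<^sup>a\<close>, indexed by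
  \<open>Inl a\<close>, and the momenta \<open>x\<^sup>*\<^sub>a\<close>, indexed by \<open>Inr a\<close>.  Functions on \<open>M\<close> are identified with their
  pullbacks to \<open>\<Pi>T\<^sup>*M\<close>, that is, with the functions not depending on the momenta.
\<close>

definition antitangent_parity :: "('m \<Rightarrow> bit) \<Rightarrow> 'm + 'm \<Rightarrow> bit" where
  "antitangent_parity q = case_sum q (\<lambda>a. q a + 1)"

definition base_functions :: "('m::finite \<Rightarrow> bit) \<Rightarrow> ('m + 'm) superfun set" where
  "base_functions q = smooth_superfuns (antitangent_parity q) (range Inl)"

text \<open>The sum over \<open>b\<close> extends the formula for \<open>f\<close> of parity \<open>b\<close> additively to all \<open>f\<close>.\<close>

definition schouten ::
    "('m::finite \<Rightarrow> bit) \<Rightarrow> ('m + 'm) superfun \<Rightarrow> ('m + 'm) superfun \<Rightarrow> ('m + 'm) superfun" where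
  "schouten q f g = (let D = sf_deriv (antitangent_parity q) in
     (\<lambda>S x. \<Sum>b\<in>{0, 1}. \<Sum>a\<in>UNIV.
        psign ((q a + 1) * (b + 1)) * (D (Inr a) (sf_part b f) \<odot> D (Inl a) g) S x
        - psign (q a * (b + 1)) * (D (Inl a) (sf_part b f) \<odot> D (Inr a) g) S x))"

definition poisson ::
    "('m::finite \<Rightarrow> bit) \<Rightarrow> ('m + 'm) superfun \<Rightarrow>
     ('m + 'm) superfun \<Rightarrow> ('m + 'm) superfun \<Rightarrow> ('m + 'm) superfun" where
  "poisson q P f g = schouten q f (schouten q P g)"


section \<open>Odd Lie bialgebras\<close>

text \<open>
  In the following, \<open>br\<close> is a bracket on \<open>\<gg>\<close> and \<open>brs\<close> is a bracket on \<open>\<Pi>\<gg>\<^sup>*\<close>.  The supermanifold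
  \<open>\<Pi>\<gg>\<close> has the coordinates \<open>\<xi>\<^sup>i\<close> of parity \<open>p i + 1\<close>.
\<close>

text \<open>\<open>Q\<^sub>i\<^sub>j\<^sup>k\<close>, where \<open>[e\<^sub>i, e\<^sub>j] = (-1)\<^bsup>p j\<^esup> Q\<^sub>i\<^sub>j\<^sup>k e\<^sub>k\<close>\<close>

definition Q_coeff ::
    "('i::finite \<Rightarrow> bit) \<Rightarrow> (real^'i \<Rightarrow> real^'i \<Rightarrow> real^'i) \<Rightarrow> 'i \<Rightarrow> 'i \<Rightarrow> 'i \<Rightarrow> real" where
  "Q_coeff p br i j k = psign (p j) * br (axis i 1) (axis j 1) $ k"

text \<open>\<open>P\<^sub>k\<^sup>i\<^sup>j\<close>, where \<open>[\<epsilon>\<^sup>i, \<epsilon>\<^sup>j] = (-1)\<^bsup>p i + 1\<^esup> \<epsilon>\<^sup>k P\<^sub>k\<^sup>i\<^sup>j\<close>\<close>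

definition P_coeff ::
    "('i::finite \<Rightarrow> bit) \<Rightarrow> (real^'i \<Rightarrow> real^'i \<Rightarrow> real^'i) \<Rightarrow> 'i \<Rightarrow> 'i \<Rightarrow> 'i \<Rightarrow> real" where
  "P_coeff p brs k i j = psign (p i + 1) * brs (axis i 1) (axis j 1) $ k"

definition xi :: "('i::finite \<Rightarrow> bit) \<Rightarrow> 'i \<Rightarrow> ('i + 'i) superfun" where
  "xi p i = sf_coord (antitangent_parity (\<lambda>i. p i + 1)) (Inl i)"

definition xi_star :: "('i::finite \<Rightarrow> bit) \<Rightarrow> 'i \<Rightarrow> ('i + 'i) superfun" where
  "xi_star p i = sf_coord (antitangent_parity (\<lambda>i. p i + 1)) (Inr i)"

definition Q_field ::
    "('i::finite \<Rightarrow> bit) \<Rightarrow> (real^'i \<Rightarrow> real^'i \<Rightarrow> real^'i) \<Rightarrow> ('i + 'i) superfun \<Rightarrow> ('i + 'i) superfun"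
  where
  "Q_field p br f = (let D = sf_deriv (antitangent_parity (\<lambda>i. p i + 1)) in
     (\<lambda>S x. 1/2 * (\<Sum>i\<in>UNIV. \<Sum>j\<in>UNIV. \<Sum>k\<in>UNIV.
        Q_coeff p br i j k * (xi p j \<odot> xi p i \<odot> D (Inl k) f) S x)))"

definition P_tensor ::
    "('i::finite \<Rightarrow> bit) \<Rightarrow> (real^'i \<Rightarrow> real^'i \<Rightarrow> real^'i) \<Rightarrow> ('i + 'i) superfun" where
  "P_tensor p brs = (\<lambda>S x. 1/2 * (\<Sum>i\<in>UNIV. \<Sum>j\<in>UNIV. \<Sum>k\<in>UNIV.
     P_coeff p brs k i j * (xi p k \<odot> xi_star p j \<odot> xi_star p i) S x))"

text \<open>
  Since the Poisson bracket is even and \<open>Q\<close> is odd, the derivation property reads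
  \<open>Q{f,g} = {Qf,g} + (-1)\<^bsup>b\<^esup>{f,Qg}\<close> for \<open>f\<close> of parity \<open>b\<close>.  The identities \<open>Q\<^sup>2 = 0\<close> and \<open>{P,P} = 0\<close>
  need not be required: they express the two Jacobi identities.
\<close>

definition odd_lie_bialgebra ::
    "('i::finite \<Rightarrow> bit) \<Rightarrow> (real^'i \<Rightarrow> real^'i \<Rightarrow> real^'i) \<Rightarrow> (real^'i \<Rightarrow> real^'i \<Rightarrow> real^'i) \<Rightarrow> bool"
  where
  "odd_lie_bialgebra p br brs \<longleftrightarrow>
     lie_superalgebra p br \<and>
     lie_superalgebra (\<lambda>i. p i + 1) brs \<and>
     (let Q = Q_field p br;
          pb = poisson (\<lambda>i. p i + 1) (P_tensor p brs);
          C = base_functions (\<lambda>i. p i + 1)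
      in \<forall>b. \<forall>f\<in>C. \<forall>g\<in>C. sf_homogeneous b f \<longrightarrow>
           Q (pb f g) = (\<lambda>S x. pb (Q f) g S x + psign b * pb f (Q g) S x))"


section \<open>Tensors and the odd cobracket\<close>

text \<open>An element \<open>t\<close> of \<open>V \<otimes> V\<close> is the matrix of its coefficients: \<open>t $ i $ j\<close> belongs to \<open>e\<^sub>i \<otimes> e\<^sub>j\<close>.\<close>

definition tensor :: "real^'i::finite \<Rightarrow> real^'i \<Rightarrow> real^'i^'i" where
  "tensor u v = (\<chi> i j. u $ i * v $ j)"

text \<open>
  The bilinear map with \<open>uv = (u \<otimes> v + (-1)\<^bsup>ab\<^esup> v \<otimes> u) / 2\<close> for \<open>u\<close>, \<open>v\<close> of parities \<open>a\<close>, \<open>b\<close>; the factors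
  \<open>u $ j\<close> and \<open>v $ i\<close> select the components of parity \<open>p j\<close> and \<open>p i\<close>.
\<close>

definition sym_prod :: "('i::finite \<Rightarrow> bit) \<Rightarrow> real^'i \<Rightarrow> real^'i \<Rightarrow> real^'i^'i" where
  "sym_prod p u v = (\<chi> i j. 1/2 * (u $ i * v $ j + psign (p i * p j) * (v $ i * u $ j)))"

definition odd_cobracket ::
    "('i::finite \<Rightarrow> bit) \<Rightarrow> (real^'i \<Rightarrow> real^'i \<Rightarrow> real^'i) \<Rightarrow> real^'i \<Rightarrow> real^'i^'i" where
  "odd_cobracket p brs u = (\<Sum>k\<in>UNIV. u $ k *\<^sub>R (psign (p k) *\<^sub>R
     (\<Sum>i\<in>UNIV. \<Sum>j\<in>UNIV. P_coeff p brs k i j *\<^sub>R sym_prod p (axis j 1) (axis i 1))))"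

text \<open>\<open>ad u \<otimes> 1 + 1 \<otimes> ad u\<close> for \<open>u\<close> of parity \<open>a\<close>, which restricts to \<open>S\<^sup>2 ad u\<close> on \<open>S\<^sup>2V\<close>\<close>

definition ad_tensor ::
    "('i::finite \<Rightarrow> bit) \<Rightarrow> (real^'i \<Rightarrow> real^'i \<Rightarrow> real^'i) \<Rightarrow> bit \<Rightarrow> real^'i \<Rightarrow> real^'i^'i \<Rightarrow> real^'i^'i"
  where
  "ad_tensor p br a u t = (\<Sum>i\<in>UNIV. \<Sum>j\<in>UNIV. t $ i $ j *\<^sub>R
     (tensor (br u (axis i 1)) (axis j 1) + psign (a * p i) *\<^sub>R tensor (axis i 1) (br u (axis j 1))))"

definition cobracket_is_coboundary ::
    "('i::finite \<Rightarrow> bit) \<Rightarrow> (real^'i \<Rightarrow> real^'i \<Rightarrow> real^'i) \<Rightarrow> (real^'i \<Rightarrow> real^'i \<Rightarrow> real^'i) \<Rightarrow>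
     real^'i^'i \<Rightarrow> bool" where
  "cobracket_is_coboundary p br brs \<rho> \<longleftrightarrow>
     (\<forall>a u. homogeneous p a u \<longrightarrow> odd_cobracket p brs u = psign a *\<^sub>R ad_tensor p br a u \<rho>)"


section \<open>The space \<open>\<gg> \<oplus> \<Pi>\<gg>\<^sup>*\<close>\<close>

text \<open>The basis of \<open>\<gg> \<oplus> \<Pi>\<gg>\<^sup>*\<close> consists of the \<open>e\<^sub>i\<close>, indexed by \<open>Inl i\<close>, and the \<open>\<epsilon>\<^sup>i\<close>, indexed by \<open>Inr i\<close>.\<close>

definition double_parity :: "('i \<Rightarrow> bit) \<Rightarrow> 'i + 'i \<Rightarrow> bit" where
  "double_parity p = case_sum p (\<lambda>i. p i + 1)"

definition in_g :: "real^'i::finite \<Rightarrow> real^('i + 'i)" where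
  "in_g u = (\<chi> c. case c of Inl i \<Rightarrow> u $ i | Inr i \<Rightarrow> 0)"

definition in_dual :: "real^'i::finite \<Rightarrow> real^('i + 'i)" where
  "in_dual v = (\<chi> c. case c of Inl i \<Rightarrow> 0 | Inr i \<Rightarrow> v $ i)"

definition natural_form :: "real^('i::finite + 'i) \<Rightarrow> real^('i + 'i) \<Rightarrow> real" where
  "natural_form u v = (\<Sum>i\<in>UNIV. u $ Inl i * v $ Inr i - u $ Inr i * v $ Inl i)"

definition ad_invariant ::
    "('i::finite \<Rightarrow> bit) \<Rightarrow> (real^'i \<Rightarrow> real^'i \<Rightarrow> real^'i) \<Rightarrow> (real^'i \<Rightarrow> real^'i \<Rightarrow> real) \<Rightarrow> bool" where
  "ad_invariant p br B \<longleftrightarrow>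
     (\<forall>a b u v w. homogeneous p a u \<longrightarrow> homogeneous p b v \<longrightarrow>
        B (br u v) w + psign (a * (b + 1)) * B v (br u w) = 0)"

definition rho :: "('i::finite \<Rightarrow> bit) \<Rightarrow> real^('i + 'i)^('i + 'i)" where
  "rho p = (\<Sum>i\<in>UNIV. sym_prod (double_parity p) (axis (Inl i) 1) (axis (Inr i) 1))"

end

theory Submission
  imports Defs
begin

text \<open>
  The compatibility condition concerns all smooth superfunctions, but the coordinate derivatives
  supercommute, so all second derivatives cancel from
  \<open>Q{f,g} - {Qf,g} - (-1)\<^bsup>b\<^esup>{f,Qg}\<close>.  What is left is of first order in \<open>f\<close> and in \<open>g\<close>: it is
  the biderivation given by the Lie derivative of the Poisson tensor along \<open>Q\<close>.  Its components are
  quadratic in the coordinates, and their vanishing says that the odd cobracket is a 1-cocycle of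
  \<open>\<gg>\<close> with values in \<open>S\<^sup>2\<gg>\<close>.

  On \<open>\<gg> \<oplus> \<Pi>\<gg>\<^sup>*\<close>, invariance of the inner product forces the brackets \<open>[e\<^sub>i, \<epsilon>\<^sup>j]\<close>, and \<open>d\<rho>\<close> then forces the
  cobracket.  Paired with a fourth vector, the Jacobi identity becomes a condition symmetric in four
  arguments.  If all of them, or all but one, lie in the same summand, it is trivial or a Jacobi
  identity of \<open>\<gg>\<close> or \<open>\<Pi>\<gg>\<^sup>*\<close>; if two lie in each, it is the cocycle condition of \<open>\<gg>\<close>.  The coboundary
  \<open>d\<rho>\<close> turns out to encode the direct sum of the brackets of \<open>\<Pi>\<gg>\<^sup>*\<close> and \<open>\<gg>\<close>, whence the Jacobi identity
  of the dual bracket, and being a coboundary it is a cocycle.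
\<close>

text \<open>Two obstacles shape the proof. The first is that the hypothesis speaks of arbitrary
  smooth superfunctions, while the double is built from structure constants. The bridge is that a
  biderivation is determined by its values on coordinates; the cancellation of second derivatives
  rests on the symmetry of mixed partials, which is derived here from a symmetric second difference.
  The second obstacle is that signs depend on the parities of the arguments. For functions they are
  turned into the operator \<open>twist\<close>, so that nothing is split into homogeneous parts.
  For structure constants, a nonzero constant fixes the parity of the summed index, so that signs
  leave the sums. The fourfold symmetry of the paired Jacobi identity has a simple source:
  invariance turns a double bracket paired with a fourth vector into the inner product of two
  brackets, and four vectors split into two pairs in just three ways. The direct sum in
  \<open>d\<rho>\<close> arises because the two halves of \<open>\<rho>\<close> contribute equally
  when all three indices lie in one summand, and cancel or vanish otherwise.\<close>

section \<open>Signs\<close>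

text \<open>These two rules would rewrite sums and products of parities into \<open>of_bool\<close> expressions.\<close>

declare add_bit_eq_xor [simp del] mult_bit_eq_and [simp del]

lemma bit_add_self [simp]: "a + a = 0" "a + (a + b) = b" for a b :: bit
  by (cases a; cases b; simp)+

lemma bit_add_one_one [simp]: "a + 1 + 1 = a" "1 + (1 + a) = a" "a + (1 + 1) = a" for a :: bit
  by (cases a; simp)+

lemma bit_mult_self [simp]: "a * a = a" "a * (a * b) = a * b" for a b :: bit
  by (cases a; cases b; simp)+

lemma psign_simps [simp]: "psign 0 = 1" "psign 1 = -1"
  by (simp_all add: psign_def)

lemma psign_add: "psign (a + b) = psign a * psign b"
  by (cases a; cases b) simp_all

lemma psign_mult_self [simp]: "psign a * psign a = 1" "psign a * (psign a * x) = x"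
  "psign a * (x * psign a) = x"
  by (cases a; simp)+

lemma psign_of_nat: "psign (of_nat n) = (-1) ^ n"
proof (induction n)
  case (Suc n)
  have "psign (of_nat (Suc n)) = psign 1 * psign (of_nat n)"
    by (simp only: of_nat_Suc psign_add)
  with Suc show ?case by simp
qed simp

lemma psign_eq_0 [simp]: "psign a \<noteq> 0"
  by (cases a) simp_all


section \<open>Smooth functions\<close>

lemma smooth_differentiable: "smooth f \<Longrightarrow> f differentiable (at x)"
  unfolding smooth_def by (drule spec[of _ "[]"]) simp

lemma smooth_partial:
  assumes "smooth f" shows "smooth (partial a f)"
  unfolding smooth_def
proof (intro allI)
  fix as x
  have "foldr partial (as @ [a]) f differentiable (at x)"
    using assms by (simp only: smooth_def)
  then show "foldr partial as (partial a f) differentiable (at x)"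
    by simp
qed

text \<open>Iterated partial derivatives never leave \<open>X\<close>, so smoothness follows from
  exhibiting a class of differentiable functions that is stable under
  \<open>partial\<close>.\<close>

lemma smooth_coinduct:
  assumes "X f"
    and "\<And>f x. X f \<Longrightarrow> f differentiable (at x)"
    and "\<And>f a. X f \<Longrightarrow> X (partial a f)"
  shows "smooth f"
proof -
  have "X (foldr partial as f)" for as
    by (induction as) (use assms in auto)
  then show ?thesis
    using assms(2) by (simp add: smooth_def)
qed

lemma partial_const [simp]: "partial a (\<lambda>x. c) = (\<lambda>x. 0)"
  by (simp add: partial_def)

lemma partial_eqI:
  assumes "\<And>x. (f has_derivative f' x) (at x)"
  shows "partial a f = (\<lambda>x. f' x (axis a 1))"
  using frechet_derivative_at[OF assms] by (simp add: partial_def)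

lemma partial_has_derivative:
  "f differentiable (at x) \<Longrightarrow> (f has_derivative frechet_derivative f (at x)) (at x)"
  by (simp add: frechet_derivative_works)

lemma partial_add:
  assumes "\<And>x. f differentiable (at x)" "\<And>x. g differentiable (at x)"
  shows "partial a (\<lambda>x. f x + g x) = (\<lambda>x. partial a f x + partial a g x)"
  unfolding partial_def[of a f] partial_def[of a g]
  by (rule partial_eqI) (intro has_derivative_add partial_has_derivative assms)

lemma partial_mult:
  assumes "\<And>x. f differentiable (at x)" "\<And>x. g differentiable (at x)"
  shows "partial a (\<lambda>x. f x * g x) = (\<lambda>x. f x * partial a g x + partial a f x * g x)"
  unfolding partial_def[of a f] partial_def[of a g]
  by (rule partial_eqI) (intro has_derivative_mult partial_has_derivative assms)

lemma partial_cmult: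
  assumes "\<And>x. f differentiable (at x)"
  shows "partial a (\<lambda>x. c * f x) = (\<lambda>x. c * partial a f x)"
  using partial_mult[of "\<lambda>x. c" f a] assms by simp

lemma partial_nth: "partial a (\<lambda>x. x $ b) = (\<lambda>x. if a = b then 1 else 0)"
proof -
  have "partial a (\<lambda>x. x $ b) = (\<lambda>x. axis a 1 $ b)"
    by (rule partial_eqI) (simp add: bounded_linear_imp_has_derivative bounded_linear_vec_nth)
  then show ?thesis by (simp add: axis_def eq_commute)
qed

text \<open>Products alone are not stable under \<open>partial\<close>, because the product rule
  yields a sum of products. The class generated by sums and products is, so
  \<open>smooth_coinduct\<close> settles both closure properties at once.\<close>

inductive smooth_gen :: "(real^'a::finite \<Rightarrow> real) \<Rightarrow> bool" where
  base: "smooth f \<Longrightarrow> smooth_gen f"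
| add: "smooth_gen f \<Longrightarrow> smooth_gen g \<Longrightarrow> smooth_gen (\<lambda>x. f x + g x)"
| mult: "smooth_gen f \<Longrightarrow> smooth_gen g \<Longrightarrow> smooth_gen (\<lambda>x. f x * g x)"

lemma smooth_gen_smooth:
  assumes "smooth_gen f" shows "smooth f"
proof (rule smooth_coinduct[where X = smooth_gen, OF assms])
  have *: "(\<forall>x. f differentiable (at x)) \<and> (\<forall>a. smooth_gen (partial a f))"
    if "smooth_gen f" for f :: "real^'a \<Rightarrow> real"
    using that
  proof induction
    case (base f)
    then show ?case by (auto intro: smooth_gen.base smooth_partial smooth_differentiable)
  next
    case (add f g)
    then show ?case by (auto simp: partial_add intro!: smooth_gen.add)
  next
    case (mult f g)
    then show ?case by (auto simp: partial_mult intro!: smooth_gen.add smooth_gen.mult)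
  qed
  show "f differentiable (at x)" if "smooth_gen f" for f :: "real^'a \<Rightarrow> real" and x
    using *[OF that] by blast
  show "smooth_gen (partial a f)" if "smooth_gen f" for f :: "real^'a \<Rightarrow> real" and a
    using *[OF that] by blast
qed

lemma smooth_const: "smooth (\<lambda>x. c)"
  by (rule smooth_coinduct[where X = "\<lambda>f. \<exists>c. f = (\<lambda>x. c)"]) auto

lemma smooth_nth: "smooth (\<lambda>x. x $ b)"
proof (rule smooth_coinduct[where X = "\<lambda>f. (\<exists>c. f = (\<lambda>x. c)) \<or> f = (\<lambda>x. x $ b)"])
  fix f :: "real^'a \<Rightarrow> real" and x a
  assume "(\<exists>c. f = (\<lambda>x. c)) \<or> f = (\<lambda>x. x $ b)"
  then show "f differentiable (at x)"
    using bounded_linear_imp_differentiable[OF bounded_linear_vec_nth] by auto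
qed (auto simp: partial_nth)

lemma smooth_add: "smooth f \<Longrightarrow> smooth g \<Longrightarrow> smooth (\<lambda>x. f x + g x)"
  by (rule smooth_gen_smooth, rule smooth_gen.add) (rule smooth_gen.base, assumption)+

lemma smooth_mult: "smooth f \<Longrightarrow> smooth g \<Longrightarrow> smooth (\<lambda>x. f x * g x)"
  by (rule smooth_gen_smooth, rule smooth_gen.mult) (rule smooth_gen.base, assumption)+

lemma smooth_cmult: "smooth f \<Longrightarrow> smooth (\<lambda>x. c * f x)"
  by (intro smooth_mult smooth_const)

lemma smooth_minus: "smooth f \<Longrightarrow> smooth (\<lambda>x. - f x)"
  using smooth_cmult[of f "-1"] by simp

lemma smooth_diff: "smooth f \<Longrightarrow> smooth g \<Longrightarrow> smooth (\<lambda>x. f x - g x)"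
  using smooth_add[of f "\<lambda>x. - g x"] smooth_minus[of g] by simp

lemma smooth_sum: "(\<And>i. i \<in> I \<Longrightarrow> smooth (f i)) \<Longrightarrow> smooth (\<lambda>x. \<Sum>i\<in>I. f i x)"
  by (induction I rule: infinite_finite_induct) (simp_all add: smooth_const smooth_add)

lemma partial_sum:
  assumes "\<And>i. i \<in> I \<Longrightarrow> smooth (f i)"
  shows "partial a (\<lambda>x. \<Sum>i\<in>I. f i x) = (\<lambda>x. \<Sum>i\<in>I. partial a (f i) x)"
  using assms
proof (induction I rule: infinite_finite_induct)
  case (insert i I)
  then show ?case
    using partial_add[of "f i" "\<lambda>x. \<Sum>i\<in>I. f i x" a] smooth_sum[of I f]
    by (simp add: smooth_differentiable)
qed simp_all

section \<open>Symmetry of second partial derivatives\<close>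

lemma DERIV_along_axis:
  assumes "f differentiable (at (y + s *\<^sub>R axis a 1))"
  shows "((\<lambda>s. f (y + s *\<^sub>R axis a 1)) has_real_derivative partial a f (y + s *\<^sub>R axis a 1)) (at s)"
proof -
  let ?F = "frechet_derivative f (at (y + s *\<^sub>R axis a 1))"
  have "((\<lambda>s. y + s *\<^sub>R axis a 1) has_derivative (\<lambda>h. h *\<^sub>R axis a 1)) (at s)"
    by (auto intro!: derivative_eq_intros)
  from diff_chain_at[OF this partial_has_derivative[OF assms]]
  have "((\<lambda>s. f (y + s *\<^sub>R axis a 1)) has_derivative (\<lambda>h. ?F (h *\<^sub>R axis a 1))) (at s)"
    by (simp add: o_def)
  moreover have "(\<lambda>h. ?F (h *\<^sub>R axis a 1)) = (*) (partial a f (y + s *\<^sub>R axis a 1))"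
    using linear_frechet_derivative[OF assms] by (simp add: fun_eq_iff linear_cmul partial_def)
  ultimately show ?thesis
    by (simp add: has_field_derivative_def)
qed

text \<open>The mean value theorem is applied twice: along \<open>axis a 1\<close> to the increment
  of \<open>f\<close> in direction \<open>axis b 1\<close>, then along \<open>axis b 1\<close> to
  \<open>partial a f\<close>. Each application moves the point by less than \<open>h\<close>, hence
  the bound \<open>2 * h\<close>.\<close>

lemma second_difference:
  assumes f: "smooth f" and h: "h > (0::real)"
  shows "\<exists>y. norm (y - x) \<le> 2 * h \<and>
    f (x + h *\<^sub>R axis a 1 + h *\<^sub>R axis b 1) - f (x + h *\<^sub>R axis a 1) - f (x + h *\<^sub>R axis b 1) + f x
      = h * h * partial b (partial a f) y"
proof -
  define A where "A = (axis a 1 :: real^'a)"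
  define B where "B = (axis b 1 :: real^'a)"
  have nrm: "norm A = 1" "norm B = 1" by (simp_all add: A_def B_def)
  let ?\<phi> = "\<lambda>s. f ((x + h *\<^sub>R B) + s *\<^sub>R A) - f (x + s *\<^sub>R A)"
  have "(?\<phi> has_real_derivative
      partial a f ((x + h *\<^sub>R B) + s *\<^sub>R A) - partial a f (x + s *\<^sub>R A)) (at s)" for s
    unfolding A_def by (intro DERIV_diff DERIV_along_axis smooth_differentiable f)
  with MVT2[OF h, of ?\<phi> "\<lambda>s. partial a f ((x + h *\<^sub>R B) + s *\<^sub>R A) - partial a f (x + s *\<^sub>R A)"]
  obtain s where s: "0 < s" "s < h"
    and eq1: "?\<phi> h - ?\<phi> 0 = (h - 0) * (partial a f ((x + h *\<^sub>R B) + s *\<^sub>R A) - partial a f (x + s *\<^sub>R A))"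
    by metis
  let ?\<psi> = "\<lambda>t. partial a f ((x + s *\<^sub>R A) + t *\<^sub>R B)"
  have "(?\<psi> has_real_derivative partial b (partial a f) ((x + s *\<^sub>R A) + t *\<^sub>R B)) (at t)" for t
    unfolding B_def by (intro DERIV_along_axis smooth_differentiable smooth_partial f)
  with MVT2[OF h, of ?\<psi> "\<lambda>t. partial b (partial a f) ((x + s *\<^sub>R A) + t *\<^sub>R B)"]
  obtain t where t: "0 < t" "t < h"
    and eq2: "?\<psi> h - ?\<psi> 0 = (h - 0) * partial b (partial a f) ((x + s *\<^sub>R A) + t *\<^sub>R B)"
    by metis
  have "norm ((x + s *\<^sub>R A) + t *\<^sub>R B - x) \<le> norm (s *\<^sub>R A) + norm (t *\<^sub>R B)"
    by (metis add.assoc add_diff_cancel_left' norm_triangle_ineq)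
  also have "\<dots> \<le> 2 * h" using s t nrm by simp
  finally have "norm ((x + s *\<^sub>R A) + t *\<^sub>R B - x) \<le> 2 * h" .
  moreover have "f (x + h *\<^sub>R A + h *\<^sub>R B) - f (x + h *\<^sub>R A) - f (x + h *\<^sub>R B) + f x
      = h * h * partial b (partial a f) ((x + s *\<^sub>R A) + t *\<^sub>R B)"
  proof -
    have "f (x + h *\<^sub>R A + h *\<^sub>R B) - f (x + h *\<^sub>R A) - f (x + h *\<^sub>R B) + f x = ?\<phi> h - ?\<phi> 0"
      by (simp add: algebra_simps)
    also have "\<dots> = h * (?\<psi> h - ?\<psi> 0)"
      using eq1 by (simp add: algebra_simps)
    also have "\<dots> = h * h * partial b (partial a f) ((x + s *\<^sub>R A) + t *\<^sub>R B)"
      using eq2 by simp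
    finally show ?thesis .
  qed
  ultimately show ?thesis unfolding A_def B_def by blast
qed

text \<open>The second difference is symmetric in \<open>a\<close> and \<open>b\<close>, so
  arbitrarily near \<open>x\<close> the two mixed derivatives share a value, possibly at different
  points; continuity carries this to \<open>x\<close>.\<close>

lemma partial_commute:
  assumes f: "smooth f"
  shows "partial a (partial b f) = partial b (partial a f)"
proof
  fix x
  let ?F = "partial a (partial b f)" and ?G = "partial b (partial a f)"
  have cont: "isCont ?F x" "isCont ?G x"
    by (intro differentiable_imp_continuous_within smooth_differentiable smooth_partial f)+
  show "?F x = ?G x"
  proof (rule ccontr)
    assume ne: "?F x \<noteq> ?G x"
    \<comment> \<open>Half the gap: numbers within \<open>e\<close> of the two values cannot
      coincide.\<close>
    define e where "e = \<bar>?F x - ?G x\<bar> / 2"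
    have e: "e > 0" using ne by (simp add: e_def)
    from cont(1) e obtain d1 where d1: "d1 > 0" "\<And>y. dist y x < d1 \<Longrightarrow> dist (?F y) (?F x) < e"
      unfolding continuous_at_eps_delta by meson
    from cont(2) e obtain d2 where d2: "d2 > 0" "\<And>y. dist y x < d2 \<Longrightarrow> dist (?G y) (?G x) < e"
      unfolding continuous_at_eps_delta by meson
    \<comment> \<open>The points supplied by \<open>second_difference\<close> lie within
      \<open>2 * h\<close> of \<open>x\<close>, so a third of the radius keeps them inside the
      balls.\<close>
    define h where "h = min d1 d2 / 3"
    have h: "h > 0" "2 * h < d1" "2 * h < d2" using d1 d2 by (auto simp: h_def)
    obtain y where y: "norm (y - x) \<le> 2 * h" and y': 
      "f (x + h *\<^sub>R axis a 1 + h *\<^sub>R axis b 1) - f (x + h *\<^sub>R axis a 1) - f (x + h *\<^sub>R axis b 1) + f x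
        = h * h * ?G y"
      using second_difference[OF f h(1)] by blast
    obtain z where z: "norm (z - x) \<le> 2 * h" and z':
      "f (x + h *\<^sub>R axis b 1 + h *\<^sub>R axis a 1) - f (x + h *\<^sub>R axis b 1) - f (x + h *\<^sub>R axis a 1) + f x
        = h * h * ?F z"
      using second_difference[OF f h(1)] by blast
    have "h * h * ?G y = h * h * ?F z"
      unfolding y'[symmetric] z'[symmetric] by (simp add: algebra_simps)
    then have "?G y = ?F z" using h by simp
    moreover have "dist z x < d1" "dist y x < d2"
      using y z h by (auto simp: dist_norm)
    then have "dist (?F z) (?F x) < e" "dist (?G y) (?G x) < e"
      by (blast intro: d1(2) d2(2))+
    ultimately have "\<bar>?F x - ?G x\<bar> < 2 * e"
      unfolding dist_real_def by linarith
    then show False by (simp add: e_def)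
  qed
qed


section \<open>The algebra of superfunctions\<close>

lemma psign_inject: "psign a = psign b \<longleftrightarrow> a = b"
  by (cases a; cases b) simp_all

lemma rank_eq_iff [simp]: "rank a = rank b \<longleftrightarrow> a = b"
  unfolding rank_def by (simp add: countable_finite inj_on_eq_iff[OF inj_on_to_nat_on])

text \<open>The sign of sorting the product of the odd coordinates in \<open>T\<close> and those in
  \<open>U\<close>, with a factor -1 for each inversion. As a double product it is visibly
  multiplicative over disjoint unions in either argument.\<close>

definition shuffle_sign :: "'a::finite set \<Rightarrow> 'a set \<Rightarrow> real" where
  "shuffle_sign T U = (\<Prod>a\<in>T. \<Prod>b\<in>U. if rank b < rank a then - 1 else 1)"

lemma psign_inversions:
  "psign (of_nat (card {(a, b). a \<in> T \<and> b \<in> U \<and> rank b < rank a})) = shuffle_sign T U"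
proof -
  have "shuffle_sign T U = (\<Prod>z\<in>T \<times> U. if rank (snd z) < rank (fst z) then - 1 else 1)"
    by (simp add: shuffle_sign_def prod.cartesian_product case_prod_unfold)
  also have "\<dots> = (- 1) ^ card ((T \<times> U) \<inter> {z. rank (snd z) < rank (fst z)})"
    by (subst prod.If_cases) simp_all
  also have "(T \<times> U) \<inter> {z. rank (snd z) < rank (fst z)} = {(a, b). a \<in> T \<and> b \<in> U \<and> rank b < rank a}"
    by auto
  finally show ?thesis by (simp add: psign_of_nat)
qed

lemma psign_inversions_singleton:
  "psign (of_nat (card {b \<in> S. rank b < rank a})) = shuffle_sign {a} S"
proof -
  have "{(a', b). a' \<in> {a} \<and> b \<in> S \<and> rank b < rank a'} = Pair a ` {b \<in> S. rank b < rank a}"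
    by auto
  then show ?thesis
    by (simp add: psign_inversions[symmetric] card_image inj_on_def)
qed

lemma shuffle_sign_empty [simp]: "shuffle_sign {} U = 1" "shuffle_sign T {} = 1"
  by (simp_all add: shuffle_sign_def)

lemma shuffle_sign_Un_left:
  "T \<inter> T' = {} \<Longrightarrow> shuffle_sign (T \<union> T') U = shuffle_sign T U * shuffle_sign T' U"
  by (simp add: shuffle_sign_def prod.union_disjoint)

lemma shuffle_sign_Un_right:
  "U \<inter> U' = {} \<Longrightarrow> shuffle_sign T (U \<union> U') = shuffle_sign T U * shuffle_sign T U'"
  by (simp add: shuffle_sign_def prod.union_disjoint prod.distrib)

lemma shuffle_sign_insert_left:
  "a \<notin> T \<Longrightarrow> shuffle_sign (insert a T) U = shuffle_sign {a} U * shuffle_sign T U"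
  by (simp add: shuffle_sign_def)

lemma shuffle_sign_insert_right:
  "a \<notin> U \<Longrightarrow> shuffle_sign T (insert a U) = shuffle_sign T {a} * shuffle_sign T U"
  by (simp add: shuffle_sign_def prod.distrib)

lemma shuffle_sign_square: "shuffle_sign T U * shuffle_sign T U = 1"
  unfolding psign_inversions[symmetric] by simp

lemma shuffle_sign_square_left [simp]: "shuffle_sign T U * (shuffle_sign T U * x) = x"
  by (simp add: mult.assoc[symmetric] shuffle_sign_square)

text \<open>By disjointness every pair is an inversion in exactly one of the two orders, so the two
  signs multiply to -1 to the power \<open>card T * card U\<close>.\<close>

lemma shuffle_sign_swap:
  assumes "T \<inter> U = {}"
  shows "shuffle_sign T U = psign (of_nat (card T) * of_nat (card U)) * shuffle_sign U T"
proof -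
  have "shuffle_sign U T = (\<Prod>a\<in>T. \<Prod>b\<in>U. if rank a < rank b then - 1 else 1)"
    unfolding shuffle_sign_def by (rule prod.swap)
  then have "shuffle_sign T U * shuffle_sign U T =
      (\<Prod>a\<in>T. \<Prod>b\<in>U. (if rank b < rank a then - 1 else 1) * (if rank a < rank b then - 1 else 1))"
    by (simp add: shuffle_sign_def prod.distrib)
  also have "\<dots> = (\<Prod>a\<in>T. \<Prod>b\<in>U. - 1)"
  proof (intro prod.cong refl)
    fix a b assume "a \<in> T" "b \<in> U"
    with assms have "rank a \<noteq> rank b" by auto
    then show "(if rank b < rank a then - 1 else 1) * (if rank a < rank b then - 1 else 1) = (- 1 :: real)"
      by auto
  qed
  also have "\<dots> = psign (of_nat (card U * card T))"
    by (simp add: psign_of_nat power_mult del: of_nat_mult)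
  finally have "shuffle_sign T U * shuffle_sign U T * shuffle_sign U T
      = psign (of_nat (card T) * of_nat (card U)) * shuffle_sign U T"
    by (simp add: mult.commute)
  then show ?thesis by (simp add: mult.assoc shuffle_sign_square)
qed

lemma sum_Pow_insert:
  fixes h :: "'a::finite set \<Rightarrow> 'b::comm_monoid_add"
  assumes "a \<notin> S"
  shows "(\<Sum>T\<in>Pow (insert a S). h T) = (\<Sum>T\<in>Pow S. h T) + (\<Sum>T\<in>Pow S. h (insert a T))"
proof -
  have "Pow S \<inter> insert a ` Pow S = {}" "inj_on (insert a) (Pow S)"
    using assms by (auto simp: inj_on_def)
  then show ?thesis
    by (simp add: Pow_insert sum.union_disjoint sum.reindex)
qed

text \<open>Smoothness is built into the type because linearity and the Leibniz rule for even
  derivatives need differentiable coefficients. The sets \<open>S\<close> range over all indices, so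
  one algebra serves every parity function.\<close>

typedef (overloaded) 'a sfun = "{f :: 'a::finite superfun. \<forall>S. smooth (f S)}"
  morphisms coeffs Sfun
  by (rule exI[of _ "\<lambda>S x. 0"]) (simp add: smooth_const)

setup_lifting type_definition_sfun

lemma smooth_coeffs [simp]: "smooth (coeffs f S)"
  using coeffs[of f] by simp

lemma differentiable_coeffs [simp]: "coeffs f S differentiable (at x)"
  by (simp add: smooth_differentiable)

lemma sfun_eqI: "(\<And>S x. coeffs f S x = coeffs g S x) \<Longrightarrow> f = g"
  by (metis coeffs_inject ext)

lemma sf_mult_eq:
  "(f \<odot> g) S x = (\<Sum>T\<in>Pow S. shuffle_sign T (S - T) * (f T x * g (S - T) x))"
  by (simp only: sf_mult_def psign_inversions)

instantiation sfun :: (finite) real_algebra_1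
begin

lift_definition zero_sfun :: "'a sfun" is "\<lambda>S x. 0" by (rule smooth_const)
lift_definition one_sfun :: "'a sfun" is "\<lambda>S x. if S = {} then 1 else 0" by (rule smooth_const)
lift_definition plus_sfun :: "'a sfun \<Rightarrow> 'a sfun \<Rightarrow> 'a sfun" is "\<lambda>f g S x. f S x + g S x"
  by (simp add: smooth_add)
lift_definition uminus_sfun :: "'a sfun \<Rightarrow> 'a sfun" is "\<lambda>f S x. - f S x"
  by (simp add: smooth_minus)
lift_definition minus_sfun :: "'a sfun \<Rightarrow> 'a sfun \<Rightarrow> 'a sfun" is "\<lambda>f g S x. f S x - g S x"
  by (simp add: smooth_diff)
lift_definition scaleR_sfun :: "real \<Rightarrow> 'a sfun \<Rightarrow> 'a sfun" is "\<lambda>c f S x. c * f S x"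
  by (simp add: smooth_cmult)
lift_definition times_sfun :: "'a sfun \<Rightarrow> 'a sfun \<Rightarrow> 'a sfun" is sf_mult
  unfolding sf_mult_def by (intro smooth_sum smooth_cmult smooth_mult) auto

text \<open>Both sides are the product of the three pairwise signs of the blocks \<open>U\<close>,
  \<open>T - U\<close>, \<open>S - T\<close>.\<close>

lemma shuffle_sign_cocycle:
  assumes "U \<subseteq> T" "T \<subseteq> S"
  shows "shuffle_sign T (S - T) * shuffle_sign U (T - U) = shuffle_sign U (S - U) * shuffle_sign (T - U) (S - T)"
proof -
  have "T = U \<union> (T - U)" "S - U = (T - U) \<union> (S - T)"
    using assms by auto
  moreover have "shuffle_sign (U \<union> (T - U)) (S - T) = shuffle_sign U (S - T) * shuffle_sign (T - U) (S - T)"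
    by (rule shuffle_sign_Un_left) auto
  moreover have "shuffle_sign U ((T - U) \<union> (S - T)) = shuffle_sign U (T - U) * shuffle_sign U (S - T)"
    by (rule shuffle_sign_Un_right) auto
  ultimately show ?thesis by (metis (no_types, lifting) mult.assoc mult.commute)
qed

lemma sf_mult_assoc: "(f \<odot> g) \<odot> h = f \<odot> g \<odot> (h :: 'b::finite superfun)"
proof (intro ext)
  fix S x
  let ?s = "shuffle_sign :: 'b set \<Rightarrow> 'b set \<Rightarrow> real"
  have "((f \<odot> g) \<odot> h) S x = (\<Sum>T\<in>Pow S. \<Sum>U\<in>Pow T.
      (?s T (S - T) * ?s U (T - U)) * (f U x * g (T - U) x * h (S - T) x))"
    by (simp add: sf_mult_eq sum_distrib_left sum_distrib_right mult.assoc)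
  also have "\<dots> = (\<Sum>(T, U)\<in>(SIGMA T:Pow S. Pow T).
      (?s T (S - T) * ?s U (T - U)) * (f U x * g (T - U) x * h (S - T) x))"
    by (rule sum.Sigma) auto
  also have "\<dots> = (\<Sum>(U, V)\<in>(SIGMA U:Pow S. Pow (S - U)).
      (?s U (S - U) * ?s V (S - U - V)) * (f U x * g V x * h (S - U - V) x))"
  \<comment> \<open>Both sums run over the ordered splittings of \<open>S\<close> into three blocks,
    recorded once by nested sets and once by the first two blocks.\<close>
  proof (rule sum.reindex_bij_witness[where i = "\<lambda>(U, V). (U \<union> V, U)" and j = "\<lambda>(T, U). (U, T - U)"])
    fix z assume "z \<in> (SIGMA T:Pow S. Pow T)"
    then obtain T U where z: "z = (T, U)" "U \<subseteq> T" "T \<subseteq> S" by auto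
    then have "S - U - (T - U) = S - T" by auto
    with shuffle_sign_cocycle[OF z(2,3)]
    show "(case case z of (T, U) \<Rightarrow> (U, T - U) of (U, V) \<Rightarrow>
         (?s U (S - U) * ?s V (S - U - V)) * (f U x * g V x * h (S - U - V) x)) =
        (case z of (T, U) \<Rightarrow> (?s T (S - T) * ?s U (T - U)) * (f U x * g (T - U) x * h (S - T) x))"
      by (simp add: z(1))
  qed auto
  also have "\<dots> = (f \<odot> g \<odot> h) S x"
    by (simp add: sf_mult_eq sum_distrib_left sum.Sigma algebra_simps)
  finally show "((f \<odot> g) \<odot> h) S x = (f \<odot> g \<odot> h) S x" .
qed

instance
proof
  fix a b c :: "'a sfun" and r s :: real
  show "a * b * c = a * (b * c)" by transfer (rule sf_mult_assoc)
  show "(a + b) * c = a * c + b * c"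
    by transfer (simp add: fun_eq_iff sf_mult_eq algebra_simps sum.distrib)
  show "a * (b + c) = a * b + a * c"
    by transfer (simp add: fun_eq_iff sf_mult_eq algebra_simps sum.distrib)
  show "r *\<^sub>R a * b = r *\<^sub>R (a * b)" "a * r *\<^sub>R b = r *\<^sub>R (a * b)"
    by (transfer, simp add: fun_eq_iff sf_mult_eq sum_distrib_left algebra_simps)+
  show "1 * a = a"
  proof (transfer, intro ext)
    fix f :: "'a superfun" and S x
    have "((\<lambda>S x. if S = {} then 1 else 0) \<odot> f) S x = (\<Sum>T\<in>Pow S. if T = {} then f S x else 0)"
      unfolding sf_mult_eq by (intro sum.cong) auto
    then show "((\<lambda>S x. if S = {} then 1 else 0) \<odot> f) S x = f S x"
      by simp
  qed
  show "a * 1 = a"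
  proof (transfer, intro ext)
    fix f :: "'a superfun" and S x
    have "(f \<odot> (\<lambda>S x. if S = {} then 1 else 0)) S x = (\<Sum>T\<in>Pow S. if T = S then f S x else 0)"
      unfolding sf_mult_eq by (intro sum.cong) auto
    then show "(f \<odot> (\<lambda>S x. if S = {} then 1 else 0)) S x = f S x"
      by simp
  qed
  show "(0 :: 'a sfun) \<noteq> 1"
    by transfer (metis zero_neq_one)
qed (transfer, simp add: algebra_simps fun_eq_iff)+

end

section \<open>Coordinates, derivatives and parity of superfunctions\<close>

lemma coeffs_sum: "coeffs (\<Sum>i\<in>I. f i) S x = (\<Sum>i\<in>I. coeffs (f i) S x)"
  by (induction I rule: infinite_finite_induct) (simp_all add: zero_sfun.rep_eq plus_sfun.rep_eq)

lift_definition der :: "('a \<Rightarrow> bit) \<Rightarrow> 'a \<Rightarrow> 'a::finite sfun \<Rightarrow> 'a sfun" is sf_deriv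
proof -
  fix \<pi> :: "'a \<Rightarrow> bit" and a and f :: "'a superfun" and S
  assume f: "\<And>S. smooth (f S)"
  show "smooth (sf_deriv \<pi> a f S)"
    by (cases "\<pi> a = 0"; cases "a \<in> S")
      (simp_all add: sf_deriv_def smooth_const smooth_cmult smooth_partial f)
qed

lift_definition coord :: "('a \<Rightarrow> bit) \<Rightarrow> 'a \<Rightarrow> 'a::finite sfun" is sf_coord
proof -
  fix \<pi> :: "'a \<Rightarrow> bit" and a S
  show "smooth (sf_coord \<pi> a S)"
    by (cases "\<pi> a = 0"; cases "S = {}"; cases "S = {a}")
      (simp_all add: sf_coord_def smooth_const smooth_nth)
qed

text \<open>The automorphism that multiplies the part of parity \<open>r\<close> by
  \<open>psign (b * r)\<close>. With it, formulas whose signs depend on the parity of a function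
  become linear in that function.\<close>

lift_definition twist :: "bit \<Rightarrow> 'a::finite sfun \<Rightarrow> 'a sfun" is
  "\<lambda>b f S x. psign (b * of_nat (card S)) * f S x"
  by (simp add: smooth_cmult)

text \<open>Homogeneity as an eigenvector condition passes through sums, products and derivatives by
  algebra alone; zero is homogeneous of both parities.\<close>

definition hom :: "bit \<Rightarrow> 'a::finite sfun \<Rightarrow> bool" where
  "hom r f \<longleftrightarrow> twist 1 f = psign r *\<^sub>R f"

lemma linear_twist: "linear (twist b)"
  by (rule linearI; transfer; simp add: fun_eq_iff algebra_simps)

lemma linear_der: "linear (der \<pi> a)"
proof (rule linearI; transfer)
  fix \<pi> :: "'a \<Rightarrow> bit" and a and f g :: "'a superfun" and r :: real
  assume f: "\<forall>S. smooth (f S)"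
  show "sf_deriv \<pi> a (\<lambda>S x. r * f S x) = (\<lambda>S x. r * sf_deriv \<pi> a f S x)"
    using f by (auto simp: fun_eq_iff sf_deriv_def partial_cmult smooth_differentiable)
  assume g: "\<forall>S. smooth (g S)"
  show "sf_deriv \<pi> a (\<lambda>S x. f S x + g S x) = (\<lambda>S x. sf_deriv \<pi> a f S x + sf_deriv \<pi> a g S x)"
    using f g by (auto simp: fun_eq_iff sf_deriv_def partial_add smooth_differentiable algebra_simps)
qed

lemma twist_0 [simp]: "twist 0 f = f"
  by transfer simp

lemma twist_twist: "twist b (twist c f) = twist (b + c) f"
  by transfer (simp add: fun_eq_iff distrib_right psign_add)

lemma twist_mult: "twist b (f * g) = twist b f * twist b g"
proof (rule sfun_eqI)
  fix S x
  have "psign (b * of_nat (card S)) * (shuffle_sign T (S - T) * (coeffs f T x * coeffs g (S - T) x)) =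
      shuffle_sign T (S - T) * ((psign (b * of_nat (card T)) * coeffs f T x) *
        (psign (b * of_nat (card (S - T))) * coeffs g (S - T) x))"
    if "T \<in> Pow S" for T
  proof -
    have "card S = card T + card (S - T)"
      using that card_Diff_subset[of T S] card_mono[of S T] by auto
    then have "psign (b * of_nat (card S)) = psign (b * of_nat (card T)) * psign (b * of_nat (card (S - T)))"
      by (simp only: of_nat_add distrib_left psign_add)
    then show ?thesis by simp
  qed
  then show "coeffs (twist b (f * g)) S x = coeffs (twist b f * twist b g) S x"
    unfolding twist.rep_eq times_sfun.rep_eq sf_mult_eq sum_distrib_left by (rule sum.cong[OF refl])
qed

lemma twist_hom:
  assumes "hom r f" shows "twist b f = psign (b * r) *\<^sub>R f"
  using assms by (cases b) (simp_all add: hom_def)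

lemma hom_coeffs_iff:
  "hom r f \<longleftrightarrow> (\<forall>S x. coeffs f S x \<noteq> 0 \<longrightarrow> of_nat (card S) = r)"
proof -
  have "hom r f \<longleftrightarrow> (\<forall>S x. coeffs (twist 1 f) S x = coeffs (psign r *\<^sub>R f) S x)"
    unfolding hom_def by (auto intro: sfun_eqI)
  then show ?thesis
    unfolding twist.rep_eq scaleR_sfun.rep_eq mult_1 mult_cancel_right psign_inject by blast
qed

lemma hom_sf_homogeneous: "hom r f \<longleftrightarrow> sf_homogeneous r (coeffs f)"
  unfolding hom_coeffs_iff sf_homogeneous_def sf_part_def by (auto simp: fun_eq_iff)

lemma hom_mult: "hom r f \<Longrightarrow> hom s g \<Longrightarrow> hom (r + s) (f * g)"
  by (simp add: hom_def twist_mult psign_add)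

lemma hom_scale: "hom r f \<Longrightarrow> hom r (c *\<^sub>R f)"
  by (simp add: hom_def linear_cmul[OF linear_twist])

lemma hom_sum: "(\<And>i. i \<in> I \<Longrightarrow> hom r (f i)) \<Longrightarrow> hom r (\<Sum>i\<in>I. f i)"
  by (simp add: hom_def linear_sum[OF linear_twist] scaleR_sum_right)

text \<open>Complementing the subset exchanges the factors at the cost of
  \<open>shuffle_sign_swap\<close>; \<open>twist r\<close> records that sign for both parity parts
  of \<open>g\<close> at once.\<close>

lemma hom_mult_commute:
  assumes "hom r f" shows "f * g = twist r g * f"
proof (rule sfun_eqI)
  fix S x
  have "coeffs (f * g) S x = (\<Sum>T\<in>Pow S. shuffle_sign (S - T) T * (coeffs f (S - T) x * coeffs g T x))"
    unfolding times_sfun.rep_eq sf_mult_eq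
    by (rule sum.reindex_bij_witness[where i = "\<lambda>T. S - T" and j = "\<lambda>T. S - T"])
       (auto simp: double_diff)
  also have "\<dots> = coeffs (twist r g * f) S x"
    unfolding times_sfun.rep_eq sf_mult_eq
  proof (rule sum.cong)
    fix T
    show "shuffle_sign (S - T) T * (coeffs f (S - T) x * coeffs g T x)
      = shuffle_sign T (S - T) * (coeffs (twist r g) T x * coeffs f (S - T) x)"
    proof (cases "coeffs f (S - T) x = 0")
      case False
      with assms have "of_nat (card (S - T)) = r" by (auto simp: hom_coeffs_iff)
      then show ?thesis
        using shuffle_sign_swap[of "S - T" T] by (simp add: twist.rep_eq Int_commute Diff_disjoint)
    qed simp
  qed simp
  finally show "coeffs (f * g) S x = coeffs (twist r g * f) S x" .
qed

lemma hom_commute: "hom r f \<Longrightarrow> hom s g \<Longrightarrow> f * g = psign (r * s) *\<^sub>R (g * f)"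
  using hom_mult_commute[of r f g] by (simp add: twist_hom)

lemma der_twist: "der \<pi> a (twist b f) = psign (b * \<pi> a) *\<^sub>R twist b (der \<pi> a f)"
proof (rule sfun_eqI)
  fix S x
  show "coeffs (der \<pi> a (twist b f)) S x = coeffs (psign (b * \<pi> a) *\<^sub>R twist b (der \<pi> a f)) S x"
    by (cases "\<pi> a")
       (simp_all add: der.rep_eq twist.rep_eq scaleR_sfun.rep_eq sf_deriv_def partial_cmult
         distrib_left psign_add)
qed

lemma twist_der: "twist b (der \<pi> a f) = psign (b * \<pi> a) *\<^sub>R der \<pi> a (twist b f)"
  by (simp add: der_twist)

lemma hom_der: "hom r f \<Longrightarrow> hom (r + \<pi> a) (der \<pi> a f)"
  by (simp add: hom_def twist_der linear_cmul[OF linear_der] psign_add mult.commute)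

text \<open>Two even derivatives commute by \<open>partial_commute\<close>. An even one acts on
  coefficients that an odd one merely relabels and signs. For two distinct odd ones, exactly one
  index precedes the other, which produces the sign.\<close>

lemma der_commute: "der \<pi> a (der \<pi> b f) = psign (\<pi> a * \<pi> b) *\<^sub>R der \<pi> b (der \<pi> a f)"
proof (rule sfun_eqI)
  fix S x
  show "coeffs (der \<pi> a (der \<pi> b f)) S x = coeffs (psign (\<pi> a * \<pi> b) *\<^sub>R der \<pi> b (der \<pi> a f)) S x"
  proof (cases "\<pi> a"; cases "\<pi> b")
    assume [simp]: "\<pi> a = 0" "\<pi> b = 0"
    show ?thesis
      using partial_commute[OF smooth_coeffs[of f S], of a b]
      by (simp add: der.rep_eq scaleR_sfun.rep_eq sf_deriv_def)
  next
    assume [simp]: "\<pi> a = 1" "\<pi> b = 1"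
    have d: "coeffs (der \<pi> c h) T x = (if c \<in> T then 0 else shuffle_sign {c} T * coeffs h (insert c T) x)"
      if "c = a \<or> c = b" for c h T
      using that by (auto simp: der.rep_eq sf_deriv_def psign_inversions_singleton)
    show ?thesis
    proof (cases "a = b \<or> a \<in> S \<or> b \<in> S")
      case False
      then have "shuffle_sign {b} (insert a S) = - shuffle_sign {a} {b} * shuffle_sign {b} S"
        "shuffle_sign {a} (insert b S) = shuffle_sign {a} {b} * shuffle_sign {a} S"
        using shuffle_sign_swap[of "{a}" "{b}"] shuffle_sign_insert_right[of a S "{b}"]
          shuffle_sign_insert_right[of b S "{a}"] by simp_all
      with False show ?thesis
        by (auto simp: d uminus_sfun.rep_eq insert_commute[of a b])
    qed (auto simp: d uminus_sfun.rep_eq)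
  qed (simp_all add: der.rep_eq scaleR_sfun.rep_eq sf_deriv_def partial_cmult)
qed

lemma der_mult: "der \<pi> a (f * g) = der \<pi> a f * g + twist (\<pi> a) f * der \<pi> a g"
proof (cases "\<pi> a")
  case zero
  show ?thesis
  proof (rule sfun_eqI)
    fix S x
    have "(coeffs f \<odot> coeffs g) S =
        (\<lambda>x. \<Sum>T\<in>Pow S. shuffle_sign T (S - T) * (coeffs f T x * coeffs g (S - T) x))"
      by (simp add: fun_eq_iff sf_mult_eq)
    with zero show "coeffs (der \<pi> a (f * g)) S x = coeffs (der \<pi> a f * g + twist (\<pi> a) f * der \<pi> a g) S x"
      by (simp add: der.rep_eq times_sfun.rep_eq plus_sfun.rep_eq sf_deriv_def sf_mult_eq
          partial_sum partial_cmult partial_mult smooth_cmult smooth_mult smooth_differentiable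
          sum.distrib[symmetric] algebra_simps)
  qed
next
  case one
  show ?thesis
  proof (rule sfun_eqI)
    fix S x
    let ?s = "shuffle_sign"
    let ?f = "\<lambda>S. coeffs f S x" and ?g = "\<lambda>S. coeffs g S x"
    have df: "coeffs (der \<pi> a h) T x = (if a \<in> T then 0 else ?s {a} T * coeffs h (insert a T) x)" for h T
      using one by (simp add: der.rep_eq sf_deriv_def psign_inversions_singleton)
    have tf: "coeffs (twist (\<pi> a) f) T x = psign (of_nat (card T)) * ?f T" for T
      using one by (simp add: twist.rep_eq)
    have sw: "?s T {a} = psign (of_nat (card T)) * ?s {a} T" if "a \<notin> T" for T
      using shuffle_sign_swap[of T "{a}"] that by simp
    show "coeffs (der \<pi> a (f * g)) S x = coeffs (der \<pi> a f * g + twist (\<pi> a) f * der \<pi> a g) S x"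
    proof (cases "a \<in> S")
      \<comment> \<open>The left side has no component containing \<open>a\<close>. On the right,
        each product of two coefficients whose sets both contain \<open>a\<close> arises once from
        each summand, with opposite signs.\<close>
      case True
      define S' where "S' = S - {a}"
      have S: "S = insert a S'" "a \<notin> S'" using True by (auto simp: S'_def)
      have notin: "a \<notin> T" if "T \<in> Pow S'" for T using that S(2) by auto
      have "coeffs (der \<pi> a f * g) S x =
          (\<Sum>T\<in>Pow S'. ?s T (S - T) * (coeffs (der \<pi> a f) T x * ?g (S - T))) +
          (\<Sum>T\<in>Pow S'. ?s (insert a T) (S - insert a T) *
            (coeffs (der \<pi> a f) (insert a T) x * ?g (S - insert a T)))"
        unfolding times_sfun.rep_eq sf_mult_eq S(1) by (rule sum_Pow_insert[OF S(2)])
      also have "\<dots> = (\<Sum>T\<in>Pow S'. ?s T (S - T) * (?s {a} T * ?f (insert a T) * ?g (S - T)))"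
        using notin by (simp add: df)
      finally have 1: "coeffs (der \<pi> a f * g) S x = \<dots>" .
      have "coeffs (twist (\<pi> a) f * der \<pi> a g) S x =
          (\<Sum>T\<in>Pow S'. ?s T (S - T) * (coeffs (twist (\<pi> a) f) T x * coeffs (der \<pi> a g) (S - T) x)) +
          (\<Sum>T\<in>Pow S'. ?s (insert a T) (S - insert a T) *
            (coeffs (twist (\<pi> a) f) (insert a T) x * coeffs (der \<pi> a g) (S - insert a T) x))"
        unfolding times_sfun.rep_eq sf_mult_eq S(1) by (rule sum_Pow_insert[OF S(2)])
      also have "(\<Sum>T\<in>Pow S'. ?s T (S - T) * (coeffs (twist (\<pi> a) f) T x * coeffs (der \<pi> a g) (S - T) x)) = 0"
        using notin True by (intro sum.neutral) (simp add: df)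
      also have "(\<Sum>T\<in>Pow S'. ?s (insert a T) (S - insert a T) *
            (coeffs (twist (\<pi> a) f) (insert a T) x * coeffs (der \<pi> a g) (S - insert a T) x)) =
          (\<Sum>T\<in>Pow S'. ?s (insert a T) (S' - T) *
            (psign (of_nat (card (insert a T))) * ?f (insert a T) * (?s {a} (S' - T) * ?g (insert a (S' - T)))))"
      proof (rule sum.cong[OF refl])
        fix T assume "T \<in> Pow S'"
        then have "S - insert a T = S' - T" "a \<notin> S' - T" using S by auto
        then show "?s (insert a T) (S - insert a T) *
            (coeffs (twist (\<pi> a) f) (insert a T) x * coeffs (der \<pi> a g) (S - insert a T) x) =
          ?s (insert a T) (S' - T) *
            (psign (of_nat (card (insert a T))) * ?f (insert a T) * (?s {a} (S' - T) * ?g (insert a (S' - T))))"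
          by (simp only: df tf if_False)
      qed
      finally have "coeffs (der \<pi> a f * g + twist (\<pi> a) f * der \<pi> a g) S x =
          (\<Sum>T\<in>Pow S'. ?s T (S - T) * (?s {a} T * ?f (insert a T) * ?g (S - T))) +
          (\<Sum>T\<in>Pow S'. ?s (insert a T) (S' - T) *
            (psign (of_nat (card (insert a T))) * ?f (insert a T) * (?s {a} (S' - T) * ?g (insert a (S' - T)))))"
        by (simp only: plus_sfun.rep_eq 1 add_0_left)
      also have "\<dots> = (\<Sum>T\<in>Pow S'. 0)"
        unfolding sum.distrib[symmetric]
      proof (rule sum.cong)
        fix T assume "T \<in> Pow S'"
        with S have T: "a \<notin> T" "a \<notin> S' - T" "S - T = insert a (S' - T)" "finite T" by auto
        show "?s T (S - T) * (?s {a} T * ?f (insert a T) * ?g (S - T)) +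
          ?s (insert a T) (S' - T) *
            (psign (of_nat (card (insert a T))) * ?f (insert a T) * (?s {a} (S' - T) * ?g (insert a (S' - T)))) = 0"
          unfolding T(3) shuffle_sign_insert_left[OF T(1)] shuffle_sign_insert_right[OF T(2)] sw[OF T(1)]
          using T(1,4) by (simp add: psign_add algebra_simps)
      qed simp
      finally show ?thesis using True by (simp add: df)
    next
      \<comment> \<open>A subset of \<open>insert a S\<close> either contains \<open>a\<close> or
        leaves it to the complement: the derivative then hits the first or the second
        factor.\<close>
      case False
      have notin: "a \<notin> T" "insert a S - T = insert a (S - T)" if "T \<in> Pow S" for T
        using that False by auto
      have "coeffs (f * g) (insert a S) x =
         (\<Sum>T\<in>Pow S. ?s T (insert a S - T) * (?f T * ?g (insert a S - T))) +
         (\<Sum>T\<in>Pow S. ?s (insert a T) (insert a S - insert a T) * (?f (insert a T) * ?g (insert a S - insert a T)))"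
        unfolding times_sfun.rep_eq sf_mult_eq by (rule sum_Pow_insert[OF False])
      also have "\<dots> = (\<Sum>T\<in>Pow S. ?s T (insert a (S - T)) * (?f T * ?g (insert a (S - T)))) +
         (\<Sum>T\<in>Pow S. ?s (insert a T) (S - T) * (?f (insert a T) * ?g (S - T)))"
        using False notin by (intro arg_cong2[of _ _ _ _ "(+)"] sum.cong refl) simp_all
      finally have "coeffs (der \<pi> a (f * g)) S x =
         (\<Sum>T\<in>Pow S. ?s {a} S * (?s (insert a T) (S - T) * (?f (insert a T) * ?g (S - T)))) +
         (\<Sum>T\<in>Pow S. ?s {a} S * (?s T (insert a (S - T)) * (?f T * ?g (insert a (S - T)))))"
        using False by (simp add: df sum_distrib_left distrib_left)
      also have "\<dots> = (\<Sum>T\<in>Pow S. ?s T (S - T) * (?s {a} T * ?f (insert a T) * ?g (S - T)))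
        + (\<Sum>T\<in>Pow S. ?s T (S - T) * (psign (of_nat (card T)) * ?f T * (?s {a} (S - T) * ?g (insert a (S - T)))))"
      proof (intro arg_cong2[of _ _ _ _ "(+)"] sum.cong refl)
        fix T assume "T \<in> Pow S"
        with False have T: "a \<notin> T" "a \<notin> S - T" "S = T \<union> (S - T)" by auto
        have s: "?s {a} S = ?s {a} T * ?s {a} (S - T)"
          by (subst T(3), rule shuffle_sign_Un_right) auto
        show "?s {a} S * (?s (insert a T) (S - T) * (?f (insert a T) * ?g (S - T)))
          = ?s T (S - T) * (?s {a} T * ?f (insert a T) * ?g (S - T))"
          unfolding s shuffle_sign_insert_left[OF T(1)] by (simp add: ac_simps shuffle_sign_square)
        show "?s {a} S * (?s T (insert a (S - T)) * (?f T * ?g (insert a (S - T))))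
          = ?s T (S - T) * (psign (of_nat (card T)) * ?f T * (?s {a} (S - T) * ?g (insert a (S - T))))"
          unfolding s shuffle_sign_insert_right[OF T(2)] sw[OF T(1)] by (simp add: ac_simps shuffle_sign_square)
      qed
      also have "\<dots> = coeffs (der \<pi> a f * g) S x + coeffs (twist (\<pi> a) f * der \<pi> a g) S x"
        unfolding times_sfun.rep_eq sf_mult_eq
        using False notin by (intro arg_cong2[of _ _ _ _ "(+)"] sum.cong refl) (simp_all add: df tf)
      finally show ?thesis
        by (simp add: plus_sfun.rep_eq)
    qed
  qed
qed

lemma der_coord: "der \<pi> a (coord \<pi> b) = (if a = b then 1 else 0)"
proof (rule sfun_eqI)
  fix S x
  show "coeffs (der \<pi> a (coord \<pi> b)) S x = coeffs (if a = b then 1 else 0) S x"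
    by (cases "\<pi> a"; cases "\<pi> b")
       (auto simp: der.rep_eq coord.rep_eq zero_sfun.rep_eq one_sfun.rep_eq sf_deriv_def sf_coord_def
         partial_nth psign_inversions_singleton)
qed

lemma hom_coord: "hom (\<pi> a) (coord \<pi> a)"
  by (cases "\<pi> a") (auto simp: hom_coeffs_iff coord.rep_eq sf_coord_def split: if_splits)


section \<open>The Schouten bracket in terms of superfunctions\<close>

lemmas twist_simps = linear_add[OF linear_twist] linear_diff[OF linear_twist] linear_neg[OF linear_twist]
  linear_cmul[OF linear_twist] linear_sum[OF linear_twist]

lemmas der_simps = linear_add[OF linear_der] linear_diff[OF linear_der] linear_neg[OF linear_der]
  linear_cmul[OF linear_der] linear_sum[OF linear_der]

declare linear_0[OF linear_twist, simp] linear_0[OF linear_der, simp]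

lemma twist_1 [simp]: "twist b 1 = 1"
  by transfer (auto simp: fun_eq_iff)

lemma der_1 [simp]: "der \<pi> a 1 = 0"
  using der_mult[of \<pi> a 1 1] by simp

lemma antitangent_parity_simps [simp]:
  "antitangent_parity q (Inl a) = q a" "antitangent_parity q (Inr a) = q a + 1"
  by (simp_all add: antitangent_parity_def)

abbreviation base_der :: "('m::finite \<Rightarrow> bit) \<Rightarrow> 'm \<Rightarrow> ('m + 'm) sfun \<Rightarrow> ('m + 'm) sfun" where
  "base_der q a \<equiv> der (antitangent_parity q) (Inl a)"

abbreviation fibre_der :: "('m::finite \<Rightarrow> bit) \<Rightarrow> 'm \<Rightarrow> ('m + 'm) sfun \<Rightarrow> ('m + 'm) sfun" where
  "fibre_der q a \<equiv> der (antitangent_parity q) (Inr a)"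

text \<open>On the part of \<open>f\<close> of parity \<open>b\<close>, the sign
  \<open>psign ((q a + 1) * (b + 1))\<close> is \<open>psign (q a + 1)\<close> times the effect of
  \<open>twist (q a + 1)\<close>; this replaces the sum over \<open>b\<close> in
  \<open>schouten\<close>.\<close>

definition schouten_sfun :: "('m::finite \<Rightarrow> bit) \<Rightarrow> ('m + 'm) sfun \<Rightarrow> ('m + 'm) sfun \<Rightarrow> ('m + 'm) sfun" where
  "schouten_sfun q f g = (\<Sum>a\<in>UNIV.
     psign (q a + 1) *\<^sub>R (fibre_der q a (twist (q a + 1) f) * base_der q a g)
     - psign (q a) *\<^sub>R (base_der q a (twist (q a) f) * fibre_der q a g))"

definition parity_part :: "bit \<Rightarrow> 'a::finite sfun \<Rightarrow> 'a sfun" where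
  "parity_part b f = (1/2) *\<^sub>R (f + psign b *\<^sub>R twist 1 f)"

lemma coeffs_parity_part: "coeffs (parity_part b f) = sf_part b (coeffs (f :: 'a::finite sfun))"
proof (intro ext)
  fix S :: "'a set" and x
  have "psign b * psign (of_nat (card S)) = (if of_nat (card S) = b then 1 else - 1)"
    by (cases b; cases "of_nat (card S) :: bit") auto
  then have "psign b * (psign (of_nat (card S)) * coeffs f S x)
      = (if of_nat (card S) = b then coeffs f S x else - coeffs f S x)"
    by (simp add: mult.assoc[symmetric])
  then show "coeffs (parity_part b f) S x = sf_part b (coeffs f) S x"
    by (simp add: parity_part_def sf_part_def scaleR_sfun.rep_eq plus_sfun.rep_eq twist.rep_eq)
qed

lemma twist_parity_part: "twist c f = parity_part 0 f + psign c *\<^sub>R parity_part 1 f"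
proof -
  have "f = (1/2) *\<^sub>R f + (1/2) *\<^sub>R f" "twist 1 f = (1/2) *\<^sub>R twist 1 f + (1/2) *\<^sub>R twist 1 f"
    by (simp_all add: scaleR_add_left[symmetric])
  then show ?thesis
    by (cases c) (simp_all add: parity_part_def scaleR_add_right scaleR_diff_right)
qed

lemma coeffs_schouten_sfun: "schouten q (coeffs f) (coeffs g) = coeffs (schouten_sfun q f g)"
proof -
  have 1: "psign (q a + 1) *\<^sub>R (fibre_der q a (twist (q a + 1) f) * base_der q a g) =
      psign (q a + 1) *\<^sub>R (fibre_der q a (parity_part 0 f) * base_der q a g)
      + fibre_der q a (parity_part 1 f) * base_der q a g" for a
    unfolding twist_parity_part[of "q a + 1"] by (simp add: der_simps distrib_right scaleR_add_right)
  have 2: "psign (q a) *\<^sub>R (base_der q a (twist (q a) f) * fibre_der q a g) =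
      psign (q a) *\<^sub>R (base_der q a (parity_part 0 f) * fibre_der q a g)
      + base_der q a (parity_part 1 f) * fibre_der q a g" for a
    unfolding twist_parity_part[of "q a"] by (simp add: der_simps distrib_right scaleR_add_right)
  show ?thesis
    unfolding schouten_def schouten_sfun_def 1 2 Let_def
    by (simp add: fun_eq_iff coeffs_sum plus_sfun.rep_eq minus_sfun.rep_eq scaleR_sfun.rep_eq
        times_sfun.rep_eq der.rep_eq coeffs_parity_part[symmetric] sum.distrib[symmetric] algebra_simps)
qed

text \<open>Independence of the momenta in the form in which it enters the Schouten bracket; the
  Leibniz rule and \<open>der_commute\<close> make it stable under products and base
  derivatives.\<close>

definition basic :: "('m::finite \<Rightarrow> bit) \<Rightarrow> ('m + 'm) sfun \<Rightarrow> bool" where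
  "basic q f \<longleftrightarrow> (\<forall>a. fibre_der q a f = 0)"

lemma basic_mult: "basic q f \<Longrightarrow> basic q g \<Longrightarrow> basic q (f * g)"
  by (simp add: basic_def der_mult)

lemma basic_scale: "basic q f \<Longrightarrow> basic q (c *\<^sub>R f)"
  by (simp add: basic_def der_simps)

lemma basic_sum: "(\<And>i. i \<in> I \<Longrightarrow> basic q (f i)) \<Longrightarrow> basic q (\<Sum>i\<in>I. f i)"
  by (simp add: basic_def der_simps)

lemma basic_base_der: "basic q f \<Longrightarrow> basic q (base_der q a f)"
  by (simp add: basic_def der_commute[of _ "Inr _" "Inl a"] der_simps)

text \<open>Momentum derivatives of \<open>f\<close> and \<open>g\<close> vanish, so each of the two
  brackets must spend a momentum derivative on \<open>P\<close>.\<close>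

lemma schouten_sfun_basic:
  assumes P: "hom 0 P" and f: "basic q f" and g: "basic q g"
  shows "schouten_sfun q f (schouten_sfun q P g) = (\<Sum>a\<in>UNIV. \<Sum>b\<in>UNIV.
    twist (q a) (base_der q a f) * (psign (q b) *\<^sub>R fibre_der q a (fibre_der q b P)) * base_der q b g)"
proof -
  have tP: "twist b P = P" for b
    using twist_hom[OF P, of b] by simp
  have f0: "fibre_der q a f = 0" for a
    using f by (simp add: basic_def)
  have g0: "fibre_der q a g = 0" "fibre_der q a (base_der q b g) = 0" for a b
    using g basic_base_der[OF g] by (simp_all add: basic_def)
  have h: "schouten_sfun q P g = - (\<Sum>b\<in>UNIV. psign (q b) *\<^sub>R (fibre_der q b P * base_der q b g))"
    by (simp add: schouten_sfun_def tP g0 psign_add sum_negf)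
  have dh: "fibre_der q a (schouten_sfun q P g) =
      - (\<Sum>b\<in>UNIV. psign (q b) *\<^sub>R (fibre_der q a (fibre_der q b P) * base_der q b g))" for a
    unfolding h by (simp add: der_simps der_mult g0)
  have "schouten_sfun q f (schouten_sfun q P g) = - (\<Sum>a\<in>UNIV. twist (q a) (base_der q a f) * fibre_der q a (schouten_sfun q P g))"
    by (simp add: schouten_sfun_def[of q f] f0 der_twist twist_simps sum_negf)
  then show ?thesis
    unfolding dh by (simp add: sum_negf sum_distrib_left mult.assoc)
qed

section \<open>Vector fields and biderivations\<close>

definition vfield :: "('m::finite \<Rightarrow> bit) \<Rightarrow> ('m \<Rightarrow> ('m + 'm) sfun) \<Rightarrow> ('m + 'm) sfun \<Rightarrow> ('m + 'm) sfun" where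
  "vfield q X f = (\<Sum>c\<in>UNIV. X c * base_der q c f)"

definition biderivation ::
    "('m::finite \<Rightarrow> bit) \<Rightarrow> ('m \<Rightarrow> 'm \<Rightarrow> ('m + 'm) sfun) \<Rightarrow> ('m + 'm) sfun \<Rightarrow> ('m + 'm) sfun \<Rightarrow> ('m + 'm) sfun" where
  "biderivation q B f g =
     (\<Sum>a\<in>UNIV. \<Sum>b\<in>UNIV. twist (q a) (base_der q a f) * B a b * base_der q b g)"

text \<open>The classical formula for the Lie derivative of a bivector field,
  \<open>X(B^ab) - (d_c X^a) B^cb - B^ac (d_c X^b)\<close>, with the signs caused by an odd
  \<open>X\<close>.\<close>

definition lie_deriv ::
    "('m::finite \<Rightarrow> bit) \<Rightarrow> ('m \<Rightarrow> ('m + 'm) sfun) \<Rightarrow> ('m \<Rightarrow> 'm \<Rightarrow> ('m + 'm) sfun) \<Rightarrow> 'm \<Rightarrow> 'm \<Rightarrow> ('m + 'm) sfun" where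
  "lie_deriv q X B a b = vfield q X (B a b)
     - (\<Sum>c\<in>UNIV. psign (q a * q c) *\<^sub>R (base_der q c (X a) * B c b))
     - psign (q a) *\<^sub>R (\<Sum>c\<in>UNIV. B a c * base_der q c (X b))"

lemma linear_vfield: "linear (vfield q X)"
  by (rule linearI) (simp_all add: vfield_def der_simps algebra_simps sum.distrib scaleR_sum_right)

lemma vfield_mult:
  assumes X: "\<And>c. hom (q c + 1) (X c)"
  shows "vfield q X (f * g) = vfield q X f * g + twist 1 f * vfield q X g"
proof -
  have "X c * twist (q c) f = twist 1 f * X c" for c
    using hom_mult_commute[OF X, of c "twist (q c) f"] by (simp add: twist_twist ac_simps)
  then have "X c * base_der q c (f * g) = X c * base_der q c f * g + twist 1 f * (X c * base_der q c g)" for c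
    by (simp add: der_mult distrib_left mult.assoc[symmetric])
  then show ?thesis
    by (simp add: vfield_def sum.distrib sum_distrib_left sum_distrib_right)
qed

lemma vfield_twist:
  assumes X: "\<And>c. hom (q c + 1) (X c)"
  shows "vfield q X (twist b f) = psign b *\<^sub>R twist b (vfield q X f)"
  by (simp add: vfield_def twist_simps twist_mult twist_hom[OF X] der_twist scaleR_sum_right
      distrib_left psign_add)

lemma base_der_vfield:
  assumes X: "\<And>c. hom (q c + 1) (X c)"
  shows "base_der q a (vfield q X f) =
    (\<Sum>c\<in>UNIV. base_der q a (X c) * base_der q c f) + psign (q a) *\<^sub>R vfield q X (base_der q a f)"
proof -
  have "base_der q a (X c * base_der q c f) =
      base_der q a (X c) * base_der q c f + psign (q a) *\<^sub>R (X c * base_der q c (base_der q a f))" for c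
    by (simp add: der_mult twist_hom[OF X] der_commute[of _ "Inl a" "Inl c"] distrib_left psign_add
        mult.commute)
  then show ?thesis
    by (simp add: vfield_def der_simps sum.distrib scaleR_sum_right)
qed

lemma vfield_base_der:
  assumes X: "\<And>c. hom (q c + 1) (X c)"
  shows "vfield q X (base_der q a f) =
    psign (q a) *\<^sub>R (base_der q a (vfield q X f) - (\<Sum>c\<in>UNIV. base_der q a (X c) * base_der q c f))"
  by (simp add: base_der_vfield[OF X])

text \<open>The second derivatives in \<open>vfield q X (base_der q a f)\<close> are absorbed into
  \<open>base_der q a (vfield q X f)\<close>, up to the first order terms that make up \<open>lie_deriv\<close>.\<close>

lemma vfield_biderivation:
  assumes X: "\<And>c. hom (q c + 1) (X c)" and B: "\<And>a b. hom (q a + q b) (B a b)"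
  shows "vfield q X (biderivation q B f g) =
    biderivation q B (vfield q X f) g + biderivation q B (twist 1 f) (vfield q X g) +
    (\<Sum>a\<in>UNIV. \<Sum>b\<in>UNIV. twist (q a + 1) (base_der q a f) * lie_deriv q X B a b * base_der q b g)"
proof -
  let ?d = "base_der q" and ?Q = "vfield q X"
  let ?F = "\<lambda>a. twist (q a + 1) (?d a f)"
  \<comment> \<open>This moves \<open>?d a (X c)\<close> to the right of the derivative of
    \<open>f\<close>, next to the tensor component.\<close>
  have 1: "twist (q a) (?d a (X c) * ?d c f) = psign (q a * q c) *\<^sub>R (?F c * ?d a (X c))" for a c
  proof -
    have h: "hom (q c + 1 + q a) (?d a (X c))"
      using hom_der[OF X[of c], of "antitangent_parity q" "Inl a"] by simp
    have "twist (q a) (?d a (X c)) = psign (q a * q c) *\<^sub>R ?d a (X c)"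
      using twist_hom[OF h, of "q a"] by (simp add: distrib_left psign_add)
    moreover have "?d a (X c) * twist (q a) (?d c f) = ?F c * ?d a (X c)"
      using hom_mult_commute[OF h, of "twist (q a) (?d c f)"] by (simp add: twist_twist ac_simps)
    ultimately show ?thesis
      by (simp add: twist_mult)
  qed
  have Q1: "?Q (twist (q a) (?d a f)) =
      twist (q a) (?d a (?Q f)) - (\<Sum>c\<in>UNIV. psign (q a * q c) *\<^sub>R (?F c * ?d a (X c)))" for a
    by (simp add: vfield_twist[OF X] vfield_base_der[OF X] twist_simps 1)
  have t1: "twist 1 (twist (q a) (?d a f)) = ?F a" for a
    by (simp add: twist_twist add.commute)
  have t2: "twist 1 (B a b) = (psign (q a) * psign (q b)) *\<^sub>R B a b" for a b
    using twist_hom[OF B, of 1 a b] by (simp add: psign_add)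
  have t3: "twist (q a) (?d a (twist 1 f)) = psign (q a) *\<^sub>R ?F a" for a
    by (simp add: der_twist twist_simps twist_twist)
  have "?Q (twist (q a) (?d a f) * B a b * ?d b g) =
      twist (q a) (?d a (?Q f)) * B a b * ?d b g
    + twist (q a) (?d a (twist 1 f)) * B a b * ?d b (?Q g)
    + (?F a * ?Q (B a b) * ?d b g
    - (\<Sum>c\<in>UNIV. psign (q a * q c) *\<^sub>R (?F c * ?d a (X c) * B a b * ?d b g))
    - (\<Sum>c\<in>UNIV. psign (q a) *\<^sub>R (?F a * B a b * ?d b (X c) * ?d c g)))" for a b
  proof -
    have "?Q (twist (q a) (?d a f) * B a b * ?d b g) =
        ?Q (twist (q a) (?d a f)) * B a b * ?d b g + ?F a * ?Q (B a b) * ?d b g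
        + ?F a * ((psign (q a) * psign (q b)) *\<^sub>R B a b) * ?Q (?d b g)"
      by (simp add: vfield_mult[OF X] twist_mult t1 t2 algebra_simps)
    also have "?F a * ((psign (q a) * psign (q b)) *\<^sub>R B a b) * ?Q (?d b g) =
        psign (q a) *\<^sub>R (?F a * B a b * ?d b (?Q g))
        - (\<Sum>c\<in>UNIV. psign (q a) *\<^sub>R (?F a * B a b * ?d b (X c) * ?d c g))"
      by (simp add: vfield_base_der[OF X] algebra_simps sum_distrib_left scaleR_sum_right)
    finally show ?thesis
      unfolding Q1 t3
      by (simp add: algebra_simps sum_distrib_left sum_distrib_right)
  qed
  then have "?Q (biderivation q B f g) =
      biderivation q B (?Q f) g + biderivation q B (twist 1 f) (?Q g) +
      ((\<Sum>a\<in>UNIV. \<Sum>b\<in>UNIV. ?F a * ?Q (B a b) * ?d b g)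
      - (\<Sum>a\<in>UNIV. \<Sum>b\<in>UNIV. \<Sum>c\<in>UNIV. psign (q a * q c) *\<^sub>R (?F c * ?d a (X c) * B a b * ?d b g))
      - (\<Sum>a\<in>UNIV. \<Sum>b\<in>UNIV. \<Sum>c\<in>UNIV. psign (q a) *\<^sub>R (?F a * B a b * ?d b (X c) * ?d c g)))"
    by (simp add: biderivation_def linear_sum[OF linear_vfield] sum.distrib sum_subtractf)
  \<comment> \<open>Here \<open>c\<close> is the index on the derivative of \<open>f\<close>; with
    this index outermost, the three sums combine into \<open>lie_deriv\<close>.\<close>
  also have "(\<Sum>a\<in>UNIV. \<Sum>b\<in>UNIV. \<Sum>c\<in>UNIV. psign (q a * q c) *\<^sub>R (?F c * ?d a (X c) * B a b * ?d b g))
      = (\<Sum>c\<in>UNIV. \<Sum>b\<in>UNIV. \<Sum>a\<in>UNIV. psign (q a * q c) *\<^sub>R (?F c * ?d a (X c) * B a b * ?d b g))"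
    by (subst sum.swap, subst (2) sum.swap, subst sum.swap, rule refl)
  also have "(\<Sum>a\<in>UNIV. \<Sum>b\<in>UNIV. \<Sum>c\<in>UNIV. psign (q a) *\<^sub>R (?F a * B a b * ?d b (X c) * ?d c g))
      = (\<Sum>a\<in>UNIV. \<Sum>c\<in>UNIV. \<Sum>b\<in>UNIV. psign (q a) *\<^sub>R (?F a * B a b * ?d b (X c) * ?d c g))"
    by (intro sum.cong refl sum.swap)
  also have "(\<Sum>a\<in>UNIV. \<Sum>b\<in>UNIV. ?F a * ?Q (B a b) * ?d b g)
      - (\<Sum>c\<in>UNIV. \<Sum>b\<in>UNIV. \<Sum>a\<in>UNIV. psign (q a * q c) *\<^sub>R (?F c * ?d a (X c) * B a b * ?d b g))
      - (\<Sum>a\<in>UNIV. \<Sum>c\<in>UNIV. \<Sum>b\<in>UNIV. psign (q a) *\<^sub>R (?F a * B a b * ?d b (X c) * ?d c g))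
      = (\<Sum>a\<in>UNIV. \<Sum>b\<in>UNIV. ?F a * lie_deriv q X B a b * ?d b g)"
    unfolding sum_subtractf[symmetric] lie_deriv_def
    by (intro sum.cong refl)
      (simp add: algebra_simps sum_distrib_left sum_distrib_right scaleR_sum_right)
  finally show ?thesis .
qed


section \<open>Structure constants\<close>

definition struct_const :: "(real^'i::finite \<Rightarrow> real^'i \<Rightarrow> real^'i) \<Rightarrow> 'i \<Rightarrow> 'i \<Rightarrow> 'i \<Rightarrow> real" where
  "struct_const br i j k = br (axis i 1) (axis j 1) $ k"

definition super_skew :: "('i \<Rightarrow> bit) \<Rightarrow> ('i \<Rightarrow> 'i \<Rightarrow> 'i \<Rightarrow> real) \<Rightarrow> bool" where
  "super_skew p c \<longleftrightarrow>
     (\<forall>i j k. c i j k \<noteq> 0 \<longrightarrow> p k = p i + p j) \<and>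
     (\<forall>i j k. c i j k = - psign (p i * p j) * c j i k)"

lemma super_skew_parity: "super_skew p c \<Longrightarrow> c i j k \<noteq> 0 \<Longrightarrow> p k = p i + p j"
  unfolding super_skew_def by blast

lemma super_skew_swap: "super_skew p c \<Longrightarrow> c i j k = - psign (p i * p j) * c j i k"
  unfolding super_skew_def by blast

section \<open>The homological vector field and the Poisson tensor\<close>

abbreviation (input) shifted :: "('i \<Rightarrow> bit) \<Rightarrow> 'i \<Rightarrow> bit" where
  "shifted p \<equiv> \<lambda>i. p i + 1"

definition base_coord :: "('i::finite \<Rightarrow> bit) \<Rightarrow> 'i \<Rightarrow> ('i + 'i) sfun" where
  "base_coord p i = coord (antitangent_parity (shifted p)) (Inl i)"

definition fibre_coord :: "('i::finite \<Rightarrow> bit) \<Rightarrow> 'i \<Rightarrow> ('i + 'i) sfun" where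
  "fibre_coord p i = coord (antitangent_parity (shifted p)) (Inr i)"

definition Q_comp :: "('i::finite \<Rightarrow> bit) \<Rightarrow> ('i \<Rightarrow> 'i \<Rightarrow> 'i \<Rightarrow> real) \<Rightarrow> 'i \<Rightarrow> ('i + 'i) sfun" where
  "Q_comp p c k = (1/2) *\<^sub>R (\<Sum>i\<in>UNIV. \<Sum>j\<in>UNIV.
     (psign (p j) * c i j k) *\<^sub>R (base_coord p j * base_coord p i))"

definition P_sfun :: "('i::finite \<Rightarrow> bit) \<Rightarrow> ('i \<Rightarrow> 'i \<Rightarrow> 'i \<Rightarrow> real) \<Rightarrow> ('i + 'i) sfun" where
  "P_sfun p f = (1/2) *\<^sub>R (\<Sum>i\<in>UNIV. \<Sum>j\<in>UNIV. \<Sum>k\<in>UNIV.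
     (psign (p i + 1) * f i j k) *\<^sub>R (base_coord p k * (fibre_coord p j * fibre_coord p i)))"

text \<open>The Poisson bracket of the coordinates \<open>\<xi>^a\<close> and
  \<open>\<xi>^b\<close>: the bracket of \<open>\<Pi>\<gg>\<^sup>*\<close> read as a linear
  function.\<close>

definition P_comp :: "('i::finite \<Rightarrow> bit) \<Rightarrow> ('i \<Rightarrow> 'i \<Rightarrow> 'i \<Rightarrow> real) \<Rightarrow> 'i \<Rightarrow> 'i \<Rightarrow> ('i + 'i) sfun" where
  "P_comp p f a b = (\<Sum>k\<in>UNIV. f a b k *\<^sub>R base_coord p k)"

lemma coeffs_Q_field:
  "Q_field p br (coeffs f) = coeffs (vfield (shifted p) (Q_comp p (struct_const br)) f)"
proof (intro ext)
  fix S x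
  let ?t = "\<lambda>i j k. (psign (p j) * struct_const br i j k) *
    coeffs (base_coord p j * base_coord p i * base_der (shifted p) k f) S x"
  have "coeffs (vfield (shifted p) (Q_comp p (struct_const br)) f) S x =
      1/2 * (\<Sum>k\<in>UNIV. \<Sum>i\<in>UNIV. \<Sum>j\<in>UNIV. ?t i j k)"
    by (simp add: vfield_def Q_comp_def sum_distrib_right coeffs_sum scaleR_sfun.rep_eq sum_distrib_left)
  also have "(\<Sum>k\<in>UNIV. \<Sum>i\<in>UNIV. \<Sum>j\<in>UNIV. ?t i j k) = (\<Sum>i\<in>UNIV. \<Sum>j\<in>UNIV. \<Sum>k\<in>UNIV. ?t i j k)"
    by (subst sum.swap, subst (2) sum.swap, rule refl)
  also have "1/2 * \<dots> = Q_field p br (coeffs f) S x"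
    by (simp add: Q_field_def Let_def Q_coeff_def struct_const_def xi_def base_coord_def
        times_sfun.rep_eq[symmetric] coord.rep_eq[symmetric] der.rep_eq[symmetric] mult.assoc)
  finally show "Q_field p br (coeffs f) S x = coeffs (vfield (shifted p) (Q_comp p (struct_const br)) f) S x"
    by simp
qed

lemma coeffs_P_tensor: "P_tensor p brs = coeffs (P_sfun p (struct_const brs))"
  by (simp add: fun_eq_iff P_tensor_def P_coeff_def P_sfun_def struct_const_def xi_def xi_star_def
      base_coord_def fibre_coord_def coeffs_sum scaleR_sfun.rep_eq
      times_sfun.rep_eq[symmetric] coord.rep_eq[symmetric])

lemma hom_base_coord: "hom (p i + 1) (base_coord p i)"
  using hom_coord[of "antitangent_parity (shifted p)" "Inl i"] by (simp add: base_coord_def)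

lemma hom_fibre_coord: "hom (p i) (fibre_coord p i)"
  using hom_coord[of "antitangent_parity (shifted p)" "Inr i"] by (simp add: fibre_coord_def)

lemma base_der_coord [simp]: "base_der (shifted p) a (base_coord p b) = (if a = b then 1 else 0)"
  by (simp add: base_coord_def der_coord)

lemma fibre_der_coord [simp]:
  "fibre_der (shifted p) a (fibre_coord p b) = (if a = b then 1 else 0)"
  "fibre_der (shifted p) a (base_coord p b) = 0"
  by (simp_all add: base_coord_def fibre_coord_def der_coord)

lemma twist_coord:
  "twist b (base_coord p i) = psign (b * (p i + 1)) *\<^sub>R base_coord p i"
  "twist b (fibre_coord p i) = psign (b * p i) *\<^sub>R fibre_coord p i"
  by (simp_all add: twist_hom[OF hom_base_coord] twist_hom[OF hom_fibre_coord])

lemma basic_base_coord: "basic (shifted p) (base_coord p i)"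
  by (simp add: basic_def)

lemma hom_scale_nonzero: "(c \<noteq> 0 \<Longrightarrow> hom r f) \<Longrightarrow> hom r (c *\<^sub>R f)"
  by (cases "c = 0") (auto simp: hom_scale hom_def twist_simps)

lemma hom_Q_comp:
  assumes "super_skew p c"
  shows "hom (shifted p k + 1) (Q_comp p c k)"
  unfolding Q_comp_def
proof (rule hom_scale, intro hom_sum hom_scale_nonzero)
  fix i j
  assume "psign (p j) * c i j k \<noteq> 0"
  then have "p k = p i + p j"
    using super_skew_parity[OF assms] by auto
  then have "shifted p k + 1 = (p j + 1) + (p i + 1)" by (simp add: ac_simps)
  then show "hom (shifted p k + 1) (base_coord p j * base_coord p i)"
    using hom_mult[OF hom_base_coord hom_base_coord] by metis
qed

lemma hom_P_comp:
  assumes "super_skew (shifted p) f"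
  shows "hom (shifted p a + shifted p b) (P_comp p f a b)"
  unfolding P_comp_def
proof (intro hom_sum hom_scale_nonzero)
  fix k
  assume "f a b k \<noteq> 0"
  then show "hom (shifted p a + shifted p b) (base_coord p k)"
    using super_skew_parity[OF assms] hom_base_coord by metis
qed

lemma hom_P_sfun:
  assumes "super_skew (shifted p) f"
  shows "hom 0 (P_sfun p f)"
  unfolding P_sfun_def
proof (rule hom_scale, intro hom_sum hom_scale_nonzero)
  fix i j k
  assume "psign (p i + 1) * f i j k \<noteq> 0"
  then have "p k + 1 = (p i + 1) + (p j + 1)"
    using super_skew_parity[OF assms] by auto
  then have "0 = (p k + 1) + (p j + p i)" by (simp add: ac_simps)
  then show "hom 0 (base_coord p k * (fibre_coord p j * fibre_coord p i))"
    using hom_mult[OF hom_base_coord hom_mult[OF hom_fibre_coord hom_fibre_coord]] by metis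
qed

text \<open>The derivative may hit either factor of a monomial; skew-symmetry of \<open>c\<close>
  makes the two contributions equal, which absorbs the 1/2.\<close>

lemma base_der_Q_comp:
  assumes "super_skew p c"
  shows "base_der (shifted p) a (Q_comp p c k) = psign (p a) *\<^sub>R (\<Sum>i\<in>UNIV. c i a k *\<^sub>R base_coord p i)"
proof -
  have d: "base_der (shifted p) a (base_coord p j * base_coord p i) =
      (if a = j then base_coord p i else 0) + (if a = i then psign ((p a + 1) * (p j + 1)) *\<^sub>R base_coord p j else 0)" for i j
    by (simp add: der_mult twist_coord)
  have "base_der (shifted p) a (Q_comp p c k) =
     (1/2) *\<^sub>R ((\<Sum>i\<in>UNIV. \<Sum>j\<in>UNIV. if a = j then (psign (p j) * c i j k) *\<^sub>R base_coord p i else 0)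
     + (\<Sum>j\<in>UNIV. \<Sum>i\<in>UNIV. if a = i then (psign (p j) * c i j k * psign ((p a + 1) * (p j + 1))) *\<^sub>R base_coord p j else 0))"
    unfolding Q_comp_def
    by (subst (2) sum.swap)
      (simp add: der_simps d scaleR_add_right sum.distrib if_distrib[of "scaleR _"] cong: if_cong)
  also have "\<dots> = (1/2) *\<^sub>R ((\<Sum>i\<in>UNIV. (psign (p a) * c i a k) *\<^sub>R base_coord p i)
     + (\<Sum>j\<in>UNIV. (psign (p j) * c a j k * psign ((p a + 1) * (p j + 1))) *\<^sub>R base_coord p j))"
    by simp
  also have "(\<Sum>j\<in>UNIV. (psign (p j) * c a j k * psign ((p a + 1) * (p j + 1))) *\<^sub>R base_coord p j)
      = (\<Sum>i\<in>UNIV. (psign (p a) * c i a k) *\<^sub>R base_coord p i)"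
  proof (rule sum.cong[OF refl])
    fix j
    have "psign (p j) * c a j k * psign ((p a + 1) * (p j + 1)) = psign (p a) * c j a k"
      unfolding super_skew_swap[OF assms, of a j] by (cases "p a"; cases "p j") simp_all
    then show "(psign (p j) * c a j k * psign ((p a + 1) * (p j + 1))) *\<^sub>R base_coord p j
        = (psign (p a) * c j a k) *\<^sub>R base_coord p j" by simp
  qed
  finally show ?thesis
    by (simp add: scaleR_sum_right scaleR_add_left[symmetric])
qed

text \<open>The two derivatives can hit the two momenta in either order; skew-symmetry of
  \<open>f\<close> makes the contributions equal, which absorbs the 1/2.\<close>

lemma fibre_der_P_sfun:
  assumes "super_skew (shifted p) f"
  shows "psign (shifted p b) *\<^sub>R fibre_der (shifted p) a (fibre_der (shifted p) b (P_sfun p f)) = P_comp p f a b"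
proof -
  have d1: "fibre_der (shifted p) b (base_coord p k * (fibre_coord p j * fibre_coord p i)) =
      psign (p b * (p k + 1)) *\<^sub>R (base_coord p k *
        ((if b = j then fibre_coord p i else 0) + (if b = i then psign (p b * p j) *\<^sub>R fibre_coord p j else 0)))" for i j k
    by (simp add: der_mult twist_coord)
  have d: "fibre_der (shifted p) a (fibre_der (shifted p) b (base_coord p k * (fibre_coord p j * fibre_coord p i))) =
      (if b = j then if a = i then (psign (p a * (p k + 1)) * psign (p b * (p k + 1))) *\<^sub>R base_coord p k else 0 else 0) +
      (if a = j then if b = i then (psign (p a * (p k + 1)) * psign (p b * (p k + 1)) * psign (p a * p b)) *\<^sub>R base_coord p k else 0 else 0)" for i j k
    unfolding d1 by (auto simp: der_mult der_simps twist_coord distrib_left scaleR_add_right mult.commute)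
  define s where "s i j k = (psign (p i + 1) * f i j k) * (psign (p a * (p k + 1)) * psign (p b * (p k + 1)))" for i j k
  have "fibre_der (shifted p) a (fibre_der (shifted p) b (P_sfun p f)) =
     (1/2) *\<^sub>R ((\<Sum>i\<in>UNIV. \<Sum>j\<in>UNIV. \<Sum>k\<in>UNIV. if b = j then if a = i then s i j k *\<^sub>R base_coord p k else 0 else 0)
     + (\<Sum>i\<in>UNIV. \<Sum>j\<in>UNIV. \<Sum>k\<in>UNIV. if a = j then if b = i then (s i j k * psign (p a * p b)) *\<^sub>R base_coord p k else 0 else 0))"
    unfolding P_sfun_def s_def
    by (simp add: der_simps d scaleR_add_right sum.distrib if_distrib[of "scaleR _"] mult.assoc cong: if_cong)
  also have "\<dots> = (1/2) *\<^sub>R ((\<Sum>k\<in>UNIV. s a b k *\<^sub>R base_coord p k) + (\<Sum>k\<in>UNIV. (s b a k * psign (p a * p b)) *\<^sub>R base_coord p k))"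
  proof -
    have *: "(\<Sum>i\<in>UNIV. \<Sum>j\<in>UNIV. \<Sum>k\<in>UNIV. if b' = j then if a' = i then g i j k else 0 else 0) = (\<Sum>k\<in>UNIV. g a' b' k)"
      for a' b' :: 'a and g :: "'a \<Rightarrow> 'a \<Rightarrow> 'a \<Rightarrow> ('a + 'a) sfun"
    proof -
      have "(\<Sum>k\<in>UNIV. if b' = j then if a' = i then g i j k else 0 else 0) =
          (if b' = j then if a' = i then (\<Sum>k\<in>UNIV. g i j k) else 0 else 0)" for i j
        by simp
      then show ?thesis by simp
    qed
    show ?thesis unfolding * by simp
  qed
  also have "(\<Sum>k\<in>UNIV. (s b a k * psign (p a * p b)) *\<^sub>R base_coord p k) = (\<Sum>k\<in>UNIV. s a b k *\<^sub>R base_coord p k)"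
  proof (rule sum.cong[OF refl])
    fix k
    have "s b a k * psign (p a * p b) = s a b k"
      unfolding s_def super_skew_swap[OF assms, of a b] by (cases "p a"; cases "p b") simp_all
    then show "(s b a k * psign (p a * p b)) *\<^sub>R base_coord p k = s a b k *\<^sub>R base_coord p k" by simp
  qed
  finally have "fibre_der (shifted p) a (fibre_der (shifted p) b (P_sfun p f)) = (\<Sum>k\<in>UNIV. s a b k *\<^sub>R base_coord p k)"
    by (simp add: scaleR_add_left[symmetric])
  \<comment> \<open>A nonzero constant fixes the parity of \<open>k\<close>, and then all remaining
    signs cancel.\<close>
  moreover have "psign (shifted p b) * s a b k = f a b k" for k
  proof (cases "f a b k = 0")
    case False
    then have "p k + 1 = p a + p b"
      using super_skew_parity[OF assms, of a b k] by (simp add: ac_simps)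
    then show ?thesis
      unfolding s_def by (cases "p a"; cases "p b") simp_all
  qed (simp add: s_def)
  ultimately show ?thesis
    by (simp add: P_comp_def scaleR_sum_right)
qed

lemma sum_delta2:
  fixes g :: "'a::finite \<Rightarrow> 'b::finite \<Rightarrow> 'c::comm_monoid_add"
  shows "(\<Sum>i\<in>UNIV. \<Sum>j\<in>UNIV. if a = i then if b = j then g i j else 0 else 0) = g a b"
    and "(\<Sum>i\<in>UNIV. \<Sum>j\<in>UNIV. if b = j then if a = i then g i j else 0 else 0) = g a b"
proof -
  have "(\<Sum>j\<in>UNIV. if a = i then if b = j then g i j else 0 else 0) = (if a = i then g i b else 0)" for i
    by simp
  then show "(\<Sum>i\<in>UNIV. \<Sum>j\<in>UNIV. if a = i then if b = j then g i j else 0 else 0) = g a b"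
    by simp
qed simp

lemma vfield_base_coord: "vfield (shifted p) X (base_coord p a) = X a"
  by (simp add: vfield_def if_distrib[of "(*) _"] cong: if_cong)

text \<open>Supercommutativity relates the two orders of a monomial, so only the supersymmetrised
  coefficients are determined; two derivatives extract them, and conversely they are the
  coefficients of twice the form.\<close>

lemma quadratic_eq_0_iff:
  "(\<Sum>k\<in>UNIV. \<Sum>l\<in>UNIV. M k l *\<^sub>R (base_coord p k * base_coord p l)) = 0 \<longleftrightarrow>
   (\<forall>k l. M k l + psign ((p k + 1) * (p l + 1)) * M l k = 0)"
  (is "?S = 0 \<longleftrightarrow> ?R")
proof
  let ?d = "base_der (shifted p)"
  assume S: "?S = 0"
  show ?R
  proof (intro allI)
    fix a b
    have d: "?d b (?d a (base_coord p k * base_coord p l)) =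
        (if a = k then if b = l then 1 else 0 else 0)
        + (if a = l then if b = k then psign ((p a + 1) * (p b + 1)) *\<^sub>R 1 else 0 else 0)" for k l
      by (auto simp: der_mult der_simps twist_coord)
    have "?d b (?d a ?S) = (M a b + psign ((p a + 1) * (p b + 1)) * M b a) *\<^sub>R 1"
      by (simp add: der_simps d scaleR_add_right sum.distrib if_distrib[of "scaleR _"] sum_delta2
          scaleR_add_left mult.commute cong: if_cong)
    then have "(M a b + psign ((p a + 1) * (p b + 1)) * M b a) *\<^sub>R (1 :: ('a + 'a) sfun) = 0"
      unfolding S by (simp add: der_simps)
    then show "M a b + psign ((p a + 1) * (p b + 1)) * M b a = 0" by simp
  qed
next
  assume R: ?R
  have "M l k *\<^sub>R (base_coord p l * base_coord p k) =
      (psign ((p k + 1) * (p l + 1)) * M l k) *\<^sub>R (base_coord p k * base_coord p l)" for k l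
    unfolding hom_commute[OF hom_base_coord hom_base_coord, of p l p k] by (simp add: mult.commute)
  then have "?S = (\<Sum>k\<in>UNIV. \<Sum>l\<in>UNIV. (psign ((p k + 1) * (p l + 1)) * M l k) *\<^sub>R (base_coord p k * base_coord p l))"
    by (subst sum.swap) simp
  then have "?S + ?S = (\<Sum>k\<in>UNIV. \<Sum>l\<in>UNIV.
      (M k l + psign ((p k + 1) * (p l + 1)) * M l k) *\<^sub>R (base_coord p k * base_coord p l))"
    by (simp add: scaleR_add_left sum.distrib)
  then have "2 *\<^sub>R ?S = 0" using R by (simp add: scaleR_2)
  then show "?S = 0" by simp
qed


section \<open>From smooth functions to the Lie derivative of the Poisson tensor\<close>

lemma base_functions_sfun:
  assumes "f \<in> base_functions q"
  obtains f' where "f = coeffs f'" "basic q f'"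
proof -
  have f: "smooth (f S)" "\<not> S \<subseteq> {a \<in> range Inl. antitangent_parity q a = 1} \<Longrightarrow> f S = (\<lambda>x. 0)"
    "(\<forall>a\<in>range Inl. antitangent_parity q a = 0 \<longrightarrow> x $ a = y $ a) \<Longrightarrow> f S x = f S y" for S x y
    using assms unfolding base_functions_def smooth_superfuns_def by blast+
  define f' where "f' = Sfun f"
  have f': "coeffs f' = f"
    using f(1) by (simp add: f'_def Sfun_inverse)
  have "fibre_der q a f' = 0" for a
  proof (rule sfun_eqI)
    fix S x
    show "coeffs (fibre_der q a f') S x = coeffs 0 S x"
    proof (cases "q a + 1 = 0")
      \<comment> \<open>Coefficients are constant along the axis of an even momentum, and no
        coefficient set contains an odd one.\<close>
      case True
      have "f S (x + s *\<^sub>R axis (Inr a) 1) = f S x" for s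
        by (rule f(3)) (auto simp: axis_def)
      moreover have "((\<lambda>s. f S (x + s *\<^sub>R axis (Inr a) 1)) has_real_derivative
          partial (Inr a) (f S) (x + 0 *\<^sub>R axis (Inr a) 1)) (at 0)"
        by (intro DERIV_along_axis smooth_differentiable f(1))
      ultimately have "((\<lambda>s. f S x) has_real_derivative partial (Inr a) (f S) x) (at 0)"
        by simp
      then have "partial (Inr a) (f S) x = 0"
        using DERIV_unique DERIV_const by blast
      with True show ?thesis
        by (simp add: der.rep_eq sf_deriv_def f' zero_sfun.rep_eq)
    next
      case False
      have "f (insert (Inr a) S) = (\<lambda>x. 0)"
        by (rule f(2)) auto
      with False show ?thesis
        by (simp add: der.rep_eq sf_deriv_def f' zero_sfun.rep_eq)
    qed
  qed
  then show ?thesis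
    using that[of f'] f' by (simp add: basic_def)
qed

lemma base_coord_base_functions: "coeffs (base_coord p i) \<in> base_functions (shifted p)"
proof -
  have eq: "coeffs (base_coord p i) = sf_coord (antitangent_parity (shifted p)) (Inl i)"
    by (simp add: base_coord_def coord.rep_eq)
  have "smooth (sf_coord (antitangent_parity (shifted p)) (Inl i) S)" for S
    using smooth_coeffs[of "base_coord p i" S] unfolding eq .
  then show ?thesis
    unfolding base_functions_def smooth_superfuns_def eq
    by (auto simp: sf_coord_def fun_eq_iff split: if_splits)
qed

definition compatible ::
    "('i::finite \<Rightarrow> bit) \<Rightarrow> (real^'i \<Rightarrow> real^'i \<Rightarrow> real^'i) \<Rightarrow> (real^'i \<Rightarrow> real^'i \<Rightarrow> real^'i) \<Rightarrow> bool"
  where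
  "compatible p br brs \<longleftrightarrow>
     (let Q = Q_field p br;
          pb = poisson (\<lambda>i. p i + 1) (P_tensor p brs);
          C = base_functions (\<lambda>i. p i + 1)
      in \<forall>b. \<forall>f\<in>C. \<forall>g\<in>C. sf_homogeneous b f \<longrightarrow>
           Q (pb f g) = (\<lambda>S x. pb (Q f) g S x + psign b * pb f (Q g) S x))"

lemma basic_Q_comp: "basic (shifted p) (Q_comp p c k)"
  unfolding Q_comp_def by (intro basic_scale basic_sum basic_mult basic_base_coord)

lemma basic_vfield:
  assumes "\<And>c. basic q (X c)" "basic q f"
  shows "basic q (vfield q X f)"
  unfolding vfield_def by (intro basic_sum basic_mult assms basic_base_der)

text \<open>By \<open>vfield_biderivation\<close> the failure of the derivation property is a sum of
  \<open>lie_deriv\<close> components times first derivatives. On coordinate functions these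
  derivatives are Kronecker deltas and isolate one component.\<close>

lemma compatible_iff_lie_deriv:
  fixes p :: "'i::finite \<Rightarrow> bit"
  assumes c: "super_skew p (struct_const br)" and f: "super_skew (shifted p) (struct_const brs)"
  shows "compatible p br brs \<longleftrightarrow>
    (\<forall>a b. lie_deriv (shifted p) (Q_comp p (struct_const br)) (P_comp p (struct_const brs)) a b = 0)"
proof -
  let ?X = "Q_comp p (struct_const br)" and ?B = "P_comp p (struct_const brs)"
  let ?Q = "vfield (shifted p) ?X" and ?pb = "biderivation (shifted p) ?B"
  have pb: "poisson (shifted p) (P_tensor p brs) (coeffs u) (coeffs v) = coeffs (?pb u v)"
    if "basic (shifted p) u" "basic (shifted p) v" for u v
    unfolding poisson_def coeffs_P_tensor coeffs_schouten_sfun schouten_sfun_basic[OF hom_P_sfun[OF f] that]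
      fibre_der_P_sfun[OF f] biderivation_def ..
  have Qb: "basic (shifted p) (?Q u)" if "basic (shifted p) u" for u
    by (intro basic_vfield basic_Q_comp that)
  have "compatible p br brs \<longleftrightarrow>
    (\<forall>r u v. basic (shifted p) u \<longrightarrow> basic (shifted p) v \<longrightarrow> coeffs u \<in> base_functions (shifted p) \<longrightarrow>
      coeffs v \<in> base_functions (shifted p) \<longrightarrow> hom r u \<longrightarrow>
      ?Q (?pb u v) = ?pb (?Q u) v + psign r *\<^sub>R ?pb u (?Q v))" (is "?L \<longleftrightarrow> ?R")
  proof -
    have eq: "Q_field p br (poisson (shifted p) (P_tensor p brs) (coeffs u) (coeffs v)) =
        (\<lambda>S x. poisson (shifted p) (P_tensor p brs) (Q_field p br (coeffs u)) (coeffs v) S x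
          + psign r * poisson (shifted p) (P_tensor p brs) (coeffs u) (Q_field p br (coeffs v)) S x)
      \<longleftrightarrow> ?Q (?pb u v) = ?pb (?Q u) v + psign r *\<^sub>R ?pb u (?Q v)"
      if "basic (shifted p) u" "basic (shifted p) v" for u v r
      unfolding coeffs_Q_field pb[OF that] pb[OF Qb[OF that(1)] that(2)] pb[OF that(1) Qb[OF that(2)]]
      by (simp add: coeffs_inject[symmetric] fun_eq_iff plus_sfun.rep_eq scaleR_sfun.rep_eq)
    show ?thesis
    proof
      assume ?L
      then show ?R
        unfolding compatible_def Let_def hom_sf_homogeneous using eq by blast
    next
      assume R: ?R
      show ?L
        unfolding compatible_def Let_def
      proof (intro allI ballI impI)
        fix r u v
        assume u: "u \<in> base_functions (shifted p)" and v: "v \<in> base_functions (shifted p)"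
          and r: "sf_homogeneous r u"
        obtain u' where u': "u = coeffs u'" "basic (shifted p) u'"
          using base_functions_sfun[OF u] .
        obtain v' where v': "v = coeffs v'" "basic (shifted p) v'"
          using base_functions_sfun[OF v] .
        show "Q_field p br (poisson (shifted p) (P_tensor p brs) u v) =
          (\<lambda>S x. poisson (shifted p) (P_tensor p brs) (Q_field p br u) v S x
          + psign r * poisson (shifted p) (P_tensor p brs) u (Q_field p br v) S x)"
          using R u v r unfolding u'(1) v'(1) eq[OF u'(2) v'(2)] hom_sf_homogeneous[symmetric]
          using u'(2) v'(2) by blast
      qed
    qed
  qed
  also have "\<dots> \<longleftrightarrow> (\<forall>a b. lie_deriv (shifted p) ?X ?B a b = 0)"
  proof -
    have eq: "?Q (?pb u v) = ?pb (?Q u) v + psign r *\<^sub>R ?pb u (?Q v) \<longleftrightarrow>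
      (\<Sum>a\<in>UNIV. \<Sum>b\<in>UNIV. twist (p a + 1 + 1) (base_der (shifted p) a u) *
         lie_deriv (shifted p) ?X ?B a b * base_der (shifted p) b v) = 0" if "hom r u" for r u v
    proof -
      have "twist 1 u = psign r *\<^sub>R u" using that by (simp add: hom_def)
      then have "?pb (twist 1 u) w = psign r *\<^sub>R ?pb u w" for w
        by (simp add: biderivation_def der_simps twist_simps scaleR_sum_right)
      then show ?thesis
        using vfield_biderivation[OF hom_Q_comp[OF c] hom_P_comp[OF f], where f = u and g = v] by simp
    qed
    show ?thesis
    proof (intro iffI allI impI)
      fix a b
      assume *: "\<forall>r u v. basic (shifted p) u \<longrightarrow> basic (shifted p) v \<longrightarrow>
        coeffs u \<in> base_functions (shifted p) \<longrightarrow> coeffs v \<in> base_functions (shifted p) \<longrightarrow> hom r u \<longrightarrow>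
        ?Q (?pb u v) = ?pb (?Q u) v + psign r *\<^sub>R ?pb u (?Q v)"
      have "?Q (?pb (base_coord p a) (base_coord p b)) = ?pb (?Q (base_coord p a)) (base_coord p b)
          + psign (p a + 1) *\<^sub>R ?pb (base_coord p a) (?Q (base_coord p b))"
        using * basic_base_coord base_coord_base_functions hom_base_coord by blast
      then have "(\<Sum>a'\<in>UNIV. \<Sum>b'\<in>UNIV. twist (p a' + 1 + 1) (base_der (shifted p) a' (base_coord p a)) *
         lie_deriv (shifted p) ?X ?B a' b' * base_der (shifted p) b' (base_coord p b)) = 0"
        unfolding eq[OF hom_base_coord] .
      moreover have "twist (p a' + 1 + 1) (base_der (shifted p) a' (base_coord p a)) *
         lie_deriv (shifted p) ?X ?B a' b' * base_der (shifted p) b' (base_coord p b) =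
         (if b' = b then if a' = a then lie_deriv (shifted p) ?X ?B a' b' else 0 else 0)" for a' b'
        by (simp add: twist_simps)
      ultimately show "lie_deriv (shifted p) ?X ?B a b = 0"
        by simp
    qed (simp add: eq)
  qed
  finally show ?thesis .
qed


section \<open>The cocycle condition\<close>

text \<open>The coefficient of \<open>e\<^sub>a \<otimes> e\<^sub>b\<close> in \<open>\<delta>(e\<^sub>k)\<close>, if \<open>f\<close> are the structure constants of \<open>\<Pi>\<gg>\<^sup>*\<close>; likewise
  \<open>ad_tensor_const p c k t a b\<close> for \<open>(ad e\<^sub>k \<otimes> 1 + 1 \<otimes> ad e\<^sub>k) t\<close>.\<close>

definition cobracket_const :: "('i \<Rightarrow> bit) \<Rightarrow> ('i \<Rightarrow> 'i \<Rightarrow> 'i \<Rightarrow> real) \<Rightarrow> 'i \<Rightarrow> 'i \<Rightarrow> 'i \<Rightarrow> real" where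
  "cobracket_const p f k a b = psign (p a) * f b a k"

definition ad_tensor_const :: "('i::finite \<Rightarrow> bit) \<Rightarrow> ('i \<Rightarrow> 'i \<Rightarrow> 'i \<Rightarrow> real) \<Rightarrow> 'i \<Rightarrow> ('i \<Rightarrow> 'i \<Rightarrow> real) \<Rightarrow> 'i \<Rightarrow> 'i \<Rightarrow> real" where
  "ad_tensor_const p c k t a b = (\<Sum>m\<in>UNIV. c k m a * t m b) + psign (p k * p a) * (\<Sum>m\<in>UNIV. c k m b * t a m)"

text \<open>The identity \<open>\<delta>[u,v] = (-1)^u u.\<delta>(v) - (-1)^(uv+v)
  v.\<delta>(u)\<close> on basis vectors; the signs \<open>(-1)^u\<close> and \<open>(-1)^v\<close>
  reflect that \<open>\<delta>\<close> is odd.\<close>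

definition cocycle :: "('i::finite \<Rightarrow> bit) \<Rightarrow> ('i \<Rightarrow> 'i \<Rightarrow> 'i \<Rightarrow> real) \<Rightarrow> ('i \<Rightarrow> 'i \<Rightarrow> 'i \<Rightarrow> real) \<Rightarrow> bool" where
  "cocycle p c f \<longleftrightarrow> (\<forall>k l a b. (\<Sum>m\<in>UNIV. c k l m * cobracket_const p f m a b) =
     psign (p k) * ad_tensor_const p c k (cobracket_const p f l) a b - psign (p k * p l + p l) * ad_tensor_const p c l (cobracket_const p f k) a b)"

lemma sum_sign:
  fixes u :: "'a \<Rightarrow> real"
  assumes "\<And>m. u m \<noteq> 0 \<Longrightarrow> v m = \<sigma> * u m" "\<And>m. u m = 0 \<Longrightarrow> v m = 0"
  shows "(\<Sum>m\<in>A. v m) = \<sigma> * (\<Sum>m\<in>A. u m)"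
  unfolding sum_distrib_left using assms by (intro sum.cong) (metis mult_zero_right)+

lemma sum_rotate: "(\<Sum>m\<in>A. \<Sum>k\<in>B. \<Sum>l\<in>C. g m k l) = (\<Sum>k\<in>B. \<Sum>l\<in>C. \<Sum>m\<in>A. g m k l)"
  by (subst sum.swap, rule sum.cong[OF refl], rule sum.swap)

definition lie_deriv_coeff :: "('i::finite \<Rightarrow> bit) \<Rightarrow> ('i \<Rightarrow> 'i \<Rightarrow> 'i \<Rightarrow> real) \<Rightarrow> ('i \<Rightarrow> 'i \<Rightarrow> 'i \<Rightarrow> real) \<Rightarrow> 'i \<Rightarrow> 'i \<Rightarrow> 'i \<Rightarrow> 'i \<Rightarrow> real" where
  "lie_deriv_coeff p c f a b k l =
     (\<Sum>m\<in>UNIV. 1/2 * (psign (p k) * (f a b m * c l k m)))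
     - (\<Sum>m\<in>UNIV. psign ((p a + 1) * (p m + 1)) * psign (p m) * (c k m a * f m b l))
     - (\<Sum>m\<in>UNIV. psign (p a + 1) * psign (p m) * (f a m k * c l m b))"

lemma lie_deriv_quadratic:
  assumes "super_skew p c"
  shows "lie_deriv (shifted p) (Q_comp p c) (P_comp p f) a b =
    (\<Sum>k\<in>UNIV. \<Sum>l\<in>UNIV. lie_deriv_coeff p c f a b k l *\<^sub>R (base_coord p k * base_coord p l))"
proof -
  let ?\<xi> = "base_coord p"
  have "vfield (shifted p) (Q_comp p c) (P_comp p f a b) = (\<Sum>m\<in>UNIV. f a b m *\<^sub>R Q_comp p c m)"
    by (simp add: P_comp_def linear_sum[OF linear_vfield] linear_cmul[OF linear_vfield] vfield_base_coord)
  also have "\<dots> = (\<Sum>m\<in>UNIV. \<Sum>k\<in>UNIV. \<Sum>l\<in>UNIV. (1/2 * (psign (p k) * (f a b m * c l k m))) *\<^sub>R (?\<xi> k * ?\<xi> l))"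
    unfolding Q_comp_def by (subst (2) sum.swap) (simp add: scaleR_sum_right ac_simps)
  also have "\<dots> = (\<Sum>k\<in>UNIV. \<Sum>l\<in>UNIV. (\<Sum>m\<in>UNIV. 1/2 * (psign (p k) * (f a b m * c l k m))) *\<^sub>R (?\<xi> k * ?\<xi> l))"
    by (subst sum_rotate) (simp only: scaleR_sum_left)
  finally have 1: "vfield (shifted p) (Q_comp p c) (P_comp p f a b) = \<dots>" .
  have "(\<Sum>m\<in>UNIV. psign ((p a + 1) * (p m + 1)) *\<^sub>R (base_der (shifted p) m (Q_comp p c a) * P_comp p f m b)) =
    (\<Sum>m\<in>UNIV. \<Sum>k\<in>UNIV. \<Sum>l\<in>UNIV. (psign ((p a + 1) * (p m + 1)) * psign (p m) * (c k m a * f m b l)) *\<^sub>R (?\<xi> k * ?\<xi> l))"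
    unfolding base_der_Q_comp[OF assms] P_comp_def scaleR_sum_right sum_product
    by (simp add: mult_ac)
  also have "\<dots> = (\<Sum>k\<in>UNIV. \<Sum>l\<in>UNIV. (\<Sum>m\<in>UNIV. psign ((p a + 1) * (p m + 1)) * psign (p m) * (c k m a * f m b l)) *\<^sub>R (?\<xi> k * ?\<xi> l))"
    by (subst sum_rotate) (simp only: scaleR_sum_left)
  finally have 2: "(\<Sum>m\<in>UNIV. psign ((p a + 1) * (p m + 1)) *\<^sub>R (base_der (shifted p) m (Q_comp p c a) * P_comp p f m b)) = \<dots>" .
  have "psign (p a + 1) *\<^sub>R (\<Sum>m\<in>UNIV. P_comp p f a m * base_der (shifted p) m (Q_comp p c b)) =
    (\<Sum>m\<in>UNIV. \<Sum>k\<in>UNIV. \<Sum>l\<in>UNIV. (psign (p a + 1) * psign (p m) * (f a m k * c l m b)) *\<^sub>R (?\<xi> k * ?\<xi> l))"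
    unfolding base_der_Q_comp[OF assms] P_comp_def scaleR_sum_right sum_product
    by (simp add: mult_ac)
  also have "\<dots> = (\<Sum>k\<in>UNIV. \<Sum>l\<in>UNIV. (\<Sum>m\<in>UNIV. psign (p a + 1) * psign (p m) * (f a m k * c l m b)) *\<^sub>R (?\<xi> k * ?\<xi> l))"
    by (subst sum_rotate) (simp only: scaleR_sum_left)
  finally have 3: "psign (p a + 1) *\<^sub>R (\<Sum>m\<in>UNIV. P_comp p f a m * base_der (shifted p) m (Q_comp p c b)) = \<dots>" .
  show ?thesis
    unfolding lie_deriv_def 1 2 3 lie_deriv_coeff_def
    by (simp add: scaleR_diff_left sum_subtractf)
qed

lemma bit_sum_eqD: "a = b + c \<Longrightarrow> c = a + b" for a b c :: bit
  by (cases a; cases b; cases c) simp_all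

text \<open>All signs depend on the summation index only through its parity, which is determined by the
  remaining indices.  So every condition below is linear in these sums.\<close>

definition mixed_sum :: "('i::finite \<Rightarrow> 'i \<Rightarrow> 'i \<Rightarrow> real) \<Rightarrow> ('i \<Rightarrow> 'i \<Rightarrow> 'i \<Rightarrow> real) \<Rightarrow> 'i \<Rightarrow> 'i \<Rightarrow> 'i \<Rightarrow> 'i \<Rightarrow> real" where
  "mixed_sum c f k l a b = (\<Sum>m\<in>UNIV. c k m a * f m b l)"

definition inner_sum :: "('i::finite \<Rightarrow> 'i \<Rightarrow> 'i \<Rightarrow> real) \<Rightarrow> ('i \<Rightarrow> 'i \<Rightarrow> 'i \<Rightarrow> real) \<Rightarrow> 'i \<Rightarrow> 'i \<Rightarrow> 'i \<Rightarrow> 'i \<Rightarrow> real" where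
  "inner_sum c f k l a b = (\<Sum>m\<in>UNIV. c k l m * f a b m)"

context
  fixes p :: "'i::finite \<Rightarrow> bit" and c f :: "'i \<Rightarrow> 'i \<Rightarrow> 'i \<Rightarrow> real"
  assumes c: "super_skew p c" and f: "super_skew (shifted p) f"
begin

lemma mixed_sum_parity: "mixed_sum c f k l a b \<noteq> 0 \<Longrightarrow> p k + p l + p a + p b = 1"
proof -
  assume "mixed_sum c f k l a b \<noteq> 0"
  then obtain m where "c k m a \<noteq> 0" "f m b l \<noteq> 0"
    unfolding mixed_sum_def by (auto elim!: sum.not_neutral_contains_not_neutral)
  then have "p a = p k + p m" "p l + 1 = (p m + 1) + (p b + 1)"
    using super_skew_parity[OF c] super_skew_parity[OF f] by blast+
  then show ?thesis
    by (cases "p k"; cases "p l"; cases "p b"; cases "p m"; cases "p a") simp_all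
qed

lemma inner_sum_parity: "inner_sum c f k l a b \<noteq> 0 \<Longrightarrow> p k + p l + p a + p b = 1"
proof -
  assume "inner_sum c f k l a b \<noteq> 0"
  then obtain m where "c k l m \<noteq> 0" "f a b m \<noteq> 0"
    unfolding inner_sum_def by (auto elim!: sum.not_neutral_contains_not_neutral)
  then have "p m = p k + p l" "p m + 1 = (p a + 1) + (p b + 1)"
    using super_skew_parity[OF c] super_skew_parity[OF f] by blast+
  then show ?thesis
    by (cases "p k"; cases "p l"; cases "p b"; cases "p m"; cases "p a") simp_all
qed

lemma parity_c: "c k m a \<noteq> 0 \<Longrightarrow> p m = p a + p k"
  by (rule bit_sum_eqD) (rule super_skew_parity[OF c])

lemma sum_mixed:
  assumes "\<And>m. p m = p a + p k \<Longrightarrow> v m = \<sigma> * (c k m a * f m b l)"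
    and "\<And>m. c k m a = 0 \<Longrightarrow> v m = 0"
  shows "(\<Sum>m\<in>UNIV. v m) = \<sigma> * mixed_sum c f k l a b"
  unfolding mixed_sum_def sum_distrib_left
proof (rule sum.cong[OF refl])
  fix m
  show "v m = \<sigma> * (c k m a * f m b l)"
    by (cases "c k m a = 0") (use assms parity_c in auto)
qed

lemma f_swap: "f i j k = - psign ((p i + 1) * (p j + 1)) * f j i k"
  by (rule super_skew_swap[OF f])

lemma lie_deriv_coeff_eq:
  "lie_deriv_coeff p c f a b k l =
     - (1/2 * psign (p k + p k * p l) * inner_sum c f k l a b)
     - psign ((p a + 1) * (p a + p k + 1) + p a + p k) * mixed_sum c f k l a b
     - psign (p a + p b + p l + (p a + 1) * (p b + p l + 1)) * mixed_sum c f l k b a"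
proof -
  have 1: "(\<Sum>m\<in>UNIV. 1/2 * (psign (p k) * (f a b m * c l k m))) = - (1/2 * psign (p k + p k * p l)) * inner_sum c f k l a b"
    unfolding inner_sum_def sum_distrib_left super_skew_swap[OF c, of l k]
    by (intro sum.cong refl) (simp add: psign_add mult.commute)
  have 2: "(\<Sum>m\<in>UNIV. psign ((p a + 1) * (p m + 1)) * psign (p m) * (c k m a * f m b l)) =
      psign ((p a + 1) * (p a + p k + 1) + p a + p k) * mixed_sum c f k l a b"
    by (rule sum_mixed) (simp_all add: psign_add)
  have 3: "(\<Sum>m\<in>UNIV. psign (p a + 1) * psign (p m) * (f a m k * c l m b)) =
      psign (p a + p b + p l + (p a + 1) * (p b + p l + 1)) * mixed_sum c f l k b a"
    by (rule sum_mixed) (simp_all add: psign_add f_swap[of a])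
  show ?thesis
    unfolding lie_deriv_coeff_def 1 2 3 by simp
qed

lemma ad_tensor_const_cobracket:
  "ad_tensor_const p c k (cobracket_const p f l) a b =
     - (psign (p a + p k + (p b + 1) * (p a + p k + 1)) * mixed_sum c f k l a b)
     + psign (p k * p a + p a) * mixed_sum c f k l b a"
proof -
  have 1: "(\<Sum>m\<in>UNIV. c k m a * cobracket_const p f l m b) =
      - psign (p a + p k + (p b + 1) * (p a + p k + 1)) * mixed_sum c f k l a b"
    by (rule sum_mixed) (simp_all add: cobracket_const_def f_swap[of b] psign_add)
  have 2: "(\<Sum>m\<in>UNIV. c k m b * cobracket_const p f l a m) = psign (p a) * mixed_sum c f k l b a"
    by (rule sum_mixed) (simp_all add: cobracket_const_def)
  show ?thesis
    unfolding ad_tensor_const_def 1 2 by (simp add: psign_add)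
qed

lemma sum_cobracket:
  "(\<Sum>m\<in>UNIV. c k l m * cobracket_const p f m a b) = - psign (p a + (p a + 1) * (p b + 1)) * inner_sum c f k l a b"
  unfolding inner_sum_def sum_distrib_left cobracket_const_def f_swap[of b a]
  by (intro sum.cong refl) (simp add: psign_add mult.commute)

text \<open>Supersymmetrising in \<open>k\<close> and \<open>l\<close> doubles the inner sum, which
  cancels its 1/2, and turns two mixed sums into the four of the cocycle condition. The sign in
  front is invertible, so both conditions vanish together.\<close>

lemma lie_deriv_coeff_cocycle:
  "lie_deriv_coeff p c f a b k l + psign ((p k + 1) * (p l + 1)) * lie_deriv_coeff p c f a b l k =
   psign (p k * p l + p k) * psign (p a + (p a + 1) * (p b + 1)) *
     ((\<Sum>m\<in>UNIV. c k l m * cobracket_const p f m a b) -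
      (psign (p k) * ad_tensor_const p c k (cobracket_const p f l) a b - psign (p k * p l + p l) * ad_tensor_const p c l (cobracket_const p f k) a b))"
proof -
  have i: "inner_sum c f l k a b = - psign (p k * p l) * inner_sum c f k l a b"
    unfolding inner_sum_def sum_distrib_left super_skew_swap[OF c, of l k]
    by (intro sum.cong refl) (simp add: mult.commute)
  \<comment> \<open>All five sums vanish unless the four parities add up to 1, which leaves eight
    parity patterns for the sign check.\<close>
  consider "p k + p l + p a + p b = 1" |
    "inner_sum c f k l a b = 0" "mixed_sum c f k l a b = 0" "mixed_sum c f l k b a = 0"
    "mixed_sum c f l k a b = 0" "mixed_sum c f k l b a = 0"
    using inner_sum_parity[of k l a b] mixed_sum_parity[of k l a b] mixed_sum_parity[of l k b a]
      mixed_sum_parity[of l k a b] mixed_sum_parity[of k l b a] by (metis add.commute add.left_commute)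
  then show ?thesis
  proof cases
    case 1
    then show ?thesis
      unfolding lie_deriv_coeff_eq ad_tensor_const_cobracket sum_cobracket i
      by (cases "p k"; cases "p l"; cases "p a"; cases "p b") (simp_all add: algebra_simps)
  next
    case 2
    then show ?thesis
      unfolding lie_deriv_coeff_eq ad_tensor_const_cobracket sum_cobracket i by simp
  qed
qed

lemma lie_deriv_iff_cocycle:
  "(\<forall>a b. lie_deriv (shifted p) (Q_comp p c) (P_comp p f) a b = 0) \<longleftrightarrow> cocycle p c f"
  unfolding lie_deriv_quadratic[OF c] quadratic_eq_0_iff lie_deriv_coeff_cocycle cocycle_def
  by (simp add: eq_diff_eq) blast

end


section \<open>Lie superalgebras in terms of structure constants\<close>

definition jacobi_at :: "('i::finite \<Rightarrow> bit) \<Rightarrow> ('i \<Rightarrow> 'i \<Rightarrow> 'i \<Rightarrow> real) \<Rightarrow> 'i \<Rightarrow> 'i \<Rightarrow> 'i \<Rightarrow> 'i \<Rightarrow> bool" where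
  "jacobi_at p c i j k l \<longleftrightarrow> (\<Sum>m\<in>UNIV. c j k m * c i m l) =
     (\<Sum>m\<in>UNIV. c i j m * c m k l) + psign (p i * p j) * (\<Sum>m\<in>UNIV. c i k m * c j m l)"

definition lie_consts :: "('i::finite \<Rightarrow> bit) \<Rightarrow> ('i \<Rightarrow> 'i \<Rightarrow> 'i \<Rightarrow> real) \<Rightarrow> bool" where
  "lie_consts p c \<longleftrightarrow> super_skew p c \<and> (\<forall>i j k l. jacobi_at p c i j k l)"

lemma ad_tensor_const_scale: "ad_tensor_const p c k (\<lambda>a b. r * t a b) a b = r * ad_tensor_const p c k t a b"
  by (simp add: ad_tensor_const_def sum_distrib_left algebra_simps)

text \<open>By the Jacobi identity \<open>ad\<close> is a representation, hence so is its action on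
  the tensor square. \<open>L\<close> and \<open>R\<close> act on the two factors without signs; the
  sign for passing the first factor is put in separately.\<close>

lemma ad_tensor_const_bracket:
  assumes c: "super_skew p c" and jac: "\<And>i j k l. jacobi_at p c i j k l"
  shows "(\<Sum>m\<in>UNIV. c i j m * ad_tensor_const p c m t a b) =
    ad_tensor_const p c i (ad_tensor_const p c j t) a b - psign (p i * p j) * ad_tensor_const p c j (ad_tensor_const p c i t) a b"
proof -
  define L where "L i t a b = (\<Sum>n\<in>UNIV. c i n a * t n b)" for i a b and t :: "'a \<Rightarrow> 'a \<Rightarrow> real"
  define R where "R i t a b = (\<Sum>n\<in>UNIV. c i n b * t a n)" for i a b and t :: "'a \<Rightarrow> 'a \<Rightarrow> real"
  have ad: "ad_tensor_const p c i t a b = L i t a b + psign (p i * p a) * R i t a b" for i t a b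
    by (simp add: ad_tensor_const_def L_def R_def)
  have bracket: "(\<Sum>m\<in>UNIV. c i j m * (\<Sum>n\<in>UNIV. c m n a * u n)) =
      (\<Sum>n\<in>UNIV. c i n a * (\<Sum>r\<in>UNIV. c j r n * u r)) - psign (p i * p j) * (\<Sum>n\<in>UNIV. c j n a * (\<Sum>r\<in>UNIV. c i r n * u r))"
    for u a
  proof -
    have swp: "(\<Sum>n\<in>UNIV. (\<Sum>m\<in>UNIV. c j n m * c i m a) * u n) = (\<Sum>n\<in>UNIV. c i n a * (\<Sum>r\<in>UNIV. c j r n * u r))" for i j
      by (simp add: sum_distrib_left sum_distrib_right mult_ac) (rule sum.swap)
    have "(\<Sum>m\<in>UNIV. c i j m * (\<Sum>n\<in>UNIV. c m n a * u n)) = (\<Sum>n\<in>UNIV. (\<Sum>m\<in>UNIV. c i j m * c m n a) * u n)"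
      by (simp add: sum_distrib_left sum_distrib_right mult.assoc) (rule sum.swap)
    also have "\<dots> = (\<Sum>n\<in>UNIV. (\<Sum>m\<in>UNIV. c j n m * c i m a) * u n)
        - psign (p i * p j) * (\<Sum>n\<in>UNIV. (\<Sum>m\<in>UNIV. c i n m * c j m a) * u n)"
      using jac by (simp add: jacobi_at_def algebra_simps sum.distrib sum_distrib_left)
    finally show ?thesis unfolding swp .
  qed
  have LL: "(\<Sum>m\<in>UNIV. c i j m * L m t a b) = L i (L j t) a b - psign (p i * p j) * L j (L i t) a b"
    unfolding L_def by (rule bracket)
  have RR: "(\<Sum>m\<in>UNIV. c i j m * R m t a b) = R i (R j t) a b - psign (p i * p j) * R j (R i t) a b"
    unfolding R_def by (rule bracket)
  have LR: "L i (R j t) a b = R j (L i t) a b" for i j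
    unfolding L_def R_def sum_distrib_left by (subst sum.swap) (simp add: mult_ac)
  \<comment> \<open>\<open>L i\<close> shifts the parity of the first index by \<open>p i\<close>,
    whence the sign exponent \<open>p j * (p a + p i)\<close>. With these signs the cross terms
    cancel in the supercommutator.\<close>
  have adad: "ad_tensor_const p c i (ad_tensor_const p c j t) a b = L i (L j t) a b + psign (p j * (p a + p i)) * L i (R j t) a b
      + psign (p i * p a) * R i (L j t) a b + psign (p i * p a) * psign (p j * p a) * R i (R j t) a b" for i j
  proof -
    have 1: "L i (\<lambda>n b. L j t n b + psign (p j * p n) * R j t n b) a b =
        L i (L j t) a b + psign (p j * (p a + p i)) * L i (R j t) a b"
    proof -
      have *: "c i n a * (psign (p j * p n) * x) = psign (p j * (p a + p i)) * (c i n a * x)" for n x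
        using super_skew_parity[OF c, of i n a] by (cases "c i n a = 0") (auto simp: add.commute)
      show ?thesis
        by (simp only: L_def[of i] distrib_left[of "c _ _ _"] sum.distrib sum_distrib_left *)
    qed
    have 2: "R i (\<lambda>a n. L j t a n + psign (p j * p a) * R j t a n) a b =
        R i (L j t) a b + psign (p j * p a) * R i (R j t) a b"
      unfolding R_def[of i] by (simp add: distrib_left sum.distrib sum_distrib_left mult_ac)
    show ?thesis
      unfolding ad[of i] using 1 2 by (simp add: ad[abs_def] distrib_left mult.assoc)
  qed
  have "(\<Sum>m\<in>UNIV. c i j m * ad_tensor_const p c m t a b) =
      (\<Sum>m\<in>UNIV. c i j m * L m t a b) + psign ((p i + p j) * p a) * (\<Sum>m\<in>UNIV. c i j m * R m t a b)"
  proof -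
    have *: "c i j m * (psign (p m * p a) * x) = psign ((p i + p j) * p a) * (c i j m * x)" for m x
      using super_skew_parity[OF c, of i j m] by (cases "c i j m = 0") auto
    show ?thesis
      by (simp only: ad distrib_left[of "c _ _ _"] sum.distrib sum_distrib_left *)
  qed
  then show ?thesis
    unfolding LL RR adad LR[of i j] LR[of j i]
    by (cases "p i"; cases "p j"; cases "p a") simp_all
qed

text \<open>The lowest case of \<open>d d = 0\<close>: for a coboundary, the cocycle condition is
  the representation property \<open>ad_tensor_const_bracket\<close> applied to
  \<open>r\<close>.\<close>

lemma cocycle_coboundary:
  assumes c: "super_skew p c" and jac: "\<And>i j k l. jacobi_at p c i j k l"
    and f: "\<And>k a b. cobracket_const p f k a b = psign (p k) * ad_tensor_const p c k r a b"
  shows "cocycle p c f"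
  unfolding cocycle_def
proof (intro allI)
  fix k l a b
  have f': "cobracket_const p f k = (\<lambda>a b. psign (p k) * ad_tensor_const p c k r a b)" for k
    by (simp add: f fun_eq_iff)
  have "(\<Sum>m\<in>UNIV. c k l m * cobracket_const p f m a b) = psign (p k + p l) * (\<Sum>m\<in>UNIV. c k l m * ad_tensor_const p c m r a b)"
    unfolding sum_distrib_left f
  proof (rule sum.cong[OF refl])
    fix m
    show "c k l m * (psign (p m) * ad_tensor_const p c m r a b) = psign (p k + p l) * (c k l m * ad_tensor_const p c m r a b)"
      using super_skew_parity[OF c, of k l m] by (cases "c k l m = 0") auto
  qed
  then show "(\<Sum>m\<in>UNIV. c k l m * cobracket_const p f m a b) =
      psign (p k) * ad_tensor_const p c k (cobracket_const p f l) a b - psign (p k * p l + p l) * ad_tensor_const p c l (cobracket_const p f k) a b"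
    unfolding ad_tensor_const_bracket[OF c jac] f' ad_tensor_const_scale
    by (cases "p k"; cases "p l") simp_all
qed

section \<open>The double in terms of structure constants\<close>

lemma sum_UNIV_sum:
  "(\<Sum>x\<in>UNIV. g x) = (\<Sum>i\<in>UNIV. g (Inl i)) + (\<Sum>j\<in>UNIV. g (Inr j))"
  for g :: "'a::finite + 'b::finite \<Rightarrow> 'c::comm_monoid_add"
  by (simp add: UNIV_Plus_UNIV[symmetric] sum.Plus del: UNIV_Plus_UNIV)

lemma double_parity_simps [simp]:
  "double_parity p (Inl i) = p i" "double_parity p (Inr i) = p i + 1"
  by (simp_all add: double_parity_def)

fun opposite :: "'i + 'i \<Rightarrow> 'i + 'i" where
  "opposite (Inl i) = Inr i"
| "opposite (Inr i) = Inl i"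

lemma opposite_opposite [simp]: "opposite (opposite x) = x"
  by (cases x) simp_all

text \<open>The natural inner product of the basis vectors \<open>opposite z\<close> and
  \<open>z\<close>, in this order.\<close>

fun pair_sign :: "'i + 'i \<Rightarrow> real" where
  "pair_sign (Inl i) = - 1"
| "pair_sign (Inr i) = 1"

text \<open>\<open>trilinear C x y z\<close> is the inner product of \<open>[x, y]\<close> with \<open>z\<close>.\<close>

definition trilinear :: "('i + 'i \<Rightarrow> 'i + 'i \<Rightarrow> 'i + 'i \<Rightarrow> real) \<Rightarrow> 'i + 'i \<Rightarrow> 'i + 'i \<Rightarrow> 'i + 'i \<Rightarrow> real" where
  "trilinear C x y z = pair_sign z * C x y (opposite z)"

text \<open>Ad-invariance on basis vectors, with the second bracket also brought into the first
  slot; the skewness of the form absorbs the minus sign.\<close>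

definition invariant :: "('i + 'i \<Rightarrow> bit) \<Rightarrow> ('i + 'i \<Rightarrow> 'i + 'i \<Rightarrow> 'i + 'i \<Rightarrow> real) \<Rightarrow> bool" where
  "invariant P C \<longleftrightarrow> (\<forall>x y z. trilinear C x y z = psign (P x * (P y + 1)) * trilinear C x z y)"

text \<open>The inner product of \<open>[x, y]\<close> with \<open>[z, w]\<close>, up to sign\<close>

definition bracket_pairing :: "('i::finite + 'i \<Rightarrow> 'i + 'i \<Rightarrow> 'i + 'i \<Rightarrow> real) \<Rightarrow> 'i + 'i \<Rightarrow> 'i + 'i \<Rightarrow> 'i + 'i \<Rightarrow> 'i + 'i \<Rightarrow> real" where
  "bracket_pairing C x y z w = (\<Sum>m\<in>UNIV. C x y m * trilinear C z w m)"

text \<open>The Jacobi identity for \<open>x\<close>, \<open>y\<close>, \<open>z\<close>, paired with \<open>w\<close>.  In this form it is symmetric in all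
  four arguments.\<close>

definition jac4 :: "('i::finite + 'i \<Rightarrow> bit) \<Rightarrow> ('i + 'i \<Rightarrow> 'i + 'i \<Rightarrow> 'i + 'i \<Rightarrow> real) \<Rightarrow> 'i + 'i \<Rightarrow> 'i + 'i \<Rightarrow> 'i + 'i \<Rightarrow> 'i + 'i \<Rightarrow> real" where
  "jac4 P C x y z w = psign (P x * (P y + P z + 1)) * bracket_pairing C y z x w + psign (P z) * bracket_pairing C x y z w
     - psign (P y * P z + P y) * bracket_pairing C x z y w"

context
  fixes p :: "'i::finite \<Rightarrow> bit" and P :: "'i + 'i \<Rightarrow> bit" and C :: "'i + 'i \<Rightarrow> 'i + 'i \<Rightarrow> 'i + 'i \<Rightarrow> real"
  assumes P: "P = double_parity p" and C: "super_skew P C" and inv: "invariant P C"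
begin

lemma P_opposite: "P (opposite x) = P x + 1"
  by (cases x) (simp_all add: P)

lemma trilinear_parity: "trilinear C x y z \<noteq> 0 \<Longrightarrow> P x + P y + P z = 1"
proof -
  assume "trilinear C x y z \<noteq> 0"
  then have "P z + 1 = P x + P y"
    using super_skew_parity[OF C, of x y "opposite z"] by (simp add: trilinear_def P_opposite)
  then show ?thesis
    by (cases "P x"; cases "P y"; cases "P z") simp_all
qed

lemma trilinear_skew: "trilinear C x y z = - psign (P x * P y) * trilinear C y x z"
  unfolding trilinear_def super_skew_swap[OF C, of x y] by simp

lemma trilinear_inv: "trilinear C x y z = psign (P x * (P y + 1)) * trilinear C x z y"
  using inv unfolding invariant_def by blast

lemma bracket_pairing_parity: "bracket_pairing C x y z w \<noteq> 0 \<Longrightarrow> P x + P y + P z + P w = 1"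
proof -
  assume "bracket_pairing C x y z w \<noteq> 0"
  then obtain m where "C x y m \<noteq> 0" "trilinear C z w m \<noteq> 0"
    unfolding bracket_pairing_def by (auto elim!: sum.not_neutral_contains_not_neutral)
  then have "P m = P x + P y" "P z + P w + P m = 1"
    using super_skew_parity[OF C] trilinear_parity by blast+
  then show ?thesis
    by (cases "P x"; cases "P y"; cases "P z"; cases "P w") simp_all
qed

lemma bracket_pairing_skew1: "bracket_pairing C x y z w = - psign (P x * P y) * bracket_pairing C y x z w"
  unfolding bracket_pairing_def sum_distrib_left super_skew_swap[OF C, of x y] by (simp add: mult.assoc)

lemma bracket_pairing_skew2: "bracket_pairing C x y z w = - psign (P z * P w) * bracket_pairing C x y w z"
  unfolding bracket_pairing_def sum_distrib_left trilinear_skew[of z w] by (simp add: mult_ac)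

text \<open>Replacing the summation index by its opposite exchanges the two brackets and reverses
  \<open>pair_sign\<close>.\<close>

lemma bracket_pairing_swap: "bracket_pairing C z w x y = - bracket_pairing C x y z w"
  unfolding bracket_pairing_def trilinear_def sum_UNIV_sum
  by (simp add: sum.distrib[symmetric] sum_negf[symmetric] mult.commute)

text \<open>Invariance converts each double bracket paired with \<open>w\<close> into a pairing of
  two single brackets, one for each splitting of the four vectors into pairs.\<close>

lemma jacobi_at_iff_jac4: "jacobi_at P C x y z (opposite w) \<longleftrightarrow> jac4 P C x y z w = 0"
proof -
  have C': "C a b (opposite w) = pair_sign w * trilinear C a b w" for a b
    by (cases w) (simp_all add: trilinear_def)
  have 1: "(\<Sum>m\<in>UNIV. C y z m * trilinear C x m w) = psign (P x * (P y + P z + 1)) * bracket_pairing C y z x w"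
    unfolding bracket_pairing_def
    by (rule sum_sign) (use super_skew_parity[OF C, of y z] trilinear_inv[of x _ w] in auto)
  have 2: "(\<Sum>m\<in>UNIV. C x y m * trilinear C m z w) = - psign (P z) * bracket_pairing C x y z w"
  proof -
    have "trilinear C m z w = - psign (P z) * trilinear C z w m" for m
      using trilinear_skew[of m z w] trilinear_inv[of z m w] by (cases "P m"; cases "P z") simp_all
    then show ?thesis
      unfolding bracket_pairing_def sum_distrib_left by (simp add: mult_ac)
  qed
  have 3: "(\<Sum>m\<in>UNIV. C x z m * trilinear C y m w) = psign (P y * (P x + P z + 1)) * bracket_pairing C x z y w"
    unfolding bracket_pairing_def
    by (rule sum_sign) (use super_skew_parity[OF C, of x z] trilinear_inv[of y _ w] in auto)
  have sg: "pair_sign w \<noteq> 0" by (cases w) auto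
  have "jacobi_at P C x y z (opposite w) \<longleftrightarrow>
    pair_sign w * (\<Sum>m\<in>UNIV. C y z m * trilinear C x m w) = pair_sign w * ((\<Sum>m\<in>UNIV. C x y m * trilinear C m z w)
      + psign (P x * P y) * (\<Sum>m\<in>UNIV. C x z m * trilinear C y m w))"
    unfolding jacobi_at_def C' by (simp add: sum_distrib_left distrib_left mult_ac)
  also have "\<dots> \<longleftrightarrow> (\<Sum>m\<in>UNIV. C y z m * trilinear C x m w) = (\<Sum>m\<in>UNIV. C x y m * trilinear C m z w)
      + psign (P x * P y) * (\<Sum>m\<in>UNIV. C x z m * trilinear C y m w)"
    using sg by simp
  also have "\<dots> \<longleftrightarrow> jac4 P C x y z w = 0"
    unfolding 1 2 3 jac4_def
    by (cases "P x"; cases "P y"; cases "P z") (simp_all, linarith+)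
  finally show ?thesis .
qed

lemma jac4_swap12: "jac4 P C y x z w = - psign (P x * P y) * jac4 P C x y z w"
  unfolding jac4_def bracket_pairing_skew1[of y x]
  by (cases "P x"; cases "P y"; cases "P z") simp_all

lemma jac4_swap23: "jac4 P C x z y w = - psign (P y * P z) * jac4 P C x y z w"
  unfolding jac4_def bracket_pairing_skew1[of z y]
  by (cases "P x"; cases "P y"; cases "P z") simp_all

text \<open>Swapping \<open>z\<close> and \<open>w\<close> exchanges two of the three pair
  splittings, which \<open>bracket_pairing_swap\<close> matches up, and fixes the third. With the
  two preceding swaps this generates all permutations.\<close>

lemma jac4_swap34: "jac4 P C x y w z = 0 \<longleftrightarrow> jac4 P C x y z w = 0"
proof -
  have q: "bracket_pairing C y w x z = - bracket_pairing C x z y w" "bracket_pairing C x w y z = - bracket_pairing C y z x w"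
    "bracket_pairing C x y w z = - psign (P w * P z) * bracket_pairing C x y z w"
    by (rule bracket_pairing_swap bracket_pairing_skew2)+
  have par: "P x + P z + P y + P w = P x + P y + P z + P w" "P y + P z + P x + P w = P x + P y + P z + P w"
    by (simp_all add: ac_simps)
  consider "P x + P y + P z + P w = 1" |
    "bracket_pairing C x z y w = 0" "bracket_pairing C y z x w = 0" "bracket_pairing C x y z w = 0"
    using bracket_pairing_parity[of x y z w] bracket_pairing_parity[of x z y w] bracket_pairing_parity[of y z x w]
    unfolding par by blast
  then show ?thesis
  proof cases
    case 1
    then show ?thesis
      unfolding jac4_def q
      by (cases "P x"; cases "P y"; cases "P z"; cases "P w") (simp_all, linarith+)
  next
    case 2
    then show ?thesis unfolding jac4_def q by simp
  qed
qed

text \<open>Adjacent swaps move every \<open>Inl\<close> to the front, so only the number of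
  arguments in each summand matters. The fourth case keeps its \<open>Inl\<close> last, where it
  selects a component of the Jacobi identity of \<open>\<Pi>\<gg>\<^sup>*\<close>.\<close>

lemma jac4_eq_0:
  assumes "\<And>i j k l. jac4 P C (Inl i) (Inl j) (Inl k) (Inl l) = 0"
    and "\<And>i j k l. jac4 P C (Inl i) (Inl j) (Inl k) (Inr l) = 0"
    and "\<And>i j k l. jac4 P C (Inl i) (Inl j) (Inr k) (Inr l) = 0"
    and "\<And>i j k l. jac4 P C (Inr i) (Inr j) (Inr k) (Inl l) = 0"
    and "\<And>i j k l. jac4 P C (Inr i) (Inr j) (Inr k) (Inr l) = 0"
  shows "jac4 P C x y z w = 0"
proof -
  have sort: "jac4 P C (Inr i) (Inl j) z w = 0 \<longleftrightarrow> jac4 P C (Inl j) (Inr i) z w = 0"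
    "jac4 P C x (Inr i) (Inl j) w = 0 \<longleftrightarrow> jac4 P C x (Inl j) (Inr i) w = 0"
    "jac4 P C x y (Inr i) (Inl j) = 0 \<longleftrightarrow> jac4 P C x y (Inl j) (Inr i) = 0" for i j x y z w
    using jac4_swap12[of "Inr i" "Inl j" z w] jac4_swap23[of x "Inr i" "Inl j" w] jac4_swap34[of x y "Inl j" "Inr i"]
    by simp_all
  show ?thesis
    using assms by (cases x; cases y; cases z; cases w) (simp_all add: sort)
qed

end

text \<open>The mixed values are those forced by invariance of the inner product.\<close>

fun double_const :: "('i \<Rightarrow> bit) \<Rightarrow> ('i \<Rightarrow> 'i \<Rightarrow> 'i \<Rightarrow> real) \<Rightarrow> ('i \<Rightarrow> 'i \<Rightarrow> 'i \<Rightarrow> real) \<Rightarrow> 'i + 'i \<Rightarrow> 'i + 'i \<Rightarrow> 'i + 'i \<Rightarrow> real" where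
  "double_const p c f (Inl i) (Inl j) (Inl k) = c i j k"
| "double_const p c f (Inl i) (Inl j) (Inr k) = 0"
| "double_const p c f (Inl i) (Inr j) (Inl k) = psign (p j + 1) * f j k i"
| "double_const p c f (Inl i) (Inr j) (Inr k) = - psign (p i * p j) * c i k j"
| "double_const p c f (Inr j) (Inl i) (Inl k) = - psign ((p j + 1) * (p i + 1)) * f j k i"
| "double_const p c f (Inr j) (Inl i) (Inr k) = psign (p i) * c i k j"
| "double_const p c f (Inr i) (Inr j) (Inl k) = 0"
| "double_const p c f (Inr i) (Inr j) (Inr k) = f i j k"

text \<open>The bracket on \<open>\<Pi>\<dd>(\<gg>)\<^sup>*\<close>: here \<open>Inl i\<close> is the shifted dual basis vector of \<open>e\<^sub>i\<close>, so the first summand is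
  \<open>\<Pi>\<gg>\<^sup>*\<close>, and \<open>Inr i\<close> is that of \<open>\<epsilon>\<^sup>i\<close>, so the second summand is \<open>\<gg>\<close>.\<close>

fun sum_const :: "('i \<Rightarrow> 'i \<Rightarrow> 'i \<Rightarrow> real) \<Rightarrow> ('i \<Rightarrow> 'i \<Rightarrow> 'i \<Rightarrow> real) \<Rightarrow> 'i + 'i \<Rightarrow> 'i + 'i \<Rightarrow> 'i + 'i \<Rightarrow> real" where
  "sum_const f c (Inl i) (Inl j) (Inl k) = f i j k"
| "sum_const f c (Inr i) (Inr j) (Inr k) = c i j k"
| "sum_const f c _ _ _ = 0"

section \<open>The bracket of the double and the direct sum bracket on its dual\<close>

lemma invariant_double_const:
  assumes c: "super_skew p c" and f: "super_skew (shifted p) f"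
  shows "invariant (double_parity p) (double_const p c f)"
  unfolding invariant_def
proof (intro allI)
  fix x y z :: "'a + 'a"
  have c': "c i j k = 0 \<or> p k = p i + p j" "f i j k = 0 \<or> p k = p i + p j + 1" for i j k
    using super_skew_parity[OF c, of i j k] super_skew_parity[OF f, of i j k]
    by (cases "p i"; cases "p j"; cases "p k"; force)+
  show "trilinear (double_const p c f) x y z =
      psign (double_parity p x * (double_parity p y + 1)) * trilinear (double_const p c f) x z y"
  proof (cases x)
    case (Inl i)
    show ?thesis
    proof (cases y; cases z)
      fix j k assume "y = Inl j" "z = Inr k"
      then show ?thesis
        using c'(1)[of i j k]
        by (cases "p i"; cases "p j"; cases "p k") (simp_all add: trilinear_def Inl)
    next
      fix j k assume "y = Inr j" "z = Inl k"
      then show ?thesis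
        using c'(1)[of i k j]
        by (cases "p i"; cases "p j"; cases "p k") (simp_all add: trilinear_def Inl)
    next
      fix j k assume "y = Inr j" "z = Inr k"
      then show ?thesis
        using super_skew_swap[OF f, of j k i] c'(2)[of j k i]
        by (cases "p i"; cases "p j"; cases "p k") (simp_all add: trilinear_def Inl)
    qed (simp_all add: trilinear_def Inl)
  next
    case (Inr i)
    show ?thesis
    proof (cases y; cases z)
      fix j k assume "y = Inl j" "z = Inr k"
      then show ?thesis
        using c'(2)[of i k j]
        by (cases "p i"; cases "p j"; cases "p k") (simp_all add: trilinear_def Inr)
    next
      fix j k assume "y = Inr j" "z = Inl k"
      then show ?thesis
        using c'(2)[of i j k]
        by (cases "p i"; cases "p j"; cases "p k") (simp_all add: trilinear_def Inr)
    next
      fix j k assume "y = Inl j" "z = Inl k"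
      then show ?thesis
        using super_skew_swap[OF c, of j k i] c'(1)[of j k i]
        by (cases "p i"; cases "p j"; cases "p k") (simp_all add: trilinear_def Inr)
    qed (simp_all add: trilinear_def Inr)
  qed
qed

lemma super_skew_double_const:
  assumes c: "super_skew p c" and f: "super_skew (shifted p) f"
  shows "super_skew (double_parity p) (double_const p c f)"
  unfolding super_skew_def
proof (intro conjI allI impI)
  fix x y z
  have f': "p k = p i + p j + 1" if "f i j k \<noteq> 0" for i j k
    using super_skew_parity[OF f that] by (cases "p i"; cases "p j"; cases "p k") simp_all
  show "double_parity p z = double_parity p x + double_parity p y" if "double_const p c f x y z \<noteq> 0"
    using that
    by (cases x; cases y; cases z) (auto dest!: super_skew_parity[OF c] f' simp: add_ac)
  show "double_const p c f x y z = - psign (double_parity p x * double_parity p y) * double_const p c f y x z"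
  proof (cases x; cases y; cases z)
    fix i j k assume "x = Inl i" "y = Inl j" "z = Inl k"
    then show ?thesis using super_skew_swap[OF c, of i j k] by simp
  next
    fix i j k assume "x = Inr i" "y = Inr j" "z = Inr k"
    then show ?thesis using super_skew_swap[OF f, of i j k] by simp
  qed (auto simp: distrib_left distrib_right psign_add mult_ac)
qed

lemma super_skew_sum_const:
  assumes c: "super_skew p c" and f: "super_skew (shifted p) f"
  shows "super_skew (shifted (double_parity p)) (sum_const f c)"
  unfolding super_skew_def
proof (intro conjI allI impI)
  fix x y z
  show "double_parity p z + 1 = double_parity p x + 1 + (double_parity p y + 1)" if "sum_const f c x y z \<noteq> 0"
    using that
    by (cases x; cases y; cases z) (auto dest!: super_skew_parity[OF c] super_skew_parity[OF f])
  show "sum_const f c x y z = - psign ((double_parity p x + 1) * (double_parity p y + 1)) * sum_const f c y x z"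
  proof (cases x; cases y; cases z)
    fix i j k assume "x = Inl i" "y = Inl j" "z = Inl k"
    then show ?thesis using super_skew_swap[OF f, of i j k] by simp
  next
    fix i j k assume "x = Inr i" "y = Inr j" "z = Inr k"
    then show ?thesis using super_skew_swap[OF c, of i j k] by simp
  qed simp_all
qed

lemma lie_consts_sum_const:
  assumes c: "lie_consts p c" and f: "lie_consts (shifted p) f"
  shows "lie_consts (shifted (double_parity p)) (sum_const f c)"
proof -
  have "jacobi_at (shifted (double_parity p)) (sum_const f c) x y z w" for x y z w
  proof (cases x; cases y; cases z; cases w)
    fix i j k l assume "x = Inl i" "y = Inl j" "z = Inl k" "w = Inl l"
    moreover have "jacobi_at (shifted p) f i j k l" using f by (simp add: lie_consts_def)
    ultimately show ?thesis by (simp add: jacobi_at_def sum_UNIV_sum)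
  next
    fix i j k l assume "x = Inr i" "y = Inr j" "z = Inr k" "w = Inr l"
    moreover have "jacobi_at p c i j k l" using c by (simp add: lie_consts_def)
    ultimately show ?thesis by (simp add: jacobi_at_def sum_UNIV_sum)
  qed (simp_all add: jacobi_at_def sum_UNIV_sum)
  then show ?thesis
    using assms super_skew_sum_const unfolding lie_consts_def by blast
qed

lemma lie_consts_double_const:
  assumes c: "lie_consts p c" and f: "lie_consts (shifted p) f" and cocycle: "cocycle p c f"
  shows "lie_consts (double_parity p) (double_const p c f)"
proof -
  let ?P = "double_parity p" and ?C = "double_const p c f"
  have sc: "super_skew p c" and sf: "super_skew (shifted p) f"
    and jc: "\<And>i j k l. jacobi_at p c i j k l" and jf: "\<And>i j k l. jacobi_at (shifted p) f i j k l"
    using c f by (auto simp: lie_consts_def)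
  note C = super_skew_double_const[OF sc sf] and inv = invariant_double_const[OF sc sf]
  note iff = jacobi_at_iff_jac4[OF refl C inv]
  have "jac4 ?P ?C x y z w = 0" for x y z w
  proof (rule jac4_eq_0[OF refl C inv])
    fix i j k l
    \<comment> \<open>Each summand is closed under the bracket and isotropic, so all pairings of
      brackets vanish.\<close>
    show "jac4 ?P ?C (Inl i) (Inl j) (Inl k) (Inl l) = 0" "jac4 ?P ?C (Inr i) (Inr j) (Inr k) (Inr l) = 0"
      by (simp_all add: jac4_def bracket_pairing_def trilinear_def sum_UNIV_sum)
    \<comment> \<open>Pairing with \<open>\<epsilon>^l\<close> selects the component along
      \<open>e_l\<close>, so only constants of \<open>\<gg>\<close> occur.\<close>
    have "jacobi_at ?P ?C (Inl i) (Inl j) (Inl k) (opposite (Inr l))"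
      using jc[of i j k l] unfolding jacobi_at_def sum_UNIV_sum by simp
    then show "jac4 ?P ?C (Inl i) (Inl j) (Inl k) (Inr l) = 0"
      unfolding iff .
    have "jacobi_at ?P ?C (Inr i) (Inr j) (Inr k) (opposite (Inl l))"
      using jf[of i j k l] unfolding jacobi_at_def sum_UNIV_sum by simp
    then show "jac4 ?P ?C (Inr i) (Inr j) (Inr k) (Inl l) = 0"
      unfolding iff .
    show "jac4 ?P ?C (Inl i) (Inl j) (Inr k) (Inr l) = 0"
    proof -
      \<comment> \<open>\<open>[e_i, e_j]\<close> and \<open>[\<epsilon>^k, \<epsilon>^l]\<close>
        meet in a single sum, whereas each mixed bracket has components in both summands, so a
        pairing of two of them gives two sums. Altogether these are the five sums of the cocycle
        condition.\<close>
      have q1: "bracket_pairing ?C (Inl i) (Inl j) (Inr k) (Inr l) = - inner_sum c f i j k l"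
        by (simp add: bracket_pairing_def trilinear_def sum_UNIV_sum inner_sum_def sum_negf)
      have q2: "bracket_pairing ?C (Inl i) (Inr k) (Inl j) (Inr l) =
          psign (p k + p j * p l + (p k + 1) * (p l + p j + 1)) * mixed_sum c f j i l k
          + psign (p i * p k + p l + 1 + (p l + 1) * (p k + p i + 1)) * mixed_sum c f i j k l" for i j
      proof -
        have a: "(\<Sum>m\<in>UNIV. psign (p k + 1) * f k m i * (psign (p j * p l) * c j m l)) =
            psign (p k + p j * p l + (p k + 1) * (p l + p j + 1)) * mixed_sum c f j i l k"
          by (rule sum_mixed[OF sc sf]) (simp_all add: psign_add super_skew_swap[OF sf, of k])
        have b: "(\<Sum>m\<in>UNIV. - (psign (p i * p k) * c i m k) * (psign (p l + 1) * f l m j)) =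
            psign (p i * p k + p l + 1 + (p l + 1) * (p k + p i + 1)) * mixed_sum c f i j k l"
          by (rule sum_mixed[OF sc sf]) (simp_all add: psign_add super_skew_swap[OF sf, of l])
        show ?thesis
          unfolding a[symmetric] b[symmetric]
          by (simp add: bracket_pairing_def trilinear_def sum_UNIV_sum)
      qed
      have coc: "(\<Sum>m\<in>UNIV. c i j m * cobracket_const p f m k l) =
          psign (p i) * ad_tensor_const p c i (cobracket_const p f j) k l - psign (p i * p j + p j) * ad_tensor_const p c j (cobracket_const p f i) k l"
        using cocycle unfolding cocycle_def by blast
      consider "p i + p j + p k + p l = 1" |
        "inner_sum c f i j k l = 0" "mixed_sum c f i j k l = 0" "mixed_sum c f j i l k = 0"
        "mixed_sum c f j i k l = 0" "mixed_sum c f i j l k = 0"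
        using inner_sum_parity[OF sc sf, of i j k l] mixed_sum_parity[OF sc sf, of i j k l]
          mixed_sum_parity[OF sc sf, of j i l k] mixed_sum_parity[OF sc sf, of j i k l]
          mixed_sum_parity[OF sc sf, of i j l k] by (metis add.commute add.left_commute)
      then show ?thesis
      proof cases
        case 1
        then show ?thesis
          using coc unfolding jac4_def q1 q2 ad_tensor_const_cobracket[OF sc sf] sum_cobracket[OF sc sf]
          by (cases "p i"; cases "p j"; cases "p k"; cases "p l") simp_all
      next
        case 2
        then show ?thesis
          unfolding jac4_def q1 q2 by simp
      qed
    qed
  qed
  then have "jacobi_at ?P ?C x y z (opposite w)" for x y z w
    unfolding iff .
  then have "jacobi_at ?P ?C x y z w" for x y z w
    by (metis opposite_opposite)
  with C show ?thesis
    by (simp add: lie_consts_def)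
qed

text \<open>The coefficients of \<open>\<rho>\<close>. The 1/2 is that of the symmetric product;
  since \<open>e_i\<close> and \<open>\<epsilon>^i\<close> have opposite parities, both orders carry
  a plus sign.\<close>

definition rho_const :: "'i + 'i \<Rightarrow> 'i + 'i \<Rightarrow> real" where
  "rho_const x y = (if y = opposite x then 1/2 else 0)"

lemma ad_tensor_const_rho_const:
  "ad_tensor_const P C k rho_const a b = 1/2 * (C k (opposite b) a + psign (P k * P a) * C k (opposite a) b)"
proof -
  have "b = opposite m \<longleftrightarrow> m = opposite b" for m by auto
  then show ?thesis
    by (simp add: ad_tensor_const_def rho_const_def if_distrib[of "(*) _"] distrib_left cong: if_cong)
qed

text \<open>Within one summand the two halves of the coboundary agree by skew-symmetry. With indices
  from both summands they are zero or cancel, because the mixed constants come from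
  invariance.\<close>

lemma cobracket_const_sum_const:
  assumes c: "super_skew p c" and f: "super_skew (shifted p) f"
  shows "cobracket_const (double_parity p) (sum_const f c) z x y =
    psign (double_parity p z) * ad_tensor_const (double_parity p) (double_const p c f) z rho_const x y"
proof -
  have c': "c i j k = 0 \<or> p k = p i + p j" "f i j k = 0 \<or> p k = p i + p j + 1" for i j k
    using super_skew_parity[OF c, of i j k] super_skew_parity[OF f, of i j k]
    by (cases "p i"; cases "p j"; cases "p k"; force)+
  show ?thesis
  proof (cases x; cases y; cases z)
    fix i j k assume "x = Inl i" "y = Inl j" "z = Inl k"
    then show ?thesis
      using super_skew_swap[OF f, of i j k] c'(2)[of j i k]
      by (cases "p i"; cases "p j"; cases "p k") (simp_all add: ad_tensor_const_rho_const cobracket_const_def)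
  next
    fix i j k assume "x = Inr i" "y = Inr j" "z = Inr k"
    then show ?thesis
      using super_skew_swap[OF c, of i j k] c'(1)[of j i k]
      by (cases "p i"; cases "p j"; cases "p k") (simp_all add: ad_tensor_const_rho_const cobracket_const_def)
  next
    fix i j k assume "x = Inl i" "y = Inr j" "z = Inr k"
    then show ?thesis
      using c'(2)[of k i j]
      by (cases "p i"; cases "p j"; cases "p k") (simp_all add: ad_tensor_const_rho_const cobracket_const_def)
  next
    fix i j k assume "x = Inr i" "y = Inl j" "z = Inl k"
    then show ?thesis
      using c'(1)[of k i j]
      by (cases "p i"; cases "p j"; cases "p k") (simp_all add: ad_tensor_const_rho_const cobracket_const_def)
  next
    fix i j k assume "x = Inr i" "y = Inl j" "z = Inr k"
    then show ?thesis
      using c'(2)[of k j i]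
      by (cases "p i"; cases "p j"; cases "p k") (simp_all add: ad_tensor_const_rho_const cobracket_const_def)
  next
    fix i j k assume "x = Inl i" "y = Inr j" "z = Inl k"
    then show ?thesis
      using c'(1)[of k j i]
      by (cases "p i"; cases "p j"; cases "p k") (simp_all add: ad_tensor_const_rho_const cobracket_const_def)
  qed (simp_all add: ad_tensor_const_rho_const cobracket_const_def)
qed

text \<open>Invariance trades \<open>[e_i, \<epsilon>^j]\<close> paired with \<open>e_k\<close> for
  \<open>[e_i, e_k]\<close> paired with \<open>\<epsilon>^j\<close>, and likewise with the summands
  exchanged; skew-symmetry gives the opposite orders.\<close>

lemma double_const_unique:
  assumes C: "super_skew (double_parity p) C" and inv: "invariant (double_parity p) C"
    and l: "\<And>i j k. C (Inl i) (Inl j) (Inl k) = c i j k" "\<And>i j k. C (Inl i) (Inl j) (Inr k) = 0"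
    and r: "\<And>i j k. C (Inr i) (Inr j) (Inr k) = f i j k" "\<And>i j k. C (Inr i) (Inr j) (Inl k) = 0"
  shows "C = double_const p c f"
proof (intro ext)
  fix x y z
  have trilinear: "trilinear C x y z = psign (double_parity p x * (double_parity p y + 1)) * trilinear C x z y" for x y z
    using inv unfolding invariant_def by blast
  have 1: "C (Inr j) (Inl i) (Inl k) = - psign ((p j + 1) * (p i + 1)) * f j k i" for i j k
    using trilinear[of "Inr j" "Inl i" "Inr k"] by (simp add: trilinear_def r)
  have 2: "C (Inl i) (Inr j) (Inr k) = - psign (p i * p j) * c i k j" for i j k
    using trilinear[of "Inl i" "Inr j" "Inl k"] by (simp add: trilinear_def l)
  have 3: "C (Inl i) (Inr j) (Inl k) = psign (p j + 1) * f j k i" for i j k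
    using super_skew_swap[OF C, of "Inl i" "Inr j" "Inl k"] unfolding 1
    by (cases "p i"; cases "p j") simp_all
  have 4: "C (Inr j) (Inl i) (Inr k) = psign (p i) * c i k j" for i j k
    using super_skew_swap[OF C, of "Inr j" "Inl i" "Inr k"] unfolding 2
    by (cases "p i"; cases "p j") simp_all
  show "C x y z = double_const p c f x y z"
    by (cases x; cases y; cases z) (simp_all add: l r 1 2 3 4)
qed


section \<open>From structure constants to brackets\<close>

definition bracket_of :: "('i::finite \<Rightarrow> 'i \<Rightarrow> 'i \<Rightarrow> real) \<Rightarrow> real^'i \<Rightarrow> real^'i \<Rightarrow> real^'i" where
  "bracket_of c u v = (\<chi> k. \<Sum>i\<in>UNIV. \<Sum>j\<in>UNIV. u $ i * v $ j * c i j k)"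

lemma bilinear_bracket_of: "bilinear (bracket_of c)"
  unfolding bilinear_def
  by (intro conjI allI linearI)
    (simp_all add: bracket_of_def vec_eq_iff algebra_simps sum.distrib sum_distrib_left)

lemma sum_axis_left: "(\<Sum>i\<in>UNIV. axis a 1 $ i * g i) = (g a :: real)"
  by (simp add: axis_def if_distrib[of "\<lambda>x. x * _"] cong: if_cong)

lemma struct_const_bracket_of [simp]: "struct_const (bracket_of c) = c"
  by (simp add: fun_eq_iff struct_const_def bracket_of_def mult.assoc sum_distrib_left[symmetric] sum_axis_left)

lemma bracket_of_struct_const:
  assumes "bilinear br"
  shows "br = bracket_of (struct_const br)"
proof (intro ext)
  fix u v
  have exp: "w = (\<Sum>i\<in>UNIV. w $ i *\<^sub>R axis i 1)" for w :: "real^'a"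
    using basis_expansion[of w] by (simp add: scalar_mult_eq_scaleR)
  have "br u v = br (\<Sum>i\<in>UNIV. u $ i *\<^sub>R axis i 1) (\<Sum>j\<in>UNIV. v $ j *\<^sub>R axis j 1)"
    using exp by metis
  also have "\<dots> = (\<Sum>(i, j)\<in>UNIV \<times> UNIV. br (u $ i *\<^sub>R axis i 1) (v $ j *\<^sub>R axis j 1))"
    by (rule bilinear_sum[OF assms])
  also have "\<dots> = (\<Sum>i\<in>UNIV. \<Sum>j\<in>UNIV. (u $ i * v $ j) *\<^sub>R br (axis i 1) (axis j 1))"
    by (simp add: sum.cartesian_product bilinear_lmul[OF assms] bilinear_rmul[OF assms] mult.commute)
  also have "\<dots> = bracket_of (struct_const br) u v"
    by (simp add: bracket_of_def struct_const_def vec_eq_iff)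
  finally show "br u v = bracket_of (struct_const br) u v" .
qed

lemma bracket_component:
  "bilinear br \<Longrightarrow> br u v $ k = (\<Sum>i\<in>UNIV. \<Sum>j\<in>UNIV. u $ i * v $ j * struct_const br i j k)"
  by (subst bracket_of_struct_const, assumption) (simp add: bracket_of_def)

lemma homogeneous_axis [simp]: "homogeneous p (p i) (axis i 1)"
  by (simp add: homogeneous_def axis_def)

lemma bracket_axis_left:
  assumes "bilinear br"
  shows "br (axis i 1) v $ k = (\<Sum>m\<in>UNIV. v $ m * struct_const br i m k)"
  by (simp add: bracket_component[OF assms] mult.assoc sum_distrib_left[symmetric] sum_axis_left)

lemma bracket_axis_right:
  assumes "bilinear br"
  shows "br u (axis j 1) $ k = (\<Sum>m\<in>UNIV. u $ m * struct_const br m j k)"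
  by (simp add: bracket_component[OF assms] mult.assoc sum_distrib_left[symmetric] sum_axis_left)

lemma bracket_left_assoc:
  assumes "bilinear br"
  shows "br u (br v w) $ l = (\<Sum>i\<in>UNIV. \<Sum>j\<in>UNIV. \<Sum>k\<in>UNIV.
    u $ i * v $ j * w $ k * (\<Sum>m\<in>UNIV. struct_const br j k m * struct_const br i m l))"
proof -
  have "br u (br v w) $ l = (\<Sum>i\<in>UNIV. \<Sum>m\<in>UNIV. \<Sum>j\<in>UNIV. \<Sum>k\<in>UNIV.
      u $ i * v $ j * w $ k * (struct_const br j k m * struct_const br i m l))"
    by (simp add: bracket_component[OF assms, of u] bracket_component[OF assms, of v]
        sum_distrib_left sum_distrib_right mult_ac)
  also have "\<dots> = (\<Sum>i\<in>UNIV. \<Sum>j\<in>UNIV. \<Sum>k\<in>UNIV. \<Sum>m\<in>UNIV.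
      u $ i * v $ j * w $ k * (struct_const br j k m * struct_const br i m l))"
    by (rule sum.cong[OF refl]) (rule sum_rotate)
  finally show ?thesis by (simp add: sum_distrib_left)
qed

lemma bracket_right_assoc:
  assumes "bilinear br"
  shows "br (br u v) w $ l = (\<Sum>i\<in>UNIV. \<Sum>j\<in>UNIV. \<Sum>k\<in>UNIV.
    u $ i * v $ j * w $ k * (\<Sum>m\<in>UNIV. struct_const br i j m * struct_const br m k l))"
proof -
  have "br (br u v) w $ l = (\<Sum>k\<in>UNIV. \<Sum>m\<in>UNIV. \<Sum>i\<in>UNIV. \<Sum>j\<in>UNIV.
      u $ i * v $ j * w $ k * (struct_const br i j m * struct_const br m k l))"
    by (subst sum.swap)
      (simp add: bracket_component[OF assms, of _ w] bracket_component[OF assms, of u]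
        sum_distrib_left sum_distrib_right mult_ac)
  also have "\<dots> = (\<Sum>k\<in>UNIV. \<Sum>i\<in>UNIV. \<Sum>j\<in>UNIV. \<Sum>m\<in>UNIV.
      u $ i * v $ j * w $ k * (struct_const br i j m * struct_const br m k l))"
    by (rule sum.cong[OF refl]) (rule sum_rotate)
  also have "\<dots> = (\<Sum>i\<in>UNIV. \<Sum>j\<in>UNIV. \<Sum>k\<in>UNIV. \<Sum>m\<in>UNIV.
      u $ i * v $ j * w $ k * (struct_const br i j m * struct_const br m k l))"
    by (rule sum_rotate)
  finally show ?thesis by (simp add: sum_distrib_left)
qed

lemma lie_superalgebra_lie_consts:
  assumes "lie_superalgebra p br"
  shows "lie_consts p (struct_const br)"
proof -
  have bil: "bilinear br"
    and par: "\<And>a b u v. homogeneous p a u \<Longrightarrow> homogeneous p b v \<Longrightarrow> homogeneous p (a + b) (br u v)"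
    and skew: "\<And>a b u v. homogeneous p a u \<Longrightarrow> homogeneous p b v \<Longrightarrow> br u v = - (psign (a * b) *\<^sub>R br v u)"
    and jac: "\<And>a b c u v w. homogeneous p a u \<Longrightarrow> homogeneous p b v \<Longrightarrow> homogeneous p c w \<Longrightarrow>
        br u (br v w) = br (br u v) w + psign (a * b) *\<^sub>R br v (br u w)"
    using assms unfolding lie_superalgebra_def by blast+
  have "p k = p i + p j" if "struct_const br i j k \<noteq> 0" for i j k
    using par[OF homogeneous_axis[of p i] homogeneous_axis[of p j]] that
    by (simp add: homogeneous_def struct_const_def)
  moreover have "struct_const br i j k = - psign (p i * p j) * struct_const br j i k" for i j k
    using arg_cong[OF skew[OF homogeneous_axis[of p i] homogeneous_axis[of p j]], of "\<lambda>v. v $ k"]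
    by (simp add: struct_const_def)
  moreover have "jacobi_at p (struct_const br) i j k l" for i j k l
    using arg_cong[OF jac[OF homogeneous_axis[of p i] homogeneous_axis[of p j] homogeneous_axis[of p k]], of "\<lambda>v. v $ l"]
    by (simp add: jacobi_at_def bracket_axis_left[OF bil] bracket_axis_right[OF bil]
        struct_const_def[symmetric] mult.commute)
  ultimately show ?thesis
    unfolding lie_consts_def super_skew_def by blast
qed

text \<open>Homogeneous vectors are supported on indices of their own parity, so the signs in the
  identities for constants are the same in every contributing term.\<close>

lemma lie_superalgebra_bracket_of:
  assumes "lie_consts p c"
  shows "lie_superalgebra p (bracket_of c)"
proof -
  have c: "super_skew p c" and jac: "\<And>i j k l. jacobi_at p c i j k l"
    using assms by (auto simp: lie_consts_def)
  note bil = bilinear_bracket_of[of c]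
  have comp: "bracket_of c u v $ k = (\<Sum>i\<in>UNIV. \<Sum>j\<in>UNIV. u $ i * v $ j * c i j k)" for u v k
    by (simp add: bracket_of_def)
  have "homogeneous p (a + b) (bracket_of c u v)" if u: "homogeneous p a u" and v: "homogeneous p b v" for a b u v
    unfolding homogeneous_def
  proof (intro allI impI)
    fix k assume "bracket_of c u v $ k \<noteq> 0"
    then obtain i j where "u $ i * v $ j * c i j k \<noteq> 0"
      unfolding comp by (auto elim!: sum.not_neutral_contains_not_neutral)
    then show "p k = a + b"
      using u v super_skew_parity[OF c, of i j k] by (auto simp: homogeneous_def)
  qed
  moreover have "bracket_of c u v = - (psign (a * b) *\<^sub>R bracket_of c v u)"
    if u: "homogeneous p a u" and v: "homogeneous p b v" for a b u v
  proof (subst vec_eq_iff, rule allI)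
    fix k
    have "bracket_of c u v $ k = (\<Sum>i\<in>UNIV. \<Sum>j\<in>UNIV. - psign (a * b) * (v $ j * u $ i * c j i k))"
      unfolding comp
    proof (intro sum.cong refl)
      fix i j
      show "u $ i * v $ j * c i j k = - psign (a * b) * (v $ j * u $ i * c j i k)"
      proof (cases "u $ i = 0 \<or> v $ j = 0")
        case False
        then have "p i = a" "p j = b" using u v by (auto simp: homogeneous_def)
        then show ?thesis using super_skew_swap[OF c, of i j k] by simp
      qed auto
    qed
    also have "\<dots> = - psign (a * b) * bracket_of c v u $ k"
      unfolding comp sum_distrib_left by (rule sum.swap)
    finally show "bracket_of c u v $ k = (- (psign (a * b) *\<^sub>R bracket_of c v u)) $ k"
      by simp
  qed
  moreover have "bracket_of c u (bracket_of c v w) =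
      bracket_of c (bracket_of c u v) w + psign (a * b) *\<^sub>R bracket_of c v (bracket_of c u w)"
    if u: "homogeneous p a u" and v: "homogeneous p b v" for a b u v w
  proof (subst vec_eq_iff, rule allI)
    fix l
    have "bracket_of c u (bracket_of c v w) $ l = (\<Sum>i\<in>UNIV. \<Sum>j\<in>UNIV. \<Sum>k\<in>UNIV.
        u $ i * v $ j * w $ k * (\<Sum>m\<in>UNIV. c i j m * c m k l) +
        psign (a * b) * (v $ j * u $ i * w $ k * (\<Sum>m\<in>UNIV. c i k m * c j m l)))"
      unfolding bracket_left_assoc[OF bil] struct_const_bracket_of
    proof (intro sum.cong refl)
      fix i j k
      show "u $ i * v $ j * w $ k * (\<Sum>m\<in>UNIV. c j k m * c i m l) =
        u $ i * v $ j * w $ k * (\<Sum>m\<in>UNIV. c i j m * c m k l) +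
        psign (a * b) * (v $ j * u $ i * w $ k * (\<Sum>m\<in>UNIV. c i k m * c j m l))"
      proof (cases "u $ i = 0 \<or> v $ j = 0")
        case False
        then have "p i = a" "p j = b" using u v by (auto simp: homogeneous_def)
        then show ?thesis using jac[of i j k l] by (simp add: jacobi_at_def algebra_simps)
      qed auto
    qed
    also have "\<dots> = bracket_of c (bracket_of c u v) w $ l + psign (a * b) * (\<Sum>i\<in>UNIV. \<Sum>j\<in>UNIV. \<Sum>k\<in>UNIV.
        v $ j * u $ i * w $ k * (\<Sum>m\<in>UNIV. c i k m * c j m l))"
      unfolding bracket_right_assoc[OF bil] struct_const_bracket_of
      by (simp only: sum.distrib sum_distrib_left)
    also have "(\<Sum>i\<in>UNIV. \<Sum>j\<in>UNIV. \<Sum>k\<in>UNIV. v $ j * u $ i * w $ k * (\<Sum>m\<in>UNIV. c i k m * c j m l)) =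
        bracket_of c v (bracket_of c u w) $ l"
      unfolding bracket_left_assoc[OF bil] struct_const_bracket_of by (rule sum.swap)
    finally show "bracket_of c u (bracket_of c v w) $ l =
      (bracket_of c (bracket_of c u v) w + psign (a * b) *\<^sub>R bracket_of c v (bracket_of c u w)) $ l"
      by simp
  qed
  ultimately show ?thesis
    unfolding lie_superalgebra_def using bil by blast
qed

text \<open>Here smooth functions leave the argument: all that follows is algebra of structure
  constants.\<close>

lemma odd_lie_bialgebra_iff:
  "odd_lie_bialgebra p br brs \<longleftrightarrow>
     lie_superalgebra p br \<and> lie_superalgebra (shifted p) brs \<and> cocycle p (struct_const br) (struct_const brs)"
proof -
  have "compatible p br brs \<longleftrightarrow> cocycle p (struct_const br) (struct_const brs)"
    if "lie_superalgebra p br" "lie_superalgebra (shifted p) brs"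
  proof -
    have "super_skew p (struct_const br)" "super_skew (shifted p) (struct_const brs)"
      using that[THEN lie_superalgebra_lie_consts] by (simp_all add: lie_consts_def)
    then show ?thesis
      by (simp only: compatible_iff_lie_deriv lie_deriv_iff_cocycle)
  qed
  then show ?thesis
    unfolding odd_lie_bialgebra_def compatible_def by blast
qed

section \<open>Inner product, cobracket and coboundary in coordinates\<close>

lemma natural_form_sum:
  "natural_form u v = (\<Sum>z\<in>UNIV. pair_sign z * u $ opposite z * v $ z)"
  by (simp add: natural_form_def sum_UNIV_sum sum_subtractf sum_negf)

text \<open>Nonzero products occur only between basis vectors of opposite parity, where the symmetry
  sign of an odd symmetric inner product is -1.\<close>

lemma natural_form_skew: "natural_form u v = - natural_form v u"
  by (simp add: natural_form_def sum_negf[symmetric] mult.commute)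

lemma natural_form_bracket:
  assumes "bilinear BR"
  shows "natural_form (BR u v) w = (\<Sum>x\<in>UNIV. \<Sum>y\<in>UNIV. \<Sum>z\<in>UNIV. u $ x * v $ y * w $ z * trilinear (struct_const BR) x y z)"
proof -
  have "natural_form (BR u v) w = (\<Sum>z\<in>UNIV. \<Sum>x\<in>UNIV. \<Sum>y\<in>UNIV. u $ x * v $ y * w $ z * trilinear (struct_const BR) x y z)"
    by (simp add: natural_form_sum bracket_component[OF assms] trilinear_def sum_distrib_left sum_distrib_right mult_ac)
  then show ?thesis by (subst (asm) sum_rotate)
qed

lemma sum_axis3:
  "(\<Sum>x\<in>UNIV. \<Sum>y\<in>UNIV. \<Sum>z\<in>UNIV. axis a 1 $ x * axis b 1 $ y * axis c 1 $ z * t x y z) = (t a b c :: real)"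
  by (simp add: mult.assoc sum_distrib_left[symmetric] sum_axis_left)

lemma ad_invariant_iff:
  assumes "bilinear BR"
  shows "ad_invariant P BR natural_form \<longleftrightarrow> invariant P (struct_const BR)"
proof
  assume ad: "ad_invariant P BR natural_form"
  show "invariant P (struct_const BR)"
    unfolding invariant_def
  proof (intro allI)
    fix x y z
    have "natural_form (BR (axis x 1) (axis y 1)) (axis z 1)
        - psign (P x * (P y + 1)) * natural_form (BR (axis x 1) (axis z 1)) (axis y 1) = 0"
      using ad[unfolded ad_invariant_def, rule_format, OF homogeneous_axis[of P x] homogeneous_axis[of P y], of "axis z 1"]
        natural_form_skew[of "axis y 1"] by simp
    then show "trilinear (struct_const BR) x y z = psign (P x * (P y + 1)) * trilinear (struct_const BR) x z y"
      unfolding natural_form_bracket[OF assms] sum_axis3 by simp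
  qed
next
  assume inv: "invariant P (struct_const BR)"
  show "ad_invariant P BR natural_form"
    unfolding ad_invariant_def
  proof (intro allI impI)
    fix a b u v w
    assume u: "homogeneous P a u" and v: "homogeneous P b v"
    have "natural_form (BR u v) w = (\<Sum>x\<in>UNIV. \<Sum>y\<in>UNIV. \<Sum>z\<in>UNIV.
        psign (a * (b + 1)) * (u $ x * w $ z * v $ y * trilinear (struct_const BR) x z y))"
      unfolding natural_form_bracket[OF assms]
    proof (intro sum.cong refl)
      fix x y z
      show "u $ x * v $ y * w $ z * trilinear (struct_const BR) x y z =
        psign (a * (b + 1)) * (u $ x * w $ z * v $ y * trilinear (struct_const BR) x z y)"
      proof (cases "u $ x = 0 \<or> v $ y = 0")
        case False
        then have "P x = a" "P y = b" using u v by (auto simp: homogeneous_def)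
        moreover have "trilinear (struct_const BR) x y z = psign (P x * (P y + 1)) * trilinear (struct_const BR) x z y"
          using inv unfolding invariant_def by blast
        ultimately show ?thesis by simp
      qed auto
    qed
    also have "\<dots> = psign (a * (b + 1)) * natural_form (BR u w) v"
      unfolding natural_form_bracket[OF assms] sum_distrib_left
      by (intro sum.cong refl sum.swap)
    finally show "natural_form (BR u v) w + psign (a * (b + 1)) * natural_form v (BR u w) = 0"
      using natural_form_skew[of v] by simp
  qed
qed

text \<open>Both orders in the symmetric product contribute equally by skew-symmetry of the dual
  bracket, which absorbs the 1/2; the parity rule then reduces the sign to
  \<open>psign (p a)\<close>.\<close>

lemma odd_cobracket_component:
  assumes f: "super_skew (shifted p) (struct_const brs)"
  shows "odd_cobracket p brs u $ a $ b = (\<Sum>k\<in>UNIV. u $ k * cobracket_const p (struct_const brs) k a b)"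
proof -
  have 1: "(\<Sum>i\<in>UNIV. \<Sum>j\<in>UNIV. P_coeff p brs k i j * sym_prod p (axis j 1) (axis i 1) $ a $ b) =
      1/2 * (P_coeff p brs k b a + psign (p a * p b) * P_coeff p brs k a b)" for k
  proof -
    have "(\<Sum>i\<in>UNIV. \<Sum>j\<in>UNIV. P_coeff p brs k i j * sym_prod p (axis j 1) (axis i 1) $ a $ b) =
      (\<Sum>i\<in>UNIV. \<Sum>j\<in>UNIV. (if b = i then if a = j then 1/2 * P_coeff p brs k i j else 0 else 0)
        + (if a = i then if b = j then 1/2 * (psign (p a * p b) * P_coeff p brs k i j) else 0 else 0))"
      by (intro sum.cong refl) (auto simp: sym_prod_def axis_def algebra_simps)
    then show ?thesis
      by (simp add: sum.distrib sum_delta2 distrib_left)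
  qed
  have 2: "psign (p k) * (1/2 * (P_coeff p brs k b a + psign (p a * p b) * P_coeff p brs k a b)) =
      cobracket_const p (struct_const brs) k a b" for k
  proof (cases "struct_const brs b a k = 0")
    case True
    then show ?thesis
      using super_skew_swap[OF f, of a b k] by (simp add: P_coeff_def cobracket_const_def struct_const_def)
  next
    case False
    then have "p k + 1 = (p b + 1) + (p a + 1)"
      using super_skew_parity[OF f, of b a k] by simp
    then show ?thesis
      using super_skew_swap[OF f, of a b k]
      by (cases "p k"; cases "p a"; cases "p b") (simp_all add: P_coeff_def cobracket_const_def struct_const_def)
  qed
  show ?thesis
    unfolding 2[symmetric] 1[symmetric] by (simp add: odd_cobracket_def mult.assoc)
qed

lemma rho_component: "rho p $ x $ y = rho_const x y"
proof -
  have "psign ((p i + 1) * p i) = 1" for i by (cases "p i") simp_all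
  then have "sym_prod (double_parity p) (axis (Inl i) 1) (axis (Inr i) 1) $ x $ y =
      (case x of Inl a \<Rightarrow> if a = i then rho_const x y else 0 | Inr a \<Rightarrow> if a = i then rho_const x y else 0)" for i
    by (cases x; cases y) (auto simp: sym_prod_def axis_def rho_const_def)
  then show ?thesis
    by (cases x) (simp_all add: rho_def)
qed

lemma ad_tensor_component:
  assumes bil: "bilinear BR" and u: "homogeneous P a u"
  shows "ad_tensor P BR a u t $ x $ y = (\<Sum>k\<in>UNIV. u $ k * ad_tensor_const P (struct_const BR) k (\<lambda>x y. t $ x $ y) x y)"
proof -
  have "ad_tensor P BR a u t $ x $ y =
      (\<Sum>i\<in>UNIV. t $ i $ y * BR u (axis i 1) $ x) + psign (a * P x) * (\<Sum>j\<in>UNIV. t $ x $ j * BR u (axis j 1) $ y)"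
  proof -
    have "ad_tensor P BR a u t $ x $ y = (\<Sum>i\<in>UNIV. \<Sum>j\<in>UNIV.
        (if y = j then t $ i $ j * BR u (axis i 1) $ x else 0)
        + (if x = i then psign (a * P i) * (t $ i $ j * BR u (axis j 1) $ y) else 0))"
      unfolding ad_tensor_def
      by (simp, intro sum.cong refl) (auto simp: tensor_def axis_def algebra_simps)
    also have "\<dots> = (\<Sum>i\<in>UNIV. t $ i $ y * BR u (axis i 1) $ x) +
        (\<Sum>j\<in>UNIV. \<Sum>i\<in>UNIV. (if x = i then psign (a * P i) * (t $ i $ j * BR u (axis j 1) $ y) else 0))"
      unfolding sum.distrib by (subst (3) sum.swap) simp
    finally show ?thesis by (simp add: sum_distrib_left)
  qed
  also have "\<dots> = (\<Sum>k\<in>UNIV. u $ k * (\<Sum>i\<in>UNIV. struct_const BR k i x * t $ i $ y))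
      + (\<Sum>k\<in>UNIV. u $ k * (psign (P k * P x) * (\<Sum>j\<in>UNIV. struct_const BR k j y * t $ x $ j)))"
  proof -
    have "(\<Sum>i\<in>UNIV. t $ i $ y * BR u (axis i 1) $ x) = (\<Sum>k\<in>UNIV. u $ k * (\<Sum>i\<in>UNIV. struct_const BR k i x * t $ i $ y))"
      unfolding bracket_axis_right[OF bil] sum_distrib_left
      by (subst sum.swap) (simp add: mult_ac)
    moreover have "psign (a * P x) * (\<Sum>j\<in>UNIV. t $ x $ j * BR u (axis j 1) $ y) =
        (\<Sum>k\<in>UNIV. psign (a * P x) * (u $ k * (\<Sum>j\<in>UNIV. struct_const BR k j y * t $ x $ j)))"
      unfolding bracket_axis_right[OF bil] sum_distrib_left
      by (subst sum.swap) (simp add: mult_ac)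
    moreover have "psign (a * P x) * (u $ k * s) = u $ k * (psign (P k * P x) * s)" for k s
      using u by (cases "u $ k = 0") (auto simp: homogeneous_def)
    ultimately show ?thesis by simp
  qed
  finally show ?thesis
    by (simp add: ad_tensor_const_def distrib_left sum.distrib)
qed

lemma cobracket_is_coboundary_iff:
  assumes bil: "bilinear BR" and f: "super_skew (shifted P) (struct_const BRS)"
    and P: "P = double_parity p"
  shows "cobracket_is_coboundary P BR BRS (rho p) \<longleftrightarrow>
    (\<forall>k x y. cobracket_const P (struct_const BRS) k x y = psign (P k) * ad_tensor_const P (struct_const BR) k rho_const x y)"
proof -
  have eq: "odd_cobracket P BRS u = psign a *\<^sub>R ad_tensor P BR a u (rho p) \<longleftrightarrow>
      (\<forall>x y. (\<Sum>k\<in>UNIV. u $ k * cobracket_const P (struct_const BRS) k x y) =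
        (\<Sum>k\<in>UNIV. u $ k * (psign (P k) * ad_tensor_const P (struct_const BR) k rho_const x y)))"
    if u: "homogeneous P a u" for a u
  proof -
    have *: "psign a * (u $ k * s) = u $ k * (psign (P k) * s)" for k s
      using u by (cases "u $ k = 0") (auto simp: homogeneous_def)
    show ?thesis
      by (simp add: vec_eq_iff odd_cobracket_component[OF f] ad_tensor_component[OF bil u]
          rho_component[abs_def] sum_distrib_left *)
  qed
  show ?thesis
  proof
    assume "cobracket_is_coboundary P BR BRS (rho p)"
    then have "odd_cobracket P BRS (axis k 1) = psign (P k) *\<^sub>R ad_tensor P BR (P k) (axis k 1) (rho p)" for k
      unfolding cobracket_is_coboundary_def using homogeneous_axis by blast
    then show "\<forall>k x y. cobracket_const P (struct_const BRS) k x y = psign (P k) * ad_tensor_const P (struct_const BR) k rho_const x y"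
      unfolding eq[OF homogeneous_axis] sum_axis_left by blast
  next
    assume "\<forall>k x y. cobracket_const P (struct_const BRS) k x y = psign (P k) * ad_tensor_const P (struct_const BR) k rho_const x y"
    then show "cobracket_is_coboundary P BR BRS (rho p)"
      unfolding cobracket_is_coboundary_def by (simp add: eq)
  qed
qed

section \<open>The two inclusions and the double\<close>

lemma in_g_axis: "in_g (axis i 1) = axis (Inl i) 1"
  by (auto simp: in_g_def vec_eq_iff axis_def split: sum.split)

lemma in_dual_axis: "in_dual (axis i 1) = axis (Inr i) 1"
  by (auto simp: in_dual_def vec_eq_iff axis_def split: sum.split)

lemma in_g_nth [simp]: "in_g u $ Inl i = u $ i" "in_g u $ Inr i = 0"
  by (simp_all add: in_g_def)

lemma in_dual_nth [simp]: "in_dual u $ Inl i = 0" "in_dual u $ Inr i = u $ i"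
  by (simp_all add: in_dual_def)

lemma vec_sum_eq_iff: "(u :: real^('a::finite + 'b::finite)) = v \<longleftrightarrow>
    (\<forall>i. u $ Inl i = v $ Inl i) \<and> (\<forall>i. u $ Inr i = v $ Inr i)"
  unfolding vec_eq_iff by (metis sum.exhaust)

theorem theorem6p1:
  fixes p :: "'i::finite \<Rightarrow> bit"
    and br brs :: "real^'i \<Rightarrow> real^'i \<Rightarrow> real^'i"
  assumes "odd_lie_bialgebra p br brs"
  shows "\<exists>!D :: (real^('i + 'i) \<Rightarrow> real^('i + 'i) \<Rightarrow> real^('i + 'i)) \<times>
                (real^('i + 'i) \<Rightarrow> real^('i + 'i) \<Rightarrow> real^('i + 'i)).
           case D of (BR, BRS) \<Rightarrow>
             odd_lie_bialgebra (double_parity p) BR BRS \<and>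
             (\<forall>u v. BR (in_g u) (in_g v) = in_g (br u v)) \<and>
             (\<forall>u v. BR (in_dual u) (in_dual v) = in_dual (brs u v)) \<and>
             ad_invariant (double_parity p) BR natural_form \<and>
             cobracket_is_coboundary (double_parity p) BR BRS (rho p)"
proof -
  let ?P = "double_parity p"
  define c where "c = struct_const br"
  define f where "f = struct_const brs"
  have lie: "lie_superalgebra p br" "lie_superalgebra (shifted p) brs" and coc: "cocycle p c f"
    using assms unfolding odd_lie_bialgebra_iff c_def f_def by auto
  then have bil: "bilinear br" "bilinear brs"
    by (simp_all add: lie_superalgebra_def)
  have lc: "lie_consts p c" and lf: "lie_consts (shifted p) f"
    unfolding c_def f_def by (intro lie_superalgebra_lie_consts lie)+
  then have sc: "super_skew p c" and sf: "super_skew (shifted p) f"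
    by (simp_all add: lie_consts_def)
  define BR where "BR = bracket_of (double_const p c f)"
  define BRS where "BRS = bracket_of (sum_const f c)"
  note C = lie_consts_double_const[OF lc lf coc]
  note cobracket_const = cobracket_const_sum_const[OF sc sf]
  show ?thesis
  proof (rule ex1I[of _ "(BR, BRS)"], unfold prod.case, intro conjI allI)
    show "odd_lie_bialgebra ?P BR BRS"
      unfolding odd_lie_bialgebra_iff BR_def BRS_def struct_const_bracket_of
    proof (intro conjI lie_superalgebra_bracket_of C lie_consts_sum_const[OF lc lf])
      \<comment> \<open>The constructed cobracket is the coboundary of \<open>rho_const\<close>, so
        it is a cocycle.\<close>
      show "cocycle ?P (double_const p c f) (sum_const f c)"
        using C cobracket_const by (intro cocycle_coboundary) (auto simp: lie_consts_def)
    qed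
    show "BR (in_g u) (in_g v) = in_g (br u v)" for u v
      by (simp add: vec_sum_eq_iff BR_def bracket_of_def sum_UNIV_sum bracket_component[OF bil(1)] c_def)
    show "BR (in_dual u) (in_dual v) = in_dual (brs u v)" for u v
      by (simp add: vec_sum_eq_iff BR_def bracket_of_def sum_UNIV_sum bracket_component[OF bil(2)] f_def)
    show "ad_invariant ?P BR natural_form"
      unfolding BR_def ad_invariant_iff[OF bilinear_bracket_of] struct_const_bracket_of
      by (rule invariant_double_const[OF sc sf])
    show "cobracket_is_coboundary ?P BR BRS (rho p)"
      using cobracket_const super_skew_sum_const[OF sc sf]
      by (simp add: BR_def BRS_def cobracket_is_coboundary_iff[OF bilinear_bracket_of _ refl])
  next
    fix D :: "(real^('i + 'i) \<Rightarrow> real^('i + 'i) \<Rightarrow> real^('i + 'i)) \<times>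
                (real^('i + 'i) \<Rightarrow> real^('i + 'i) \<Rightarrow> real^('i + 'i))"
    obtain BR' BRS' where D: "D = (BR', BRS')" by (cases D)
    assume "case D of (BR, BRS) \<Rightarrow>
             odd_lie_bialgebra (double_parity p) BR BRS \<and>
             (\<forall>u v. BR (in_g u) (in_g v) = in_g (br u v)) \<and>
             (\<forall>u v. BR (in_dual u) (in_dual v) = in_dual (brs u v)) \<and>
             ad_invariant (double_parity p) BR natural_form \<and>
             cobracket_is_coboundary (double_parity p) BR BRS (rho p)"
    then have bialg: "odd_lie_bialgebra ?P BR' BRS'"
      and g: "\<And>u v. BR' (in_g u) (in_g v) = in_g (br u v)"
      and dual: "\<And>u v. BR' (in_dual u) (in_dual v) = in_dual (brs u v)"
      and ad: "ad_invariant ?P BR' natural_form"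
      and cob: "cobracket_is_coboundary ?P BR' BRS' (rho p)"
      unfolding D by auto
    have lie': "lie_superalgebra ?P BR'" "lie_superalgebra (shifted ?P) BRS'"
      using bialg unfolding odd_lie_bialgebra_iff by auto
    then have bil': "bilinear BR'" "bilinear BRS'"
      by (simp_all add: lie_superalgebra_def)
    have skew': "super_skew ?P (struct_const BR')" "super_skew (shifted ?P) (struct_const BRS')"
      using lie'[THEN lie_superalgebra_lie_consts] by (simp_all add: lie_consts_def)
    \<comment> \<open>The two subalgebra conditions fix the brackets within each summand, and
      invariance fixes the mixed ones.\<close>
    have C': "struct_const BR' = double_const p c f"
      using g[of "axis _ 1" "axis _ 1"] dual[of "axis _ 1" "axis _ 1"]
      by (intro double_const_unique[OF skew'(1) ad[unfolded ad_invariant_iff[OF bil'(1)]]])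
        (simp_all add: struct_const_def c_def f_def flip: in_g_axis in_dual_axis)
    \<comment> \<open>The coboundary depends only on the bracket, which is known by now; it
      determines the cobracket, and that determines the dual bracket because the sign between them
      is invertible.\<close>
    have "cobracket_const ?P (struct_const BRS') k x y = cobracket_const ?P (sum_const f c) k x y" for k x y
      using cob unfolding cobracket_is_coboundary_iff[OF bil'(1) skew'(2) refl] C' cobracket_const by blast
    then have "struct_const BRS' = sum_const f c"
      by (simp add: fun_eq_iff cobracket_const_def)
    with C' show "D = (BR, BRS)"
      using bracket_of_struct_const[OF bil'(1)] bracket_of_struct_const[OF bil'(2)]
      by (simp add: D BR_def BRS_def)
  qed
qed

end
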